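(* The series $\displaystyle\sum_{n=0}^{\infty} \frac{1}{(2n+1)^3 \binom{2n}{n}}$ equals \[ \frac{32\mathcal{G}}{3} - \frac{4\pi \operatorname{Li}_2\bigl(2-\sqrt{3}\bigr)}{3} -\frac{\pi^3}{9} - \frac{\pi \bigl(\log 2-\log(2+\sqrt3)\bigr)^2}{3}, \] where $\mathcal G=\operatorname{Im}\operatorname{Li}_3\bigl(\frac{1+i}{2}\bigr)$. Moreover, this number belongs to the $\mathbb Q$-vector space $i\,\mathfrak Z_3(12)$.
   Context: For $|z|\le 1$ and integer $s\ge 2$ (or $|z|<1$, $s=1$), $\operatorname{Li}_s(z)=\sum_{n\ge1} z^n/n^s$. For positive integers $s_1,\dots,s_m$ and complex $z_1,\dots,z_m$, define (when convergent) $\operatorname{Li}_{s_1,\dots,s_m}(z_1,\dots,z_m)=\sum_{n_1>\cdots>n_m\ge1} \frac{z_1^{n_1}\cdots z_m^{n_m}}{n_1^{s_1}\cdots n_m^{s_m}}$. For positive integers $k,N$, $\mathfrak Z_k(N)$ denotes the $\mathbb Q$-linear span of all $\operatorname{Li}_{s_1,\dots,s_m}(z_1,\dots,z_m)$ with $s_j\in\mathbb Z_{>0}$, $\sum_j s_j=k$, $z_j^N=1$ for all $j$, and $(s_1,z_1)\ne(1,1)$ (cyclotomic multiple zeta values of weight $k$ and level $N$); $\mathfrak Z_0(N)=\mathbb Q$. $i\,\mathfrak Z_3(12)=\{ix: x\in\mathfrak Z_3(12)\}$. *)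

theory Defs
  imports "HOL-Analysis.Analysis"
begin

definition polylog :: "nat \<Rightarrow> 'a::real_normed_field \<Rightarrow> 'a" where
  "polylog s z = (\<Sum>n. z ^ Suc n / of_nat (Suc n) ^ s)"

text \<open>Truncated multiple polylogarithm:
  mpl_trunc [s1,..,sm] [z1,..,zm] N = sum over N >= n1 > n2 > ... > nm >= 1
  of z1^n1 ... zm^nm / (n1^s1 ... nm^sm).\<close>
fun mpl_trunc :: "nat list \<Rightarrow> complex list \<Rightarrow> nat \<Rightarrow> complex" where
  "mpl_trunc [] [] N = 1"
| "mpl_trunc (s # ss) (z # zs) N =
     (\<Sum>n\<in>{1..N}. z ^ n / of_nat n ^ s * mpl_trunc ss zs (n - 1))"
| "mpl_trunc _ _ N = 0"

definition mpl :: "nat list \<Rightarrow> complex list \<Rightarrow> complex" where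
  "mpl s z = lim (\<lambda>N. mpl_trunc s z N)"

text \<open>Admissible indices for cyclotomic MZVs of weight k and level N.
  The empty index (value 1) is admissible exactly in weight 0, giving Z_0(N) = Q.\<close>
definition cmzv_index :: "nat \<Rightarrow> nat \<Rightarrow> nat list \<Rightarrow> complex list \<Rightarrow> bool" where
  "cmzv_index k N s z \<longleftrightarrow>
     length s = length z \<and> (\<forall>j\<in>set s. j > 0) \<and> sum_list s = k \<and>
     (\<forall>w\<in>set z. w ^ N = 1) \<and> (s \<noteq> [] \<longrightarrow> (hd s, hd z) \<noteq> (1, 1)) \<and>
     convergent (\<lambda>M. mpl_trunc s z M)"

definition cmzv_space :: "nat \<Rightarrow> nat \<Rightarrow> complex set" where
  "cmzv_space k N = {x. \<exists>A c. finite A \<and> (\<forall>(s, z)\<in>A. cmzv_index k N s z) \<and>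
       x = (\<Sum>(s, z)\<in>A. of_rat (c (s, z)) * mpl s z)}"

end

theory Submission
  imports Defs "HOL-Analysis.Analysis"
begin

text \<open>By the arcsine series the sum is the value at \<open>\<pi>/6\<close> of a function \<open>S\<close> with \<open>S(0) = 0\<close> and
  \<open>S'(\<theta>) = - 2 \<theta> ln (2 sin \<theta>) / sin \<theta>\<close>, and \<open>S\<close> is found by integrating \<open>S'\<close> in two ways.

  With \<open>tan (\<theta>/2) = t\<^sup>2\<close> it has a primitive built from dilogarithms and trilogarithms at rational functions
  of \<open>t cis (\<pi>/4)\<close>. At the endpoint, \<open>t\<^sup>2 = tan (\<pi>/12) = 2 - \<surd>3\<close>, the trilogarithms are evaluated by
  the duplication formula and a functional equation along the curve \<open>cis t / (2 cos t)\<close>. This is the closed form.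

  On the other hand \<open>S/4\<close> is the boundary value on the unit circle of the imaginary part of
  \<open>\<Phi>(x) = \<Sum> H\<^sub>n x\<^bsup>2n+1\<^esup> / (2n+1)\<^sup>2 - Ln x \<Sum> H\<^sub>n x\<^bsup>2n+1\<^esup> / (2n+1)\<close>. At \<open>cis (\<pi>/6)\<close> the two sums are double
  polylogarithms at twelfth roots of unity, because \<open>H\<^sub>n = \<Sum>\<^sub>j (1 + (-1)\<^sup>j) / j\<close> over \<open>1 \<le> j \<le> 2n\<close>, while
  \<open>\<i>\<pi>\<close> has weight 1 and level 4; the stuffle product then gives the membership.\<close>

section \<open>Polylogarithms on the closed unit disc\<close>

text \<open>Why r = t cis(pi/4) rather than tan(\<theta>/2): the logarithm of 1 - i tan(\<theta>/2)
  = (1 - r)(1 + r) splits, and at the endpoint the factors are simpler than their product. There 1 +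
  r has modulus sqrt 2 and argument pi/12, and (1 - r)/(1 + r) is the conjugate of r. Because of
  this coincidence the trilogarithms at r, -r and r^2 cancel, and only points of modulus 1/sqrt 2
  remain; the relation along cis t / (2 cos t), taken at t = pi/4, reduces those to (1 + i)/2.
  Catalan's constant, brought in by Li_2 at imaginary arguments, cancels too.

  The obstacle in the functional equations is the choice of branches. They are therefore stated for
  real combinations corrected by logarithms, and each is proved by a vanishing derivative along a
  curve where the logarithms of z and 1 - z are explicit; the constant is read off at an end of the
  curve, often on the unit circle.

  For the membership, the obstacle is that the sum with denominators 2n+1 converges only
  conditionally at cis(pi/6). Its value is reached radially, by Abel's theorem for the series and
  dominated convergence for the integral.\<close>

lemma summable_polylog_bound: "2 \<le> s \<Longrightarrow> summable (\<lambda>n. 1 / real (Suc n) ^ s)"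
proof -
  assume "2 \<le> s"
  hence "summable (\<lambda>n. 1 / real n ^ s)"
    using inverse_power_summable[of s, where ?'a = real] by (simp add: divide_inverse)
  thus ?thesis by (subst (asm) summable_Suc_iff[symmetric])
qed

lemma summable_polylog:
  fixes z :: "'a::{real_normed_field,banach}"
  assumes "2 \<le> s" "norm z \<le> 1"
  shows "summable (\<lambda>n. z ^ Suc n / of_nat (Suc n) ^ s)"
proof (rule summable_comparison_test'[OF summable_polylog_bound[OF assms(1)]])
  fix n
  have "norm (z ^ Suc n) \<le> 1"
    using assms(2) unfolding norm_power by (rule power_le_one[OF norm_ge_zero])
  thus "norm (z ^ Suc n / of_nat (Suc n) ^ s) \<le> 1 / real (Suc n) ^ s"
    by (simp only: norm_divide norm_power norm_of_nat) (intro divide_right_mono; simp)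
qed

lemma polylog_sums:
  fixes z :: "'a::{real_normed_field,banach}"
  assumes "2 \<le> s" "norm z \<le> 1"
  shows "(\<lambda>n. z ^ Suc n / of_nat (Suc n) ^ s) sums polylog s z"
  unfolding polylog_def by (rule summable_sums[OF summable_polylog[OF assms]])

text \<open>The majorant 1/n^s does not depend on z, so convergence is uniform up to the unit
  circle. Later identities rely on this, since their constants are often read off at points of
  modulus 1.\<close>

lemma continuous_on_polylog:
  fixes s :: nat
  assumes "2 \<le> s"
  shows "continuous_on (cball 0 1) (polylog s :: 'a::{real_normed_field,banach} \<Rightarrow> 'a)"
proof -
  have "uniform_limit (cball 0 1) (\<lambda>n z. \<Sum>i<n. z ^ Suc i / of_nat (Suc i) ^ s)
      (polylog s :: 'a \<Rightarrow> 'a) sequentially"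
    unfolding polylog_def
  proof (rule Weierstrass_m_test[OF _ summable_polylog_bound[OF assms]])
    fix n and z :: 'a assume "z \<in> cball 0 1"
    hence "norm (z ^ Suc n) \<le> 1"
      unfolding norm_power by (intro power_le_one) auto
    thus "norm (z ^ Suc n / of_nat (Suc n) ^ s) \<le> 1 / real (Suc n) ^ s"
      by (simp only: norm_divide norm_power norm_of_nat) (intro divide_right_mono; simp)
  qed
  thus ?thesis
    by (rule uniform_limit_theorem[rotated]) (auto intro!: always_eventually continuous_intros simp del: power_Suc of_nat_Suc)
qed

lemma summable_polylog_inside:
  fixes z :: "'a::{real_normed_field,banach}"
  assumes "norm z < 1"
  shows "summable (\<lambda>n. z ^ n / of_nat (Suc n) ^ s)"
proof (rule summable_comparison_test'[OF summable_geometric[of "norm z"]])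
  fix n
  have "norm (z ^ n) / real (Suc n) ^ s \<le> norm (z ^ n) / 1"
    by (intro divide_left_mono) (auto intro!: one_le_power)
  thus "norm (z ^ n / of_nat (Suc n) ^ s) \<le> norm z ^ n"
    by (simp only: norm_divide norm_power norm_of_nat div_by_1)
qed (use assms in auto)

lemma DERIV_polylog:
  fixes z :: "'a::{real_normed_field,banach}"
  assumes z: "norm z < 1" and "z \<noteq> 0"
  shows "(polylog (Suc s) has_field_derivative polylog s z / z) (at z)"
proof -
  \<comment> \<open>The constant coefficient 0 undoes the index shift in \<open>polylog\<close> and
    yields an ordinary power series, which can be differentiated termwise.\<close>
  define c :: "nat \<Rightarrow> 'a" where "c n = (if n = 0 then 0 else 1 / of_nat n ^ Suc s)" for n
  have c_Suc: "(\<Sum>n. c n * w ^ n) = polylog (Suc s) w" if "norm w < 1" for w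
  proof -
    have "summable (\<lambda>n. c (Suc n) * w ^ Suc n)"
      using summable_mult[OF summable_polylog_inside[OF that, of "Suc s"], of w]
      by (simp add: c_def field_simps del: of_nat_Suc)
    hence "summable (\<lambda>n. c n * w ^ n)"
      by (subst (asm) summable_Suc_iff)
    from suminf_split_head[OF this] show ?thesis
      by (simp add: c_def polylog_def field_simps del: of_nat_Suc)
  qed
  obtain K where K: "norm z < K" "K < 1" using dense[OF z] by blast
  hence nK: "norm (of_real K :: 'a) = K" using norm_ge_zero[of z] by (simp del: norm_ge_zero)
  have sK: "summable (\<lambda>n. c n * of_real K ^ n)"
  proof -
    have "summable (\<lambda>n. c (Suc n) * (of_real K :: 'a) ^ Suc n)"
      using summable_mult[OF summable_polylog_inside[of "of_real K :: 'a" "Suc s"], of "of_real K"] nK K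
      by (simp add: c_def field_simps del: of_nat_Suc)
    thus ?thesis by (subst (asm) summable_Suc_iff)
  qed
  have "((\<lambda>x. \<Sum>n. c n * x ^ n) has_field_derivative (\<Sum>n. diffs c n * z ^ n)) (at z)"
    by (rule termdiffs_strong[OF sK]) (use nK K in simp)
  moreover have "(\<Sum>n. diffs c n * z ^ n) = polylog s z / z"
  proof -
    have "diffs c n * z ^ n = z ^ n / of_nat (Suc n) ^ s" for n
      by (simp add: diffs_def c_def del: of_nat_Suc)
    moreover have "polylog s z = z * (\<Sum>n. z ^ n / of_nat (Suc n) ^ s)"
      unfolding polylog_def
      by (subst suminf_mult[OF summable_polylog_inside[OF z], symmetric]) simp
    ultimately show ?thesis using \<open>z \<noteq> 0\<close> by simp
  qed
  ultimately have "((\<lambda>x. \<Sum>n. c n * x ^ n) has_field_derivative polylog s z / z) (at z)"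
    by simp
  thus ?thesis
    by (rule has_field_derivative_transform_within_open[where S = "ball 0 1"]) (use z c_Suc in auto)
qed

lemma polylog_1_sums:
  fixes z :: complex
  assumes "norm z < 1"
  shows "(\<lambda>n. z ^ Suc n / of_nat (Suc n)) sums - Ln (1 - z)"
proof -
  have "(\<lambda>n. - (z ^ n) / of_nat n) sums ln (1 + - z)"
    using Ln_series'[of "- z"] assms by simp
  hence "(\<lambda>n. z ^ n / of_nat n) sums - ln (1 - z)"
    using sums_minus by fastforce
  thus ?thesis by (subst sums_Suc_iff) simp
qed

lemma polylog_1:
  fixes z :: complex
  assumes "norm z < 1"
  shows "polylog 1 z = - Ln (1 - z)"
  using polylog_1_sums[OF assms] by (simp add: polylog_def sums_iff)

lemma polylog_of_real:
  fixes x :: real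
  assumes "2 \<le> s" "\<bar>x\<bar> \<le> 1"
  shows "polylog s (complex_of_real x) = of_real (polylog s x)"
proof -
  have "(\<lambda>n. complex_of_real (x ^ Suc n / of_nat (Suc n) ^ s)) sums of_real (polylog s x)"
    by (rule sums_of_real[OF polylog_sums]) (use assms in auto)
  thus ?thesis by (simp add: polylog_def sums_iff)
qed

lemma polylog_cnj:
  assumes "2 \<le> s" "norm z \<le> 1"
  shows "polylog s (cnj z) = cnj (polylog s z)"
proof -
  have "(\<lambda>n. cnj (z ^ Suc n / of_nat (Suc n) ^ s)) sums cnj (polylog s z)"
    using polylog_sums[OF assms] by (simp only: sums_cnj)
  thus ?thesis by (simp add: polylog_def sums_iff)
qed

lemma polylog_0 [simp]: "polylog s (0 :: 'a::{real_normed_field,banach}) = 0"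
  by (simp add: polylog_def)

lemma polylog_2_1: "polylog 2 (1 :: 'a::{real_normed_field,banach}) = of_real (pi\<^sup>2 / 6)"
proof -
  have "(\<lambda>n. of_real (1 / (real n + 1)\<^sup>2) :: 'a) sums of_real (pi\<^sup>2 / 6)"
    by (rule sums_of_real) (use inverse_squares_sums in \<open>simp add: add.commute\<close>)
  thus ?thesis by (simp add: polylog_def sums_iff add_ac)
qed

text \<open>In the sum over the powers of a primitive root of unity only the multiples of \<open>N\<close> survive.\<close>

lemma polylog_distribution:
  fixes z \<omega> :: complex
  assumes s: "2 \<le> s" and z: "norm z \<le> 1" and N: "0 < N" and \<omega>: "\<And>n. \<omega> ^ n = 1 \<longleftrightarrow> N dvd n"
  shows "(\<Sum>k<N. polylog s (\<omega> ^ k * z)) = of_nat N / of_nat N ^ s * polylog s (z ^ N)"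
proof -
  have "norm \<omega> ^ N = 1" using \<omega>[of N] by (simp flip: norm_power)
  hence "norm \<omega> = 1" using N power_eq_imp_eq_base[of "norm \<omega>" N 1] by simp
  hence n\<omega>: "norm (\<omega> ^ k * z) \<le> 1" for k using z by (simp add: norm_mult norm_power)
  have nzN: "norm (z ^ N) \<le> 1" using z by (simp add: norm_power power_le_one)
  define f where "f n = (if n = 0 then 0 else (\<Sum>k<N. (\<omega> ^ k * z) ^ n / of_nat n ^ s))" for n
  have "(\<lambda>n. f (Suc n)) sums (\<Sum>k<N. polylog s (\<omega> ^ k * z))"
    unfolding f_def using sums_sum[of "{..<N}", OF polylog_sums[OF s n\<omega>]] by simp
  hence A: "f sums (\<Sum>k<N. polylog s (\<omega> ^ k * z))"
    by (subst (asm) sums_Suc_iff) (simp add: f_def)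
  have f_eq: "f n = (if N dvd n \<and> n \<noteq> 0 then of_nat N * z ^ n / of_nat n ^ s else 0)" for n
  proof (cases "N dvd n")
    case False
    have "(\<omega> ^ n) ^ N = 1" using \<omega>[of "n * N"] by (simp add: power_mult)
    hence "(\<Sum>k<N. (\<omega> ^ n) ^ k) = 0" using False \<omega>[of n] by (simp add: geometric_sum)
    hence "(\<Sum>k<N. (\<omega> ^ n) ^ k * (z ^ n / of_nat n ^ s)) = 0"
      by (simp only: sum_distrib_right[symmetric] mult_zero_left)
    moreover have "(\<omega> ^ k * z) ^ n / of_nat n ^ s = (\<omega> ^ n) ^ k * (z ^ n / of_nat n ^ s)" for k
      by (simp add: power_mult_distrib power_mult[symmetric] mult.commute[of n k])
    ultimately have "(\<Sum>k<N. (\<omega> ^ k * z) ^ n / of_nat n ^ s) = 0" by (simp only:)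
    thus ?thesis using False by (simp add: f_def)
  next
    case True
    hence "(\<omega> ^ k) ^ n = 1" for k using \<omega>[of "k * n"] by (simp add: power_mult)
    thus ?thesis using True by (simp add: f_def power_mult_distrib)
  qed
  have B: "(\<lambda>n. f (N * n)) sums (\<Sum>k<N. polylog s (\<omega> ^ k * z))"
    by (subst sums_mono_reindex[of "\<lambda>n. N * n" f]) (use A N f_eq in \<open>auto simp: strict_mono_def\<close>)
  have "(\<lambda>n. of_nat N / of_nat N ^ s * ((z ^ N) ^ Suc n / of_nat (Suc n) ^ s))
      sums (of_nat N / of_nat N ^ s * polylog s (z ^ N))"
    by (intro sums_mult polylog_sums s nzN)
  moreover have "of_nat N / of_nat N ^ s * ((z ^ N) ^ Suc n / of_nat (Suc n) ^ s) = f (N * Suc n)" for n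
    using N by (simp add: f_eq power_mult power_mult_distrib of_nat_mult
        del: of_nat_Suc power_Suc mult_Suc_right)
  ultimately have "(\<lambda>n. f (N * Suc n)) sums (of_nat N / of_nat N ^ s * polylog s (z ^ N))" by simp
  hence "(\<lambda>n. f (N * n)) sums (of_nat N / of_nat N ^ s * polylog s (z ^ N))"
    by (subst (asm) sums_Suc_iff[of "\<lambda>n. f (N * n)"]) (simp add: f_def)
  thus ?thesis using B sums_unique2 by blast
qed

lemma polylog_duplication:
  fixes z :: complex
  assumes s: "2 \<le> s" and z: "norm z \<le> 1"
  shows "polylog s z + polylog s (- z) = 2 / 2 ^ s * polylog s (z\<^sup>2)"
proof -
  have "(-1) ^ n = (1 :: complex) \<longleftrightarrow> 2 dvd n" for n
    by (cases "even n") auto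
  from polylog_distribution[OF s z _ this] show ?thesis
    by (simp add: lessThan_nat_numeral add.commute)
qed

text \<open>Supplies the hypothesis of \<open>polylog_distribution\<close> for N = 3.\<close>

lemma cis_third_power_eq_1: "cis (2 * pi / 3) ^ n = 1 \<longleftrightarrow> 3 dvd n"
proof -
  have c: "cis (2 * pi / 3) = Complex (- 1 / 2) (sqrt 3 / 2)"
    by (auto simp: complex_eq_iff cos_120 sin_120)
  have c3: "cis (2 * pi / 3) ^ 3 = 1"
    unfolding Complex.DeMoivre by simp
  have c1: "cis (2 * pi / 3) \<noteq> 1" and c2: "cis (2 * pi / 3) ^ 2 \<noteq> 1"
    by (simp_all add: c complex_eq_iff power2_eq_square)
  have "cis (2 * pi / 3) ^ n = (cis (2 * pi / 3) ^ 3) ^ (n div 3) * cis (2 * pi / 3) ^ (n mod 3)"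
    by (metis div_mult_mod_eq mult.commute power_add power_mult)
  hence n: "cis (2 * pi / 3) ^ n = cis (2 * pi / 3) ^ (n mod 3)" unfolding c3 by simp
  consider "n mod 3 = 0" | "n mod 3 = 1" | "n mod 3 = 2" by linarith
  thus ?thesis
  proof cases
    case 1 thus ?thesis using n by (simp add: dvd_eq_mod_eq_0)
  next
    case 2 thus ?thesis using n c1 by (simp add: dvd_eq_mod_eq_0)
  next
    case 3 thus ?thesis using n c2 by (simp add: dvd_eq_mod_eq_0)
  qed
qed

section \<open>Modified dilogarithm and trilogarithm\<close>

text \<open>The product of logarithms is dictated by \<open>mod_trilog\<close>: differentiating Im
  Li_3 - ln|z| Im Li_2 along a curve leaves exactly this combination as the coefficient of d arg z.
  With \<open>ln 0 = 0\<close> the product vanishes at z = 0 and z = 1, in agreement with its limits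
  there.\<close>

definition mod_dilog :: "complex \<Rightarrow> real" where
  "mod_dilog z = Re (polylog 2 z) + ln (norm z) * ln (norm (1 - z))"

definition mod_trilog :: "complex \<Rightarrow> real" where
  "mod_trilog z = Im (polylog 3 z) - ln (norm z) * Im (polylog 2 z)"

lemma mod_dilog_cnj: "norm z \<le> 1 \<Longrightarrow> mod_dilog (cnj z) = mod_dilog z"
proof -
  have "norm (1 - cnj z) = norm (1 - z)" by (metis complex_cnj_diff complex_cnj_one complex_mod_cnj)
  thus "norm z \<le> 1 \<Longrightarrow> mod_dilog (cnj z) = mod_dilog z"
    by (simp add: mod_dilog_def polylog_cnj)
qed

lemma mod_trilog_cnj: "norm z \<le> 1 \<Longrightarrow> mod_trilog (cnj z) = - mod_trilog z"
  by (simp add: mod_trilog_def polylog_cnj)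

text \<open>The correction term distributes as Li_2 does: ln|z^2| = 2 ln|z| cancels the factor 1/2,
  and ln|1 - z^2| splits over (1 - z)(1 + z).\<close>

lemma mod_dilog_duplication:
  assumes "norm z \<le> 1" "z \<noteq> 0" "z\<^sup>2 \<noteq> 1"
  shows "mod_dilog z + mod_dilog (- z) = mod_dilog (z\<^sup>2) / 2"
proof -
  have *: "1 - z \<noteq> 0" "1 + z \<noteq> 0" using assms by (auto simp: power2_eq_1_iff add_eq_0_iff)
  have "(1 - z) * (1 + z) = 1 - z\<^sup>2" by (simp add: power2_eq_square algebra_simps)
  hence "norm (1 - z\<^sup>2) = norm (1 - z) * norm (1 + z)" by (metis norm_mult)
  moreover have "polylog 2 z + polylog 2 (- z) = polylog 2 (z\<^sup>2) / 2"
    using polylog_duplication[of 2 z] assms by simp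
  from arg_cong[OF this, of Re] have "Re (polylog 2 z) + Re (polylog 2 (- z)) = Re (polylog 2 (z\<^sup>2)) / 2"
    by simp
  ultimately show ?thesis using * assms
    by (simp add: mod_dilog_def norm_power ln_mult ln_realpow algebra_simps)
qed

lemma mod_trilog_duplication:
  assumes "norm z \<le> 1" "z \<noteq> 0"
  shows "mod_trilog z + mod_trilog (- z) = mod_trilog (z\<^sup>2) / 4"
proof -
  have "polylog 2 z + polylog 2 (- z) = polylog 2 (z\<^sup>2) / 2"
    "polylog 3 z + polylog 3 (- z) = polylog 3 (z\<^sup>2) / 4"
    using polylog_duplication[of 2 z] polylog_duplication[of 3 z] assms by simp_all
  from this[THEN arg_cong[where f = Im]]
  have "Im (polylog 2 (z\<^sup>2)) = 2 * Im (polylog 2 z) + 2 * Im (polylog 2 (- z))"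
    "Im (polylog 3 (z\<^sup>2)) = 4 * Im (polylog 3 z) + 4 * Im (polylog 3 (- z))"
    by simp_all
  thus ?thesis using assms
    by (simp add: mod_trilog_def norm_power ln_realpow algebra_simps)
qed

section \<open>Continuity of the modified functions on the closed disc\<close>

lemma xlnx_tendsto_0: "((\<lambda>x::real. x * ln x) \<longlongrightarrow> 0) (at_right 0)"
  using lim_ln_over_power by real_asymp

text \<open>A linear bound at 0, strong enough to absorb the factor ln|z| that accompanies this
  logarithm in \<open>mod_dilog\<close>.\<close>

lemma ln_norm_1_minus_bound:
  fixes z :: complex
  assumes "norm z \<le> 1 / 2"
  shows "\<bar>ln (norm (1 - z))\<bar> \<le> 2 * norm z"
proof -
  have "norm (1 - z) \<le> 1 + norm z" "1 - norm z \<le> norm (1 - z)"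
    using norm_triangle_ineq4[of 1 z] norm_triangle_ineq2[of 1 z] by auto
  moreover have "ln (1 + norm z) \<le> norm z" by (rule ln_add_one_self_le_self) simp
  moreover have "- ln (1 - norm z) \<le> 2 * norm z"
  proof -
    have "ln (1 / (1 - norm z)) \<le> 1 / (1 - norm z) - 1" using assms by (intro ln_le_minus_one) auto
    also have "\<dots> = norm z * (1 / (1 - norm z))" using assms by (simp add: field_simps)
    also have "\<dots> \<le> norm z * 2" using assms by (intro mult_left_mono) (auto simp: field_simps)
    finally show ?thesis using assms by (simp add: ln_div)
  qed
  moreover have "ln (norm (1 - z)) \<le> ln (1 + norm z)" "ln (1 - norm z) \<le> ln (norm (1 - z))"
  proof -
    have "0 < norm (1 - z)" "0 < 1 - norm z" using calculation(1,2) assms by auto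
    thus "ln (norm (1 - z)) \<le> ln (1 + norm z)" "ln (1 - norm z) \<le> ln (norm (1 - z))"
      using calculation(1,2) by (auto intro!: ln_mono)
  qed
  ultimately show ?thesis by linarith
qed

lemma isCont_norm_mult_ln: "isCont (\<lambda>z::complex. norm z * ln (norm z)) 0"
proof -
  have "((\<lambda>z::complex. norm z * ln (norm z)) \<longlongrightarrow> 0) (at 0)"
    by (rule filterlim_compose[OF xlnx_tendsto_0])
       (auto simp: filterlim_at intro!: tendsto_eq_intros eventually_at_ball' simp: eventually_at intro: exI[of _ 1])
  thus ?thesis by (simp add: isCont_def)
qed

text \<open>The product is dominated by a multiple of |z| |ln|z||, which tends to 0; the value at 0
  is 0 as well, because \<open>ln 0 = 0\<close>.\<close>

lemma isCont_0_mult_ln_norm: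
  fixes f :: "complex \<Rightarrow> real"
  assumes "\<And>z. norm z \<le> 1 / 2 \<Longrightarrow> \<bar>f z\<bar> \<le> C * norm z"
  shows "isCont (\<lambda>z. ln (norm z) * f z) 0"
proof -
  have "((\<lambda>z. ln (norm z) * f z) \<longlongrightarrow> 0) (at 0)"
  proof (rule Lim_null_comparison)
    show "\<forall>\<^sub>F z in at 0. norm (ln (norm z) * f z) \<le> C * \<bar>norm z * ln (norm z)\<bar>"
      unfolding eventually_at
    proof (intro exI[of _ "1/2"] conjI ballI impI)
      fix z :: complex assume "z \<noteq> 0 \<and> dist z 0 < 1 / 2"
      hence "\<bar>f z\<bar> \<le> C * norm z" using assms by simp
      from mult_left_mono[OF this abs_ge_zero[of "ln (norm z)"]]
      show "norm (ln (norm z) * f z) \<le> C * \<bar>norm z * ln (norm z)\<bar>" by (simp add: abs_mult mult_ac)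
    qed simp
    have "((\<lambda>z. C * \<bar>norm z * ln (norm z)\<bar>) \<longlongrightarrow> C * \<bar>0\<bar>) (at (0 :: complex))"
      using isCont_norm_mult_ln by (intro tendsto_intros) (simp add: isCont_def)
    thus "((\<lambda>z. C * \<bar>norm z * ln (norm z)\<bar>) \<longlongrightarrow> 0) (at (0 :: complex))" by simp
  qed
  thus ?thesis by (simp add: isCont_def)
qed

lemma isCont_ln_norm_mult_ln_norm: "isCont (\<lambda>z::complex. ln (norm z) * ln (norm (1 - z))) z"
proof -
  have 0: "isCont (\<lambda>z::complex. ln (norm z) * ln (norm (1 - z))) 0"
    by (rule isCont_0_mult_ln_norm[OF ln_norm_1_minus_bound])
  \<comment> \<open>The reflection z -> 1 - z swaps the two factors, so continuity at 1 is
    continuity at 0.\<close>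
  have "isCont ((\<lambda>z::complex. ln (norm z) * ln (norm (1 - z))) \<circ> (\<lambda>z. 1 - z)) 1"
    by (rule continuous_at_compose) (use 0 in \<open>auto intro!: continuous_intros\<close>)
  hence 1: "isCont (\<lambda>z::complex. ln (norm z) * ln (norm (1 - z))) 1"
    by (simp add: o_def mult.commute)
  show ?thesis
    using 0 1 by (cases "z = 0"; cases "z = 1") (auto intro!: continuous_intros)
qed

lemma continuous_on_mod_dilog: "continuous_on (cball 0 1) mod_dilog"
  unfolding mod_dilog_def
  by (intro continuous_intros continuous_on_polylog continuous_at_imp_continuous_on ballI
      isCont_ln_norm_mult_ln_norm) simp

text \<open>After splitting off one factor z the remaining series is bounded by zeta(2) = pi^2/6,
  which is below 2. The bound tames ln|z| Im Li_2(z) at 0.\<close>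

lemma norm_polylog_2_le:
  assumes "norm z \<le> 1" shows "norm (polylog 2 z :: complex) \<le> 2 * norm z"
proof -
  have "polylog 2 z = z * (\<Sum>n. z ^ n / of_nat (Suc n) ^ 2)"
  proof (cases "z = 0")
    case False
    have "summable (\<lambda>n. z ^ n / of_nat (Suc n) ^ 2)"
      using summable_mult[OF summable_polylog[of 2 z], of "1 / z"] assms False by (simp add: field_simps del: of_nat_Suc)
    from suminf_mult[OF this, of z] show ?thesis by (simp add: polylog_def)
  qed simp
  moreover have "norm (\<Sum>n. z ^ n / of_nat (Suc n) ^ 2) \<le> (\<Sum>n. 1 / (real n + 1)\<^sup>2)"
  proof (rule norm_suminf_le)
    fix n show "norm (z ^ n / of_nat (Suc n) ^ 2) \<le> 1 / (real n + 1)\<^sup>2"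
      using assms by (auto simp: norm_divide norm_power add.commute intro!: divide_right_mono power_le_one simp flip: of_nat_Suc simp del: of_nat_Suc)
  next
    show "summable (\<lambda>n. 1 / (real n + 1)\<^sup>2)" using inverse_squares_sums by (simp add: sums_iff add.commute)
  qed
  moreover have "(\<Sum>n. 1 / (real n + 1)\<^sup>2) = pi\<^sup>2 / 6" using inverse_squares_sums by (simp add: sums_iff add.commute)
  moreover have "pi\<^sup>2 / 6 \<le> 2"
    using pi_less_4 pi_approx power_mono[of pi "3.2" 2] by (simp add: power2_eq_square)
  ultimately show ?thesis
    using mult_left_mono[of "norm (\<Sum>n. z ^ n / of_nat (Suc n) ^ 2)" 2 "norm z"]
    by (simp add: norm_mult mult.commute)
qed

lemma continuous_on_mod_trilog: "continuous_on (cball 0 1) mod_trilog"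
proof -
  have "continuous_on (cball 0 1) (\<lambda>z. ln (norm z) * Im (polylog 2 z))"
    unfolding continuous_on_eq_continuous_within
  proof
    fix z :: complex assume z: "z \<in> cball 0 1"
    show "continuous (at z within cball 0 1) (\<lambda>z. ln (norm z) * Im (polylog 2 z))"
    proof (cases "z = 0")
      case True
      have "\<bar>Im (polylog 2 z)\<bar> \<le> 2 * norm z" if "norm z \<le> 1 / 2" for z :: complex
        using norm_polylog_2_le[of z] that abs_Im_le_cmod[of "polylog 2 z"] by simp
      from isCont_0_mult_ln_norm[OF this] show ?thesis
        using True by (auto intro: continuous_at_imp_continuous_within)
    next
      case False
      have "continuous (at z within cball 0 1) (polylog 2)"
        using continuous_on_polylog[of 2] z by (auto simp: continuous_on_eq_continuous_within)
      thus ?thesis using False by (intro continuous_intros) auto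
    qed
  qed
  thus ?thesis unfolding mod_trilog_def
    by (intro continuous_on_diff continuous_on_Im continuous_on_polylog) auto
qed

text \<open>Packages explicit logarithms \<rho> + i \<psi> of z and \<sigma> + i \<kappa> of 1 - z.
  The condition \<rho> < 0 puts z inside the open unit disc, and |\<kappa>| < pi makes \<sigma> + i
  \<kappa> the principal logarithm, so that Li_1(z) = -(\<sigma> + i \<kappa>). The angle \<psi> may
  be any lift, which allows values such as 3 t + pi.\<close>

definition polar_path ::
  "real set \<Rightarrow> (real \<Rightarrow> complex) \<Rightarrow> (real \<Rightarrow> real) \<Rightarrow> (real \<Rightarrow> real) \<Rightarrow> (real \<Rightarrow> real) \<Rightarrow> (real \<Rightarrow> real) \<Rightarrow> bool"
  where "polar_path T z \<rho> \<psi> \<sigma> \<kappa> \<longleftrightarrow> open T \<and> (\<forall>t\<in>T. \<rho> t < 0 \<and> \<bar>\<kappa> t\<bar> < pi \<and>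
     z t = exp (Complex (\<rho> t) (\<psi> t)) \<and> 1 - z t = exp (Complex (\<sigma> t) (\<kappa> t)))"

text \<open>The combinations \<^const>\<open>mod_dilog\<close> and \<^const>\<open>mod_trilog\<close> are chosen such that
  the imaginary part of the dilogarithm does not occur in their derivatives.\<close>

lemma
  assumes path: "polar_path T z \<rho> \<psi> \<sigma> \<kappa>" and t: "t \<in> T"
    and D: "(\<rho> has_real_derivative \<rho>') (at t)" "(\<psi> has_real_derivative \<psi>') (at t)"
           "(\<sigma> has_real_derivative \<sigma>') (at t)"
  shows DERIV_mod_dilog:
      "((\<lambda>t. mod_dilog (z t)) has_real_derivative \<rho> t * \<sigma>' + \<kappa> t * \<psi>') (at t)"
    and DERIV_mod_trilog:
      "((\<lambda>t. mod_trilog (z t)) has_real_derivative mod_dilog (z t) * \<psi>' + \<rho> t * \<kappa> t * \<rho>') (at t)"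
    and DERIV_Im_dilog:
      "((\<lambda>t. Im (polylog 2 (z t))) has_real_derivative - \<sigma> t * \<psi>' - \<kappa> t * \<rho>') (at t)"
proof -
  have T: "open T" "t \<in> T" using assms by (auto simp: polar_path_def)
  have z: "z t = exp (Complex (\<rho> t) (\<psi> t))" and z1: "1 - z t = exp (Complex (\<sigma> t) (\<kappa> t))"
    and "\<rho> t < 0" "\<bar>\<kappa> t\<bar> < pi" if "t \<in> T" for t
    using path that by (auto simp: polar_path_def)
  \<comment> \<open>The points z t have this form only for t in \<open>T\<close>, so
    \<open>w\<close> is differentiated instead and the result is transferred through the open set
    \<open>T\<close>.\<close>
  define w where "w = (\<lambda>t. exp (Complex (\<rho> t) (\<psi> t)))"
  have wt: "w t = z t" using z[OF T(2)] by (simp add: w_def)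
  have n1: "ln (norm (z t)) = \<rho> t" and n2: "ln (norm (1 - z t)) = \<sigma> t" if "t \<in> T" for t
    using that by (simp_all add: z1) (simp add: z)
  have nz: "norm (z t) < 1" "z t \<noteq> 0" using z[OF t] \<open>\<And>t. t \<in> T \<Longrightarrow> \<rho> t < 0\<close>[OF t] by auto
  have L1: "polylog 1 (z t) = - Complex (\<sigma> t) (\<kappa> t)"
    using z1[OF t] \<open>\<And>t. t \<in> T \<Longrightarrow> \<bar>\<kappa> t\<bar> < pi\<close>[OF t] nz by (subst polylog_1) (auto simp: abs_less_iff)
  have "((\<lambda>t. Complex (\<rho> t) (\<psi> t)) has_vector_derivative Complex \<rho>' \<psi>') (at t)"
    using D by (auto simp: has_vector_derivative_complex_iff Complex.complex_eq_iff)
  hence "(w has_vector_derivative Complex \<rho>' \<psi>' * exp (Complex (\<rho> t) (\<psi> t))) (at t)"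
    unfolding w_def using field_vector_diff_chain_at[OF _ DERIV_exp] by (auto simp: o_def)
  hence w': "(w has_vector_derivative Complex \<rho>' \<psi>' * z t) (at t)"
    using wt by (simp add: w_def)
  have DL: "((\<lambda>t. polylog (Suc s) (z t)) has_vector_derivative Complex \<rho>' \<psi>' * polylog s (z t)) (at t)" for s
  proof -
    have "((polylog (Suc s) \<circ> w) has_vector_derivative (Complex \<rho>' \<psi>' * z t) * (polylog s (z t) / z t)) (at t)"
      by (rule field_vector_diff_chain_at[OF w']) (use DERIV_polylog[OF nz] wt in simp)
    hence "((polylog (Suc s) \<circ> w) has_vector_derivative Complex \<rho>' \<psi>' * polylog s (z t)) (at t)"
      using nz by simp
    thus ?thesis
      by (rule has_vector_derivative_transform_within_open[OF _ T]) (simp add: z w_def)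
  qed
  have D2: "((\<lambda>t. polylog 2 (z t)) has_vector_derivative Complex \<rho>' \<psi>' * - Complex (\<sigma> t) (\<kappa> t)) (at t)"
    using DL[of 1] L1 by (simp add: numeral_2_eq_2)
  have D3: "((\<lambda>t. polylog 3 (z t)) has_vector_derivative Complex \<rho>' \<psi>' * polylog 2 (z t)) (at t)"
    using DL[of 2] by (simp add: numeral_3_eq_3)
  have I2: "((\<lambda>t. Im (polylog 2 (z t))) has_real_derivative - \<sigma> t * \<psi>' - \<kappa> t * \<rho>') (at t)"
    and R2: "((\<lambda>t. Re (polylog 2 (z t))) has_real_derivative \<kappa> t * \<psi>' - \<sigma> t * \<rho>') (at t)"
    using D2 by (auto simp: has_vector_derivative_complex_iff algebra_simps)
  have I3: "((\<lambda>t. Im (polylog 3 (z t))) has_real_derivative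
       \<rho>' * Im (polylog 2 (z t)) + \<psi>' * Re (polylog 2 (z t))) (at t)"
    using D3 by (auto simp: has_vector_derivative_complex_iff algebra_simps)
  have "((\<lambda>t. Re (polylog 2 (z t)) + \<rho> t * \<sigma> t) has_real_derivative \<rho> t * \<sigma>' + \<kappa> t * \<psi>') (at t)"
    by (rule DERIV_cong[OF DERIV_add[OF R2 DERIV_mult[OF D(1) D(3)]]]) (simp add: algebra_simps)
  thus "((\<lambda>t. mod_dilog (z t)) has_real_derivative \<rho> t * \<sigma>' + \<kappa> t * \<psi>') (at t)"
    by (rule has_field_derivative_transform_within_open[OF _ T]) (simp add: mod_dilog_def n1 n2)
  have md: "mod_dilog (z t) = Re (polylog 2 (z t)) + \<rho> t * \<sigma> t"
    using T by (simp add: mod_dilog_def n1 n2)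
  have "((\<lambda>t. Im (polylog 3 (z t)) - \<rho> t * Im (polylog 2 (z t))) has_real_derivative
      mod_dilog (z t) * \<psi>' + \<rho> t * \<kappa> t * \<rho>') (at t)"
    by (rule DERIV_cong[OF DERIV_diff[OF I3 DERIV_mult[OF D(1) I2]]]) (simp add: md algebra_simps)
  thus "((\<lambda>t. mod_trilog (z t)) has_real_derivative mod_dilog (z t) * \<psi>' + \<rho> t * \<kappa> t * \<rho>') (at t)"
    by (rule has_field_derivative_transform_within_open[OF _ T]) (simp add: mod_trilog_def n1)
  show "((\<lambda>t. Im (polylog 2 (z t))) has_real_derivative - \<sigma> t * \<psi>' - \<kappa> t * \<rho>') (at t)"
    by (fact I2)
qed

section \<open>Special dilogarithm values and a trilogarithm relation\<close>

lemma exp_Complex_cis: "exp (Complex a b) = of_real (exp a) * cis b"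
  by (simp add: exp_eq_polar)

lemma mod_trilog_of_real:
  assumes "\<bar>x\<bar> \<le> 1"
  shows "mod_trilog (of_real x) = 0"
  using assms by (simp add: mod_trilog_def polylog_of_real)

text \<open>Distribution over the cube roots of unity at z = 1: the three values add up to
  zeta(2)/3, and the two nonreal ones are conjugate.\<close>

lemma Re_dilog_cis_third: "Re (polylog 2 (cis (2 * pi / 3))) = - pi\<^sup>2 / 18"
proof -
  define \<omega> where "\<omega> = cis (2 * pi / 3)"
  have c: "\<omega> = Complex (- 1 / 2) (sqrt 3 / 2)"
    by (auto simp: \<omega>_def complex_eq_iff cos_120 sin_120)
  have "\<omega>\<^sup>2 = cnj \<omega>" by (simp add: c complex_eq_iff power2_eq_square)
  moreover have "norm \<omega> \<le> 1" by (simp add: \<omega>_def)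
  ultimately have "polylog 2 (\<omega>\<^sup>2) = cnj (polylog 2 \<omega>)" by (simp add: polylog_cnj)
  moreover have "polylog 2 1 + polylog 2 \<omega> + polylog 2 (\<omega>\<^sup>2) = polylog 2 (1 :: complex) / 3"
    using polylog_distribution[of 2 1 3 \<omega>] cis_third_power_eq_1
    by (simp add: \<omega>_def lessThan_nat_numeral lessThan_Suc numeral_3_eq_3 power2_eq_square add_ac)
  ultimately have "of_real (pi\<^sup>2 / 6) + polylog 2 \<omega> + cnj (polylog 2 \<omega>) = of_real (pi\<^sup>2 / 18)"
    by (simp add: polylog_2_1)
  from arg_cong[OF this, of Re] show ?thesis by (simp add: \<omega>_def)
qed

text \<open>Duplication at e = cis(pi/3), where e^2 and -e are a primitive cube root of unity and
  its conjugate.\<close>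

lemma Re_dilog_cis_sixth: "Re (polylog 2 (cis (pi / 3))) = pi\<^sup>2 / 36"
proof -
  define e where "e = cis (pi / 3)"
  have "e\<^sup>2 = cis (2 * pi / 3)" by (simp add: e_def cis_mult power2_eq_square)
  moreover have "- e = cnj (cis (2 * pi / 3))"
    by (simp add: e_def complex_eq_iff cos_60 sin_60 cos_120 sin_120)
  moreover have "polylog 2 e + polylog 2 (- e) = polylog 2 (e\<^sup>2) / 2"
    using polylog_duplication[of 2 e] by (simp add: e_def)
  ultimately have "polylog 2 e + cnj (polylog 2 (cis (2 * pi / 3))) = polylog 2 (cis (2 * pi / 3)) / 2"
    by (simp add: polylog_cnj)
  from arg_cong[OF this, of Re] Re_dilog_cis_third show ?thesis by (simp add: e_def)
qed

lemma mod_dilog_norm_1: "norm z = 1 \<Longrightarrow> mod_dilog z = Re (polylog 2 z)"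
  by (simp add: mod_dilog_def)

text \<open>The points \<open>x\<close>, \<open>y\<close>, \<open>z\<close>, \<open>w\<close> share
  the modulus 1/(2 cos t), and 1 minus them have the arguments -t, -pi/6, pi/6, t. Hence all
  logarithms along the curve are explicit in t, \<open>b\<close>, \<open>p\<close>,
  \<open>m\<close>, and a suitable combination \<open>G\<close> of trilogarithms is constant on
  [0, pi/3], where 2 cos t is at least 1. The relation is read off at t = pi/4, where the modulus is
  1/sqrt 2.\<close>

lemma mod_trilog_relation_root2_circle:
  "mod_trilog (cis (7 * pi / 12) / sqrt 2) - mod_trilog (cis (pi / 12) / sqrt 2) =
     mod_trilog (cis (pi / 4) / sqrt 2) / 3 + pi * (ln 2)\<^sup>2 / 96 + pi ^ 3 / 128"
proof -
  define b where "b = (\<lambda>t::real. ln (2 * cos t))"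
  define p where "p = (\<lambda>t::real. ln (2 * cos (t - pi / 6)))"
  define m where "m = (\<lambda>t::real. ln (2 * cos (t + pi / 6)))"
  define x where "x = (\<lambda>t::real. cis t / (2 * cos t))"
  define w where "w = (\<lambda>t::real. cis (3 * t + pi) / (2 * cos t))"
  define y where "y = (\<lambda>t::real. cis (t + pi / 3) / (2 * cos t))"
  define z where "z = (\<lambda>t::real. cis (t - pi / 3) / (2 * cos t))"
  \<comment> \<open>\<open>F\<close> is the derivative of \<open>G\<close> plus pi^2/6. The weight
    of \<open>w\<close> is 3 here but 1 in \<open>G\<close>, since its angle 3 t + pi has derivative
    3. The weights cancel \<open>p\<close> and \<open>m\<close> from the derivative of
    \<open>F\<close>, and the terms in \<open>b\<close> and t absorb what is left.\<close>
  define F where "F = (\<lambda>t. 3 * mod_dilog (y t) + 3 * mod_dilog (z t) - 3 * mod_dilog (w t)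
      - 2 * mod_dilog (x t) - (b t)\<^sup>2 / 2 + 7 / 2 * t\<^sup>2)"
  define G where "G = (\<lambda>t. 3 * mod_trilog (y t) + 3 * mod_trilog (z t) - mod_trilog (w t)
      - 2 * mod_trilog (x t) - t * (b t)\<^sup>2 / 2 + 7 / 6 * t ^ 3 - pi\<^sup>2 / 6 * t)"
  have half: "1 / 2 \<le> cos t" if "0 \<le> t" "t \<le> pi / 3" for t
    using cos_monotone_0_pi_le[of t "pi / 3"] that by (simp add: cos_60)
  have half': "1 / 2 < cos t" if "0 < t" "t < pi / 3" for t
    using cos_monotone_0_pi[of t "pi / 3"] that by (simp add: cos_60)
  have contz: "continuous_on {0..pi/3} (\<lambda>t. f (cis (u t) / (2 * cos t)))"
    if "continuous_on (cball 0 1) f" "continuous_on {0..pi/3} u" for f :: "complex \<Rightarrow> real" and u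
  proof (rule continuous_on_compose2[OF that(1)])
    show "continuous_on {0..pi/3} (\<lambda>t. cis (u t) / complex_of_real (2 * cos t))"
      using half by (intro continuous_intros that(2)) (force simp: complex_eq_iff)
  qed (use half in \<open>force simp: norm_divide norm_mult\<close>)
  have contb: "continuous_on {0..pi/3} b"
    unfolding b_def using half by (intro continuous_intros) force
  have contF: "continuous_on {0..pi/3} F" and contG: "continuous_on {0..pi/3} G"
    unfolding F_def G_def x_def y_def z_def w_def
    by (intro continuous_intros contz contb continuous_on_mod_dilog continuous_on_mod_trilog; simp)+
  define T where "T = {0<..<pi/3}"
  have pos: "0 < cos t" "0 < cos (t - pi / 6)" "0 < cos (t + pi / 6)" if "t \<in> T" for t
    using that by (auto simp: T_def intro!: cos_gt_zero_pi)
  have E: "cis u / (2 * cos t) = exp (Complex (- b t) u)" if "t \<in> T" for t u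
    using pos[OF that] by (simp add: exp_Complex_cis b_def exp_minus field_simps flip: of_real_mult)
  have x1: "1 - x t = exp (Complex (- b t) (- t))"
    and y1: "1 - y t = exp (Complex (p t - b t) (- (pi / 6)))"
    and z1: "1 - z t = exp (Complex (m t - b t) (pi / 6))"
    and w1: "1 - w t = exp (Complex (p t + m t - b t) t)" if "t \<in> T" for t
  proof -
    note pos = pos[OF that]
    have trig: "cos (t - pi / 6) = sqrt 3 / 2 * cos t + sin t / 2"
      "cos (t + pi / 6) = sqrt 3 / 2 * cos t - sin t / 2"
      "cos (t + pi / 3) = cos t / 2 - sqrt 3 / 2 * sin t"
      "sin (t + pi / 3) = sqrt 3 / 2 * cos t + sin t / 2"
      "cos (t - pi / 3) = cos t / 2 + sqrt 3 / 2 * sin t"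
      "sin (t - pi / 3) = sin t / 2 - sqrt 3 / 2 * cos t"
      by (simp_all add: cos_add sin_add cos_diff sin_diff cos_30 sin_30 cos_60 sin_60)
    show "1 - x t = exp (Complex (- b t) (- t))"
      using pos by (simp add: exp_Complex_cis b_def exp_minus x_def complex_eq_iff field_simps)
    show "1 - y t = exp (Complex (p t - b t) (- (pi / 6)))"
    proof -
      have "exp (p t - b t) = cos (t - pi / 6) / cos t" using pos by (simp add: b_def p_def exp_diff)
      thus ?thesis using pos(1)
        by (simp add: exp_Complex_cis y_def complex_eq_iff trig cos_30 sin_30) (simp add: field_simps)
    qed
    show "1 - z t = exp (Complex (m t - b t) (pi / 6))"
    proof -
      have "exp (m t - b t) = cos (t + pi / 6) / cos t" using pos by (simp add: b_def m_def exp_diff)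
      thus ?thesis using pos(1)
        by (simp add: exp_Complex_cis z_def complex_eq_iff trig cos_30 sin_30) (simp add: field_simps)
    qed
    \<comment> \<open>This product makes ln|1 - w| equal to p + m - b, so that \<open>w\<close> can
      cancel the logarithms contributed by \<open>y\<close> and \<open>z\<close>.\<close>
    have "4 * cos (t - pi / 6) * cos (t + pi / 6) = 3 * (cos t)\<^sup>2 - (sin t)\<^sup>2"
      by (simp add: cos_add cos_diff cos_30 sin_30 algebra_simps power2_eq_square)
    hence "4 * cos (t - pi / 6) * cos (t + pi / 6) = 4 * (cos t)\<^sup>2 - 1"
      by (simp add: sin_squared_eq)
    hence "exp (p t + m t - b t) = (4 * (cos t)\<^sup>2 - 1) / (2 * cos t)"
      using pos by (simp add: b_def p_def m_def exp_diff exp_add field_simps)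
    moreover have "cos (3 * t + pi) = - (4 * cos t ^ 3 - 3 * cos t)"
      "sin (3 * t + pi) = - ((4 * (cos t)\<^sup>2 - 1) * sin t)"
    proof -
      have "sin (3 * t) = sin (2 * t + t)" by simp
      also have "\<dots> = (4 * (cos t)\<^sup>2 - 1) * sin t"
        unfolding sin_add sin_double cos_double_cos by (simp add: power2_eq_square algebra_simps)
      finally show "cos (3 * t + pi) = - (4 * cos t ^ 3 - 3 * cos t)"
        "sin (3 * t + pi) = - ((4 * (cos t)\<^sup>2 - 1) * sin t)"
        using cos_treble_cos[of t] by simp_all
    qed
    ultimately have "Re (1 - w t) = exp (p t + m t - b t) * cos t" "Im (1 - w t) = exp (p t + m t - b t) * sin t"
      using pos(1) unfolding w_def
      by (simp_all only: minus_complex.sel Re_divide_of_real Im_divide_of_real cis.sel one_complex.sel)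
        (simp_all add: field_simps power2_eq_square power3_eq_cube)
    thus "1 - w t = exp (Complex (p t + m t - b t) t)"
      by (simp add: exp_Complex_cis complex_eq_iff)
  qed
  have zE: "x t = exp (Complex (- b t) t)" "y t = exp (Complex (- b t) (t + pi / 3))"
    "z t = exp (Complex (- b t) (t - pi / 3))" "w t = exp (Complex (- b t) (3 * t + pi))" if "t \<in> T" for t
    unfolding x_def y_def z_def w_def by (rule E[OF that])+
  have bpos: "0 < b t" if "t \<in> T" for t
    unfolding b_def using half'[of t] that by (intro ln_gt_zero) (auto simp: T_def)
  have path: "polar_path T x (\<lambda>t. - b t) (\<lambda>t. t) (\<lambda>t. - b t) (\<lambda>t. - t)"
    "polar_path T y (\<lambda>t. - b t) (\<lambda>t. t + pi / 3) (\<lambda>t. p t - b t) (\<lambda>t. - (pi / 6))"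
    "polar_path T z (\<lambda>t. - b t) (\<lambda>t. t - pi / 3) (\<lambda>t. m t - b t) (\<lambda>t. pi / 6)"
    "polar_path T w (\<lambda>t. - b t) (\<lambda>t. 3 * t + pi) (\<lambda>t. p t + m t - b t) (\<lambda>t. t)"
    unfolding polar_path_def using bpos x1 y1 z1 w1 zE by (auto simp: T_def)
  {
    fix t :: real assume t: "t \<in> T"
    obtain b' p' m' where D: "(b has_real_derivative b') (at t)" "(p has_real_derivative p') (at t)"
        "(m has_real_derivative m') (at t)"
    proof -
      have "(b has_real_derivative - 2 * sin t / (2 * cos t)) (at t)"
        "(p has_real_derivative - 2 * sin (t - pi / 6) / (2 * cos (t - pi / 6))) (at t)"
        "(m has_real_derivative - 2 * sin (t + pi / 6) / (2 * cos (t + pi / 6))) (at t)"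
        unfolding b_def p_def m_def using pos[OF t] by (auto intro!: derivative_eq_intros)
      thus ?thesis by (rule that)
    qed
    have Db: "((\<lambda>t. - b t) has_real_derivative - b') (at t)"
      "((\<lambda>t. p t - b t) has_real_derivative p' - b') (at t)"
      "((\<lambda>t. m t - b t) has_real_derivative m' - b') (at t)"
      "((\<lambda>t. p t + m t - b t) has_real_derivative p' + m' - b') (at t)"
      by (auto intro!: derivative_eq_intros D)
    have Dt: "((\<lambda>t. t) has_real_derivative 1) (at t)"
      "((\<lambda>t. t + pi / 3) has_real_derivative 1) (at t)" "((\<lambda>t. t - pi / 3) has_real_derivative 1) (at t)"
      "((\<lambda>t. 3 * t + pi) has_real_derivative 3) (at t)"
      by (auto intro!: derivative_eq_intros)
    note F' = path(1)[THEN DERIV_mod_dilog, OF t Db(1) Dt(1) Db(1)]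
      path(2)[THEN DERIV_mod_dilog, OF t Db(1) Dt(2) Db(2)]
      path(3)[THEN DERIV_mod_dilog, OF t Db(1) Dt(3) Db(3)]
      path(4)[THEN DERIV_mod_dilog, OF t Db(1) Dt(4) Db(4)]
    note G' = path(1)[THEN DERIV_mod_trilog, OF t Db(1) Dt(1) Db(1)]
      path(2)[THEN DERIV_mod_trilog, OF t Db(1) Dt(2) Db(2)]
      path(3)[THEN DERIV_mod_trilog, OF t Db(1) Dt(3) Db(3)]
      path(4)[THEN DERIV_mod_trilog, OF t Db(1) Dt(4) Db(4)]
    have "(F has_real_derivative 0) (at t)"
      unfolding F_def by (auto intro!: derivative_eq_intros F' D simp: field_simps)
    moreover have "(G has_real_derivative F t - pi\<^sup>2 / 6) (at t)"
      unfolding G_def by (auto intro!: derivative_eq_intros G' D simp: F_def field_simps power2_eq_square)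
    ultimately have "(F has_real_derivative 0) (at t)" "(G has_real_derivative F t - pi\<^sup>2 / 6) (at t)" .
  } note D = this
  have F_const: "F t = F 0" if "t \<in> {0..pi/3}" for t
    using that by (intro DERIV_isconst2[of 0 "pi / 3" F] contF D) (auto simp: T_def)
  \<comment> \<open>At t = pi/3 the points \<open>x\<close>, \<open>y\<close>, \<open>z\<close>,
    \<open>w\<close> reach the unit circle, at cis(pi/3), cis(2 pi/3), 1, 1, and \<open>b\<close>
    vanishes; the special values of Re Li_2 give the constant.\<close>
  have "F (pi / 3) = pi\<^sup>2 / 6"
    by (simp add: F_def b_def cos_60 x_def y_def z_def w_def mod_dilog_norm_1 Re_dilog_cis_third
        Re_dilog_cis_sixth polylog_2_1 power2_eq_square cis_divide flip: cis_cnj)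
  hence F_eq: "F t - pi\<^sup>2 / 6 = 0" if "t \<in> T" for t
    using F_const[of t] F_const[of "pi / 3"] that by (simp add: T_def)
  have "(G has_real_derivative 0) (at t)" if "t \<in> T" for t
    using D(2)[OF that] unfolding F_eq[OF that] .
  hence "G (pi / 4) = G 0"
    by (intro DERIV_isconst2[of 0 "pi / 3" G] contG) (auto simp: T_def)
  \<comment> \<open>At t = 0 the points \<open>y\<close>, \<open>z\<close> are conjugate while
    \<open>x\<close>, \<open>w\<close> are real, and \<open>mod_trilog\<close> is odd under
    conjugation.\<close>
  also have "G 0 = 0"
  proof -
    have "z 0 = cnj (y 0)" "norm (y 0) \<le> 1"
      by (simp_all add: y_def z_def cis_cnj norm_divide)
    hence "mod_trilog (z 0) = - mod_trilog (y 0)" by (simp add: mod_trilog_cnj)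
    moreover have "mod_trilog (x 0) = 0" "mod_trilog (w 0) = 0"
      using mod_trilog_of_real[of "1 / 2"] mod_trilog_of_real[of "- 1 / 2"] by (simp_all add: x_def w_def)
    ultimately show ?thesis by (simp add: G_def)
  qed
  finally have G: "G (pi / 4) = 0" .
  have s2: "complex_of_real (2 * cos (pi / 4)) = sqrt 2" by (simp add: cos_45)
  \<comment> \<open>At t = pi/4 the point \<open>w\<close> is the conjugate of \<open>x\<close>,
    because 3 pi/4 + pi = -pi/4 + 2 pi. The weights -1 and -2 therefore combine to a single -1, and
    dividing by 3 gives the stated relation.\<close>
  have yz: "y (pi / 4) = cis (7 * pi / 12) / sqrt 2" "z (pi / 4) = cnj (cis (pi / 12) / sqrt 2)"
    "x (pi / 4) = cis (pi / 4) / sqrt 2" "w (pi / 4) = cnj (cis (pi / 4) / sqrt 2)"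
  proof -
    have "pi / 4 + pi / 3 = 7 * pi / 12" "pi / 4 - pi / 3 = - (pi / 12)" "3 * (pi / 4) + pi = - (pi / 4) + 2 * pi"
      by (simp_all add: field_simps)
    moreover have "cis (- (pi / 4) + 2 * pi) = cis (- (pi / 4))"
      by (simp only: cis_mult[symmetric]) simp
    ultimately show "y (pi / 4) = cis (7 * pi / 12) / sqrt 2" "z (pi / 4) = cnj (cis (pi / 12) / sqrt 2)"
      "x (pi / 4) = cis (pi / 4) / sqrt 2" "w (pi / 4) = cnj (cis (pi / 4) / sqrt 2)"
      unfolding x_def y_def z_def w_def s2 by (simp_all only: complex_cnj_divide cis_cnj complex_cnj_complex_of_real)
  qed
  have n: "norm (cis u / complex_of_real (sqrt 2)) \<le> 1" for u by (simp add: norm_divide)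
  have b: "b (pi / 4) = ln 2 / 2" by (simp add: b_def cos_45 ln_sqrt)
  show ?thesis using G unfolding G_def yz b mod_trilog_cnj[OF n]
    by (simp add: field_simps power2_eq_square power3_eq_cube)
qed

section \<open>The primitive along a ray\<close>

definition ray :: "real \<Rightarrow> complex" where
  "ray t = of_real t * cis (pi / 4)"

definition lnp :: "real \<Rightarrow> real" where "lnp t = ln (norm (1 + ray t))"
definition lnm :: "real \<Rightarrow> real" where "lnm t = ln (norm (1 - ray t))"
definition argp :: "real \<Rightarrow> real" where "argp t = Im (Ln (1 + ray t))"
text \<open>The sign makes \<open>argm t\<close> positive for 0 < t; the difference
  \<open>argm - argp\<close> then turns out to be arctan (t^2).\<close>

definition argm :: "real \<Rightarrow> real" where "argm t = - Im (Ln (1 - ray t))"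

lemma ray_altdef: "ray t = Complex (t / sqrt 2) (t / sqrt 2)"
  by (simp add: ray_def complex_eq_iff cos_45 sin_45 real_div_sqrt field_simps)

text \<open>The bound 1/sqrt 2 on t says that the real part of \<open>ray t\<close> is below 1/2,
  equivalently |ray t| < |1 - ray t|. This keeps the Landen argument -r/(1 - r) inside the unit
  disc.\<close>

lemma ray_bounds:
  assumes "0 < t" "t < 1 / sqrt 2"
  shows "0 < t / sqrt 2" "t / sqrt 2 < 1 / 2" "t < 1"
proof -
  show "0 < t / sqrt 2" using assms by simp
  have "t / sqrt 2 < 1 / sqrt 2 / sqrt 2" using assms by (intro divide_strict_right_mono) auto
  thus "t / sqrt 2 < 1 / 2" by simp
  have "1 / sqrt 2 < 1" by simp
  thus "t < 1" using assms by linarith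
qed

lemma norm_ray: "norm (ray t) = \<bar>t\<bar>"
  by (simp add: ray_def norm_mult)

lemma
  assumes "0 \<le> t" "t < 1 / sqrt 2"
  shows one_plus_ray: "1 + ray t = exp (Complex (lnp t) (argp t))"
    and one_minus_ray: "1 - ray t = exp (Complex (lnm t) (- argm t))"
    and argp_bound: "\<bar>argp t\<bar> < pi / 2" and argm_bound: "\<bar>argm t\<bar> < pi / 2"
proof -
  have "0 \<le> t / sqrt 2" "t / sqrt 2 < 1 / 2"
    using assms ray_bounds(1,2)[of t] by (cases "t = 0"; simp)+
  hence pos: "0 < Re (1 + ray t)" "0 < Re (1 - ray t)"
    unfolding ray_altdef minus_complex.sel plus_complex.sel one_complex.sel complex.sel by linarith+
  hence nz: "1 + ray t \<noteq> 0" "1 - ray t \<noteq> 0" by (metis less_irrefl zero_complex.sel(1))+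
  have "Ln (1 + ray t) = Complex (lnp t) (argp t)" "Ln (1 - ray t) = Complex (lnm t) (- argm t)"
    using nz by (simp_all add: complex_eq_iff lnp_def lnm_def argp_def argm_def)
  thus "1 + ray t = exp (Complex (lnp t) (argp t))" "1 - ray t = exp (Complex (lnm t) (- argm t))"
    using nz by (metis exp_Ln)+
  show "\<bar>argp t\<bar> < pi / 2" "\<bar>argm t\<bar> < pi / 2"
    using Re_Ln_pos_lt[OF nz(1)] Re_Ln_pos_lt[OF nz(2)] pos by (auto simp: argp_def argm_def)
qed

lemma exp_Complex_diff: "exp (Complex a b) / exp (Complex c d) = exp (Complex (a - c) (b - d))"
  by (simp add: exp_diff[symmetric] complex_diff)

lemma exp_Complex_mult: "exp (Complex a b) * exp (Complex c d) = exp (Complex (a + c) (b + d))"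
  by (simp add: exp_add[symmetric] complex_add)

lemma exp_Complex_inverse: "1 / exp (Complex a b) = exp (Complex (- a) (- b))"
  by (simp add: exp_Complex_cis exp_minus divide_inverse)

lemma exp_Complex_double: "2 * exp (Complex a b) = exp (Complex (ln 2 + a) b)"
  by (simp add: exp_Complex_cis exp_add)

lemma exp_Complex_uminus: "- exp (Complex a b) = exp (Complex a (pi + b))"
  by (simp add: exp_Complex_cis flip: cis_mult)

lemma polar_pathI:
  assumes "open T" "\<And>t. t \<in> T \<Longrightarrow> \<rho> t < 0" "\<And>t. t \<in> T \<Longrightarrow> \<bar>\<kappa> t\<bar> < pi"
    "\<And>t. t \<in> T \<Longrightarrow> z t = exp (Complex (\<rho> t) (\<psi> t))"
    "\<And>t. t \<in> T \<Longrightarrow> 1 - z t = exp (Complex (\<sigma> t) (\<kappa> t))"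
  shows "polar_path T z \<rho> \<psi> \<sigma> \<kappa>"
  using assms unfolding polar_path_def by blast

text \<open>In each case both z and 1 - z are, up to sign, products of powers of 2, r, 1 + r and 1 -
  r with r = \<open>ray t\<close>. Their logarithms are therefore integral combinations of ln 2, ln
  t, \<open>lnp\<close>, \<open>lnm\<close>, with angles built from \<open>argp\<close>,
  \<open>argm\<close> and multiples of pi/4.\<close>

lemma ray_paths:
  defines "T \<equiv> {0<..<1 / sqrt 2}"
  shows path_ray: "polar_path T ray ln (\<lambda>_. pi / 4) lnm (\<lambda>t. - argm t)"
    and path_minus_ray: "polar_path T (\<lambda>t. - ray t) ln (\<lambda>_. 5 * pi / 4) lnp argp"
    and path_ray_square: "polar_path T (\<lambda>t. (ray t)\<^sup>2) (\<lambda>t. 2 * ln t) (\<lambda>_. pi / 2)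
      (\<lambda>t. lnp t + lnm t) (\<lambda>t. argp t - argm t)"
    and path_landen: "polar_path T (\<lambda>t. - ray t / (1 - ray t)) (\<lambda>t. ln t - lnm t)
      (\<lambda>t. 5 * pi / 4 + argm t) (\<lambda>t. - lnm t) argm"
    and path_inverse: "polar_path T (\<lambda>t. 1 / (1 + ray t)) (\<lambda>t. - lnp t)
      (\<lambda>t. - argp t) (\<lambda>t. ln t - lnp t) (\<lambda>t. pi / 4 - argp t)"
    and path_cayley: "polar_path T (\<lambda>t. (1 - ray t) / (1 + ray t)) (\<lambda>t. lnm t - lnp t)
      (\<lambda>t. - argm t - argp t) (\<lambda>t. ln 2 + ln t - lnp t) (\<lambda>t. pi / 4 - argp t)"
    and path_minus_cayley: "polar_path T (\<lambda>t. - ((1 - ray t) / (1 + ray t))) (\<lambda>t. lnm t - lnp t)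
      (\<lambda>t. pi - argm t - argp t) (\<lambda>t. ln 2 - lnp t) (\<lambda>t. - argp t)"
proof -
  have T: "open T" by (simp add: T_def)
  have p: "1 + ray t = exp (Complex (lnp t) (argp t))" and m: "1 - ray t = exp (Complex (lnm t) (- argm t))"
    and b: "\<bar>argp t\<bar> < pi / 2" "\<bar>argm t\<bar> < pi / 2" if "t \<in> T" for t
    using that one_plus_ray one_minus_ray argp_bound argm_bound by (simp_all add: T_def)
  have nz: "1 + ray t \<noteq> 0" "1 - ray t \<noteq> 0" if "t \<in> T" for t
    unfolding p[OF that] m[OF that] by (rule exp_not_eq_zero)+
  have r: "ray t = exp (Complex (ln t) (pi / 4))" if "t \<in> T" for t
    using that by (simp add: ray_def exp_Complex_cis T_def)
  have mr: "- ray t = exp (Complex (ln t) (5 * pi / 4))" if "t \<in> T" for t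
  proof -
    have "- ray t = exp (Complex (ln t) (pi + pi / 4))"
      unfolding r[OF that] by (rule exp_Complex_uminus)
    thus ?thesis by simp
  qed
  have neg: "ln t < 0" "- lnp t < 0" "ln t - lnm t < 0" "lnm t - lnp t < 0" if "t \<in> T" for t
  proof -
    have t: "0 < t" "t < 1 / sqrt 2" using that by (auto simp: T_def)
    note t' = ray_bounds[OF t]
    have "(t / sqrt 2)\<^sup>2 = t\<^sup>2 / 2" by (simp add: power_divide)
    hence n2: "(norm (1 + ray t))\<^sup>2 = 1 + 2 * (t / sqrt 2) + t\<^sup>2"
      "(norm (1 - ray t))\<^sup>2 = 1 - 2 * (t / sqrt 2) + t\<^sup>2"
      unfolding cmod_power2 ray_altdef by (simp_all add: power2_sum power2_diff)
    have "0 < t\<^sup>2" using t by simp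
    have "1\<^sup>2 < (norm (1 + ray t))\<^sup>2" "t\<^sup>2 < (norm (1 - ray t))\<^sup>2"
      "(norm (1 - ray t))\<^sup>2 < (norm (1 + ray t))\<^sup>2"
      unfolding n2 one_power2 using t'(1,2) \<open>0 < t\<^sup>2\<close> by linarith+
    hence n: "1 < norm (1 + ray t)" "t < norm (1 - ray t)" "norm (1 - ray t) < norm (1 + ray t)"
      using power2_less_imp_less norm_ge_zero by blast+
    show "ln t < 0" using t t' by simp
    show "- lnp t < 0" using ln_gt_zero[OF n(1)] by (simp add: lnp_def)
    have pos: "0 < norm (1 - ray t)" using n t by linarith
    show "ln t - lnm t < 0" using ln_less_cancel_iff[OF t(1) pos] n by (simp add: lnm_def)
    have "0 < norm (1 + ray t)" using n by linarith
    from ln_less_cancel_iff[OF pos this] show "lnm t - lnp t < 0" using n(3) by (simp add: lnm_def lnp_def)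
  qed
  show "polar_path T ray ln (\<lambda>_. pi / 4) lnm (\<lambda>t. - argm t)"
  proof (rule polar_pathI[OF T])
    fix t assume t: "t \<in> T"
    show "\<bar>- argm t\<bar> < pi" using b[OF t] by linarith
  qed (fact neg r m)+
  show "polar_path T (\<lambda>t. - ray t) ln (\<lambda>_. 5 * pi / 4) lnp argp"
  proof (rule polar_pathI[OF T])
    fix t assume t: "t \<in> T"
    show "\<bar>argp t\<bar> < pi" using b[OF t] by linarith
    show "1 - - ray t = exp (Complex (lnp t) (argp t))" using p[OF t] by simp
  qed (fact neg mr)+
  show "polar_path T (\<lambda>t. (ray t)\<^sup>2) (\<lambda>t. 2 * ln t) (\<lambda>_. pi / 2) (\<lambda>t. lnp t + lnm t) (\<lambda>t. argp t - argm t)"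
  proof (rule polar_pathI[OF T])
    fix t assume t: "t \<in> T"
    show "2 * ln t < 0" using neg(1)[OF t] by simp
    show "\<bar>argp t - argm t\<bar> < pi" using b[OF t] by linarith
    have "1 - (ray t)\<^sup>2 = (1 + ray t) * (1 - ray t)" by (simp add: power2_eq_square algebra_simps)
    thus "1 - (ray t)\<^sup>2 = exp (Complex (lnp t + lnm t) (argp t - argm t))"
      unfolding p[OF t] m[OF t] exp_Complex_mult by simp
    show "(ray t)\<^sup>2 = exp (Complex (2 * ln t) (pi / 2))"
      unfolding power2_eq_square r[OF t] exp_Complex_mult by simp
  qed
  show "polar_path T (\<lambda>t. - ray t / (1 - ray t)) (\<lambda>t. ln t - lnm t)
      (\<lambda>t. 5 * pi / 4 + argm t) (\<lambda>t. - lnm t) argm"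
  proof (rule polar_pathI[OF T])
    fix t assume t: "t \<in> T"
    show "\<bar>argm t\<bar> < pi" using b[OF t] by linarith
    show "- ray t / (1 - ray t) = exp (Complex (ln t - lnm t) (5 * pi / 4 + argm t))"
      unfolding mr[OF t] m[OF t] exp_Complex_diff by simp
    have "1 - - ray t / (1 - ray t) = 1 / (1 - ray t)" using nz[OF t] by (simp add: field_simps)
    also have "\<dots> = exp (Complex (- lnm t) (argm t))"
      unfolding m[OF t] exp_Complex_inverse by simp
    finally show "1 - - ray t / (1 - ray t) = exp (Complex (- lnm t) (argm t))" .
  qed (fact neg)
  show "polar_path T (\<lambda>t. 1 / (1 + ray t)) (\<lambda>t. - lnp t) (\<lambda>t. - argp t) (\<lambda>t. ln t - lnp t) (\<lambda>t. pi / 4 - argp t)"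
  proof (rule polar_pathI[OF T])
    fix t assume t: "t \<in> T"
    show "\<bar>pi / 4 - argp t\<bar> < pi" using b[OF t] by linarith
    show "1 / (1 + ray t) = exp (Complex (- lnp t) (- argp t))"
      unfolding p[OF t] exp_Complex_inverse by (rule refl)
    have "1 - 1 / (1 + ray t) = ray t / (1 + ray t)" using nz[OF t] by (simp add: field_simps)
    also have "\<dots> = exp (Complex (ln t - lnp t) (pi / 4 - argp t))"
      unfolding p[OF t] unfolding r[OF t] exp_Complex_diff by (rule refl)
    finally show "1 - 1 / (1 + ray t) = exp (Complex (ln t - lnp t) (pi / 4 - argp t))" .
  qed (fact neg)
  show "polar_path T (\<lambda>t. (1 - ray t) / (1 + ray t)) (\<lambda>t. lnm t - lnp t)
      (\<lambda>t. - argm t - argp t) (\<lambda>t. ln 2 + ln t - lnp t) (\<lambda>t. pi / 4 - argp t)"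
  proof (rule polar_pathI[OF T])
    fix t assume t: "t \<in> T"
    show "\<bar>pi / 4 - argp t\<bar> < pi" using b[OF t] by linarith
    show "(1 - ray t) / (1 + ray t) = exp (Complex (lnm t - lnp t) (- argm t - argp t))"
      unfolding p[OF t] m[OF t] exp_Complex_diff by (rule refl)
    have "1 - (1 - ray t) / (1 + ray t) = 2 * ray t / (1 + ray t)" using nz[OF t] by (simp add: field_simps)
    also have "\<dots> = exp (Complex (ln 2 + ln t - lnp t) (pi / 4 - argp t))"
      unfolding p[OF t] unfolding r[OF t] exp_Complex_double exp_Complex_diff by simp
    finally show "1 - (1 - ray t) / (1 + ray t) = exp (Complex (ln 2 + ln t - lnp t) (pi / 4 - argp t))" .
  qed (fact neg)
  show "polar_path T (\<lambda>t. - ((1 - ray t) / (1 + ray t))) (\<lambda>t. lnm t - lnp t)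
      (\<lambda>t. pi - argm t - argp t) (\<lambda>t. ln 2 - lnp t) (\<lambda>t. - argp t)"
  proof (rule polar_pathI[OF T])
    fix t assume t: "t \<in> T"
    show "\<bar>- argp t\<bar> < pi" using b[OF t] by linarith
    show "- ((1 - ray t) / (1 + ray t)) = exp (Complex (lnm t - lnp t) (pi - argm t - argp t))"
      unfolding p[OF t] m[OF t] exp_Complex_diff exp_Complex_uminus by (simp add: algebra_simps)
    have "1 - - ((1 - ray t) / (1 + ray t)) = 2 * (1 / (1 + ray t))" using nz[OF t] by (simp add: field_simps)
    also have "\<dots> = exp (Complex (ln 2 - lnp t) (- argp t))"
      unfolding p[OF t] exp_Complex_inverse exp_Complex_double by simp
    finally show "1 - - ((1 - ray t) / (1 + ray t)) = exp (Complex (ln 2 - lnp t) (- argp t))" .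
  qed (fact neg)
qed

lemma Re_ray_pos:
  assumes "0 \<le> t" "t < 1 / sqrt 2"
  shows "0 < Re (1 + ray t)" "0 < Re (1 - ray t)"
proof -
  have "0 \<le> t / sqrt 2" "t / sqrt 2 < 1 / 2"
    using assms ray_bounds(1,2)[of t] by (cases "t = 0"; simp)+
  thus "0 < Re (1 + ray t)" "0 < Re (1 - ray t)"
    unfolding ray_altdef minus_complex.sel plus_complex.sel one_complex.sel complex.sel by linarith+
qed

lemma ray_nz:
  assumes "0 \<le> t" "t < 1 / sqrt 2"
  shows "1 + ray t \<noteq> 0" "1 - ray t \<noteq> 0"
  using Re_ray_pos[OF assms] by (metis less_irrefl zero_complex.sel(1))+

lemma ray_0 [simp]: "ray 0 = 0" "lnp 0 = 0" "lnm 0 = 0" "argp 0 = 0" "argm 0 = 0"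
  by (simp_all add: ray_def lnp_def lnm_def argp_def argm_def)

lemma DERIV_ray_logs:
  assumes "0 \<le> t" "t < 1 / sqrt 2"
  shows "(lnp has_real_derivative Re (cis (pi / 4) / (1 + ray t))) (at t)"
    "(argp has_real_derivative Im (cis (pi / 4) / (1 + ray t))) (at t)"
    "(lnm has_real_derivative - Re (cis (pi / 4) / (1 - ray t))) (at t)"
    "(argm has_real_derivative Im (cis (pi / 4) / (1 - ray t))) (at t)"
proof -
  have L: "((\<lambda>t. Ln (1 + c * ray t)) has_vector_derivative c * cis (pi / 4) / (1 + c * ray t)) (at t)"
    if "0 < Re (1 + c * ray t)" for c
  proof -
    have "1 + c * (of_real t * cis (pi / 4)) \<notin> \<real>\<^sub>\<le>\<^sub>0"
      using that unfolding ray_def complex_nonpos_Reals_iff by linarith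
    note Ln' = has_field_derivative_Ln[OF this]
    have "((\<lambda>z. 1 + c * (z * cis (pi / 4))) has_field_derivative c * cis (pi / 4)) (at (of_real t))"
      by (auto intro!: derivative_eq_intros)
    from DERIV_chain2[OF Ln' this]
    have "((\<lambda>z. Ln (1 + c * (z * cis (pi / 4)))) has_field_derivative
        c * cis (pi / 4) / (1 + c * ray t)) (at (of_real t))"
      by (simp only: ray_def divide_inverse mult.commute)
    from has_vector_derivative_real_field[OF this] show ?thesis by (simp add: ray_def)
  qed
  have L1: "((\<lambda>t. Ln (1 + ray t)) has_vector_derivative cis (pi / 4) / (1 + ray t)) (at t)"
    using L[of 1] Re_ray_pos(1)[OF assms] by simp
  have L2: "((\<lambda>t. Ln (1 - ray t)) has_vector_derivative - (cis (pi / 4) / (1 - ray t))) (at t)"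
    using L[of "-1"] Re_ray_pos(2)[OF assms] by simp
  \<comment> \<open>The interval extends below 0 so that the two-sided derivative at t = 0 is
    covered too.\<close>
  have n: "ln (norm (1 + ray t)) = Re (Ln (1 + ray t))" "ln (norm (1 - ray t)) = Re (Ln (1 - ray t))"
    if "t \<in> {- 1 / sqrt 2<..<1 / sqrt 2}" for t
  proof -
    have "\<bar>t\<bar> < 1 / sqrt 2" using that by auto
    moreover have "1 / sqrt 2 < 1" by simp
    ultimately have "norm (ray t) < 1" unfolding norm_ray by linarith
    hence "0 < norm (1 + ray t)" "0 < norm (1 - ray t)"
      using norm_triangle_ineq2[of 1 "- ray t"] norm_triangle_ineq2[of 1 "ray t"]
      unfolding diff_minus_eq_add norm_minus_cancel norm_one by linarith+
    thus "ln (norm (1 + ray t)) = Re (Ln (1 + ray t))" "ln (norm (1 - ray t)) = Re (Ln (1 - ray t))" by simp_all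
  qed
  have t: "t \<in> {- 1 / sqrt 2<..<1 / sqrt 2}"
  proof -
    have "- 1 / sqrt 2 < 0" by simp
    thus ?thesis using assms by auto
  qed
  have D: "((\<lambda>t. Re (Ln (1 + ray t))) has_real_derivative Re (cis (pi / 4) / (1 + ray t))) (at t)"
    "((\<lambda>t. Im (Ln (1 + ray t))) has_real_derivative Im (cis (pi / 4) / (1 + ray t))) (at t)"
    "((\<lambda>t. Re (Ln (1 - ray t))) has_real_derivative Re (- (cis (pi / 4) / (1 - ray t)))) (at t)"
    "((\<lambda>t. Im (Ln (1 - ray t))) has_real_derivative Im (- (cis (pi / 4) / (1 - ray t)))) (at t)"
    using L1 L2 unfolding has_vector_derivative_complex_iff by blast+
  show "(lnp has_real_derivative Re (cis (pi / 4) / (1 + ray t))) (at t)"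
    by (rule has_field_derivative_transform_within_open[OF D(1) open_greaterThanLessThan t])
       (simp only: lnp_def n)
  show "(lnm has_real_derivative - Re (cis (pi / 4) / (1 - ray t))) (at t)"
    using has_field_derivative_transform_within_open[OF D(3) open_greaterThanLessThan t, of lnm]
    by (simp only: lnm_def n uminus_complex.sel)
  show "(argp has_real_derivative Im (cis (pi / 4) / (1 + ray t))) (at t)"
    using D(2) unfolding argp_def[abs_def] .
  show "(argm has_real_derivative Im (cis (pi / 4) / (1 - ray t))) (at t)"
    using DERIV_minus[OF D(4)] unfolding argm_def[abs_def] by (simp only: uminus_complex.sel minus_minus)
qed

lemma polar_path_norm: "polar_path T z \<rho> \<psi> \<sigma> \<kappa> \<Longrightarrow> t \<in> T \<Longrightarrow> norm (z t) \<le> 1"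
proof -
  assume "polar_path T z \<rho> \<psi> \<sigma> \<kappa>" "t \<in> T"
  hence z: "z t = exp (Complex (\<rho> t) (\<psi> t))" and "\<rho> t < 0" unfolding polar_path_def by blast+
  thus "norm (z t) \<le> 1" unfolding z by simp
qed

text \<open>The polar paths cover only t > 0. At t = 0 three of the arguments are 1, 1 and -1, on
  the unit circle, so the closed disc is the right domain for the continuity arguments.\<close>

lemma ray_args_in_cball:
  assumes "0 \<le> t" "t < 1 / sqrt 2"
  shows "ray t \<in> cball 0 1" "- ray t \<in> cball 0 1" "(ray t)\<^sup>2 \<in> cball 0 1"
    "- ray t / (1 - ray t) \<in> cball 0 1" "1 / (1 + ray t) \<in> cball 0 1"
    "(1 - ray t) / (1 + ray t) \<in> cball 0 1" "- ((1 - ray t) / (1 + ray t)) \<in> cball 0 1"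
proof -
  have cases: "z t \<in> cball 0 1"
    if "polar_path {0<..<1 / sqrt 2} z \<rho> \<psi> \<sigma> \<kappa>" "norm (z 0) \<le> 1" for z \<rho> \<psi> \<sigma> \<kappa>
  proof (cases "t = 0")
    case False
    hence "t \<in> {0<..<1 / sqrt 2}" using assms by simp
    from polar_path_norm[OF that(1) this] show ?thesis by simp
  qed (use that(2) in simp)
  show "ray t \<in> cball 0 1" by (rule cases[OF path_ray]) simp
  show "- ray t \<in> cball 0 1" by (rule cases[OF path_minus_ray]) simp
  show "(ray t)\<^sup>2 \<in> cball 0 1" by (rule cases[OF path_ray_square]) simp
  show "- ray t / (1 - ray t) \<in> cball 0 1" by (rule cases[OF path_landen]) simp
  show "1 / (1 + ray t) \<in> cball 0 1" by (rule cases[OF path_inverse]) simp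
  show "(1 - ray t) / (1 + ray t) \<in> cball 0 1" by (rule cases[OF path_cayley]) simp
  show "- ((1 - ray t) / (1 + ray t)) \<in> cball 0 1" by (rule cases[OF path_minus_cayley]) simp
qed

lemma continuous_on_ray_args:
  assumes r: "r < 1 / sqrt 2" and f: "continuous_on (cball 0 1) f"
  shows "continuous_on {0..r} (\<lambda>t. f (ray t))" "continuous_on {0..r} (\<lambda>t. f (- ray t))"
    "continuous_on {0..r} (\<lambda>t. f ((ray t)\<^sup>2))" "continuous_on {0..r} (\<lambda>t. f (- ray t / (1 - ray t)))"
    "continuous_on {0..r} (\<lambda>t. f (1 / (1 + ray t)))"
    "continuous_on {0..r} (\<lambda>t. f ((1 - ray t) / (1 + ray t)))"
    "continuous_on {0..r} (\<lambda>t. f (- ((1 - ray t) / (1 + ray t))))"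
proof -
  have c: "continuous_on {0..r} ray" unfolding ray_def[abs_def] by (intro continuous_intros)
  have nz: "1 + ray t \<noteq> 0" "1 - ray t \<noteq> 0" if "t \<in> {0..r}" for t
    using ray_nz[of t] that r by auto
  have sub: "0 \<le> t \<and> t < 1 / sqrt 2" if "t \<in> {0..r}" for t using that r by auto
  have comp: "continuous_on {0..r} (\<lambda>t. f (g t))"
    if "continuous_on {0..r} g" "\<And>t. t \<in> {0..r} \<Longrightarrow> g t \<in> cball 0 1" for g
    by (rule continuous_on_compose2[OF f that(1)]) (use that(2) in blast)
  have g: "continuous_on {0..r} (\<lambda>t. ray t)"
    "continuous_on {0..r} (\<lambda>t. - ray t)"
    "continuous_on {0..r} (\<lambda>t. (ray t)\<^sup>2)"
    "continuous_on {0..r} (\<lambda>t. - ray t / (1 - ray t))"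
    "continuous_on {0..r} (\<lambda>t. 1 / (1 + ray t))"
    "continuous_on {0..r} (\<lambda>t. (1 - ray t) / (1 + ray t))"
    "continuous_on {0..r} (\<lambda>t. - ((1 - ray t) / (1 + ray t)))"
    using c nz by (auto intro!: continuous_intros)
  show "continuous_on {0..r} (\<lambda>t. f (ray t))"
    by (rule comp[OF g(1) ray_args_in_cball(1)]) (use sub in blast)+
  show "continuous_on {0..r} (\<lambda>t. f (- ray t))"
    by (rule comp[OF g(2) ray_args_in_cball(2)]) (use sub in blast)+
  show "continuous_on {0..r} (\<lambda>t. f ((ray t)\<^sup>2))"
    by (rule comp[OF g(3) ray_args_in_cball(3)]) (use sub in blast)+
  show "continuous_on {0..r} (\<lambda>t. f (- ray t / (1 - ray t)))"
    by (rule comp[OF g(4) ray_args_in_cball(4)]) (use sub in blast)+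
  show "continuous_on {0..r} (\<lambda>t. f (1 / (1 + ray t)))"
    by (rule comp[OF g(5) ray_args_in_cball(5)]) (use sub in blast)+
  show "continuous_on {0..r} (\<lambda>t. f ((1 - ray t) / (1 + ray t)))"
    by (rule comp[OF g(6) ray_args_in_cball(6)]) (use sub in blast)+
  show "continuous_on {0..r} (\<lambda>t. f (- ((1 - ray t) / (1 + ray t))))"
    by (rule comp[OF g(7) ray_args_in_cball(7)]) (use sub in blast)+
qed

lemma continuous_on_ray_logs:
  assumes r: "r < 1 / sqrt 2"
  shows "continuous_on {0..r} lnp" "continuous_on {0..r} lnm"
    "continuous_on {0..r} argp" "continuous_on {0..r} argm"
    "continuous_on {0..r} (\<lambda>t. ln t * lnp t)" "continuous_on {0..r} (\<lambda>t. ln t * lnm t)"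
proof -
  have "isCont lnp t" "isCont lnm t" "isCont argp t" "isCont argm t" if "t \<in> {0..r}" for t
    using DERIV_ray_logs[of t, THEN DERIV_isCont] that r by simp_all
  thus "continuous_on {0..r} lnp" "continuous_on {0..r} lnm"
    "continuous_on {0..r} argp" "continuous_on {0..r} argm"
    by (auto intro!: continuous_at_imp_continuous_on)
  have c: "continuous_on {0..r} ray" unfolding ray_def[abs_def] by (intro continuous_intros)
  have f: "continuous_on UNIV (\<lambda>z::complex. ln (norm z) * ln (norm (1 - z)))"
    by (intro continuous_at_imp_continuous_on ballI isCont_ln_norm_mult_ln_norm)
  have "continuous_on {0..r} (\<lambda>t. ln (norm (ray t)) * ln (norm (1 - ray t)))"
    by (intro continuous_on_compose2[OF f] c) simp
  thus "continuous_on {0..r} (\<lambda>t. ln t * lnm t)"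
    by (rule continuous_on_cong[THEN iffD1, rotated -1]) (auto simp: norm_ray lnm_def)
  have "continuous_on {0..r} (\<lambda>t. ln (norm (- ray t)) * ln (norm (1 - - ray t)))"
    by (intro continuous_on_compose2[OF f] continuous_intros c) simp
  thus "continuous_on {0..r} (\<lambda>t. ln t * lnp t)"
    by (rule continuous_on_cong[THEN iffD1, rotated -1]) (auto simp: norm_ray lnp_def)
qed

section \<open>Dilogarithm equations and the trilogarithm primitive\<close>

lemma dilog_minus_1: "polylog 2 (- 1 :: complex) = - of_real (pi\<^sup>2 / 12)"
proof -
  have "polylog 2 1 + polylog 2 (- 1) = polylog 2 1 / (2 :: complex)"
    using polylog_duplication[of 2 1] by simp
  hence "polylog 2 (- 1) = - (polylog 2 1 / (2 :: complex))"
    by (simp add: field_simps eq_neg_iff_add_eq_0)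
  thus ?thesis by (simp add: polylog_2_1)
qed

text \<open>Real forms of dilogarithm functional equations. Each difference of the two sides has
  derivative 0 along the polar paths, and its value is found at t = 0, where the arguments are 0, 1
  and -1; thus pi^2/4 is zeta(2) - Li_2(-1). The equations serve to eliminate dilogarithms from the
  derivative of \<open>ray_trilog\<close>.\<close>

lemma mod_dilog_ray:
  assumes t: "0 \<le> t" "t < 1 / sqrt 2"
  shows mod_dilog_cayley: "mod_dilog ((1 - ray t) / (1 + ray t)) - mod_dilog (- ((1 - ray t) / (1 + ray t)))
      + mod_dilog (ray t) - mod_dilog (- ray t)
      = ln t * (lnm t - lnp t) - pi / 4 * (argm t + argp t) + pi\<^sup>2 / 4" (is ?A)
    and mod_dilog_landen: "mod_dilog (- ray t / (1 - ray t)) + mod_dilog (ray t)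
      = ((lnm t)\<^sup>2 + (argm t)\<^sup>2) / 2" (is ?B)
    and mod_dilog_inverse: "mod_dilog (1 / (1 + ray t)) - mod_dilog (- ray t)
      = - (ln t * lnp t) + (lnp t)\<^sup>2 / 2 - pi / 4 * argp t + (argp t)\<^sup>2 / 2 + pi\<^sup>2 / 6" (is ?C)
proof -
  define A where "A = (\<lambda>t. mod_dilog ((1 - ray t) / (1 + ray t)) - mod_dilog (- ((1 - ray t) / (1 + ray t)))
      + mod_dilog (ray t) - mod_dilog (- ray t) - (ln t * lnm t - ln t * lnp t) + pi / 4 * (argm t + argp t))"
  define B where "B = (\<lambda>t. mod_dilog (- ray t / (1 - ray t)) + mod_dilog (ray t)
      - ((lnm t)\<^sup>2 + (argm t)\<^sup>2) / 2)"
  define C where "C = (\<lambda>t. mod_dilog (1 / (1 + ray t)) - mod_dilog (- ray t)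
      + ln t * lnp t - (lnp t)\<^sup>2 / 2 + pi / 4 * argp t - (argp t)\<^sup>2 / 2)"
  note cont = continuous_on_ray_args[OF t(2) continuous_on_mod_dilog] continuous_on_ray_logs[OF t(2)]
  have "continuous_on {0..t} A" unfolding A_def by (intro cont continuous_intros)
  moreover have "continuous_on {0..t} B" unfolding B_def by (intro cont continuous_intros) simp_all
  moreover have "continuous_on {0..t} C" unfolding C_def by (intro cont continuous_intros) simp_all
  ultimately have c: "continuous_on {0..t} A" "continuous_on {0..t} B" "continuous_on {0..t} C" .
  have D: "(A has_real_derivative 0) (at u)" "(B has_real_derivative 0) (at u)" "(C has_real_derivative 0) (at u)"
    if u: "0 < u" "u < t" for u
  proof -
    obtain P' p' M' m' where D: "(lnp has_real_derivative P') (at u)" "(argp has_real_derivative p') (at u)"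
        "(lnm has_real_derivative M') (at u)" "(argm has_real_derivative m') (at u)"
      by (rule that[OF DERIV_ray_logs[of u]]) (use u t in auto)
    have Dln: "(ln has_real_derivative 1 / u) (at u)" using u by (auto intro!: derivative_eq_intros)
    have uT: "u \<in> {0<..<1 / sqrt 2}" using u t by auto
    note DD = D Dln
    have r: "((\<lambda>t. mod_dilog (ray t)) has_real_derivative ln u * M') (at u)"
      by (rule DERIV_cong[OF DERIV_mod_dilog[OF path_ray uT Dln DERIV_const D(3)]]) (simp add: field_simps)
    have mr: "((\<lambda>t. mod_dilog (- ray t)) has_real_derivative ln u * P') (at u)"
      by (rule DERIV_cong[OF DERIV_mod_dilog[OF path_minus_ray uT Dln DERIV_const D(1)]]) (simp add: field_simps)
    have l: "((\<lambda>t. mod_dilog (- ray t / (1 - ray t))) has_real_derivative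
        (ln u - lnm u) * - M' + argm u * m') (at u)"
      by (rule DERIV_cong[OF DERIV_mod_dilog[OF path_landen uT DERIV_diff[OF Dln D(3)] DERIV_add[OF DERIV_const D(4)] DERIV_minus[OF D(3)]]]) (simp add: field_simps)
    have i: "((\<lambda>t. mod_dilog (1 / (1 + ray t))) has_real_derivative
        - lnp u * (1 / u - P') + (pi / 4 - argp u) * - p') (at u)"
      by (rule DERIV_cong[OF DERIV_mod_dilog[OF path_inverse uT DERIV_minus[OF D(1)] DERIV_minus[OF D(2)] DERIV_diff[OF Dln D(1)]]]) (simp add: field_simps)
    have q: "((\<lambda>t. mod_dilog ((1 - ray t) / (1 + ray t))) has_real_derivative
        (lnm u - lnp u) * (1 / u - P') + (pi / 4 - argp u) * (- m' - p')) (at u)"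
      by (rule DERIV_cong[OF DERIV_mod_dilog[OF path_cayley uT DERIV_diff[OF D(3) D(1)] DERIV_diff[OF DERIV_minus[OF D(4)] D(2)] DERIV_diff[OF DERIV_add[OF DERIV_const Dln] D(1)]]]) (simp add: field_simps)
    have mq: "((\<lambda>t. mod_dilog (- ((1 - ray t) / (1 + ray t)))) has_real_derivative
        (lnm u - lnp u) * - P' + - argp u * (- m' - p')) (at u)"
      by (rule DERIV_cong[OF DERIV_mod_dilog[OF path_minus_cayley uT DERIV_diff[OF D(3) D(1)] DERIV_diff[OF DERIV_diff[OF DERIV_const D(4)] D(2)] DERIV_diff[OF DERIV_const D(1)]]]) (simp add: field_simps)
    have sq: "((\<lambda>t. (f t)\<^sup>2) has_real_derivative 2 * f u * f') (at u)"
      if "(f has_real_derivative f') (at u)" for f f'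
      by (rule DERIV_cong[OF DERIV_power[OF that, of 2]]) simp
    show "(A has_real_derivative 0) (at u)" unfolding A_def
      by (rule DERIV_cong[OF DERIV_add[OF DERIV_diff[OF DERIV_diff[OF DERIV_add[OF DERIV_diff[OF q mq] r] mr]
            DERIV_diff[OF DERIV_mult[OF Dln D(3)] DERIV_mult[OF Dln D(1)]]] DERIV_cmult[OF DERIV_add[OF D(4) D(2)]]]])
         (use u in \<open>simp add: field_simps\<close>)
    show "(B has_real_derivative 0) (at u)" unfolding B_def
      by (rule DERIV_cong[OF DERIV_diff[OF DERIV_add[OF l r] DERIV_cdivide[OF DERIV_add[OF sq[OF D(3)] sq[OF D(4)]]]]])
         (simp add: field_simps)
    show "(C has_real_derivative 0) (at u)" unfolding C_def
      by (rule DERIV_cong[OF DERIV_diff[OF DERIV_add[OF DERIV_diff[OF DERIV_add[OF DERIV_diff[OF i mr]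
            DERIV_mult[OF Dln D(1)]] DERIV_cdivide[OF sq[OF D(1)]]] DERIV_cmult[OF D(2)]] DERIV_cdivide[OF sq[OF D(2)]]]])
         (use u in \<open>simp add: field_simps\<close>)
  qed
  have 0: "A 0 = pi\<^sup>2 / 4" "B 0 = 0" "C 0 = pi\<^sup>2 / 6"
    by (simp_all add: A_def B_def C_def mod_dilog_def polylog_2_1 dilog_minus_1 del: of_real_divide of_real_power)
  have const: "X t = X 0" if "continuous_on {0..t} X" "\<And>u. 0 < u \<Longrightarrow> u < t \<Longrightarrow> (X has_real_derivative 0) (at u)"
    for X :: "real \<Rightarrow> real"
  proof (cases "t = 0")
    case False
    thus ?thesis using t by (intro DERIV_isconst2[of 0 t X]) (auto intro: that)
  qed simp
  show ?A ?B ?C using const[OF c(1) D(1)] const[OF c(2) D(2)] const[OF c(3) D(3)] unfolding 0 by (simp_all add: A_def B_def C_def field_simps)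
qed

text \<open>With these weights the relations of \<open>mod_dilog_ray\<close> collapse the
  dilogarithms in the derivative to the single one at the square of \<open>ray t\<close>, multiplied
  by minus the derivative of \<open>argm - argp\<close>. The summand at \<open>ray t\<close> has
  constant angle and contributes no dilogarithm; it removes the term ln t argm / t produced by the
  Landen argument.\<close>

definition ray_trilog :: "real \<Rightarrow> real" where
  "ray_trilog t = 2 * mod_trilog ((1 - ray t) / (1 + ray t)) - 2 * mod_trilog (- ((1 - ray t) / (1 + ray t)))
     + 4 * mod_trilog (ray t) + 4 * mod_trilog (- ray t / (1 - ray t)) - 4 * mod_trilog (1 / (1 + ray t))"

text \<open>The elementary part is chosen such that \<open>ray_trilog - ray_elementary\<close> has derivative
  \<open>- Re (polylog 2 ((ray t)\<^sup>2)) * (argm - argp)'\<close>; the last summand of \<open>ray_primitive\<close> is an integration by parts.\<close>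

definition ray_elementary :: "real \<Rightarrow> real" where
  "ray_elementary t = 2 * ((lnm t)\<^sup>2 * argm t) - 4 * (ln t * lnm t * argm t) + 2 * ((lnp t)\<^sup>2 * argp t)
     + 2 / 3 * argm t ^ 3 + 2 / 3 * argp t ^ 3 + pi / 4 * (argm t)\<^sup>2 + pi / 2 * (argp t * argm t)
     - pi / 4 * (argp t)\<^sup>2 - pi\<^sup>2 / 2 * argm t + pi\<^sup>2 / 6 * argp t + pi / 4 * (lnm t - lnp t)\<^sup>2
     - pi / 2 * (lnp t)\<^sup>2"

definition ray_primitive :: "real \<Rightarrow> real" where
  "ray_primitive t = 4 * mod_trilog ((ray t)\<^sup>2) - 8 * ln 2 * Im (polylog 2 ((ray t)\<^sup>2))
     - 8 * (ray_trilog t - ray_elementary t) - 8 * (Re (polylog 2 ((ray t)\<^sup>2)) * (argm t - argp t))"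

lemma DERIV_square: "(f has_real_derivative f') (at t) \<Longrightarrow> ((\<lambda>t. (f t)\<^sup>2) has_real_derivative 2 * f t * f') (at t)"
  by (rule DERIV_cong[OF DERIV_power[where n = 2]]) auto

lemma DERIV_cube: "(f has_real_derivative f') (at t) \<Longrightarrow> ((\<lambda>t. f t ^ 3) has_real_derivative 3 * (f t)\<^sup>2 * f') (at t)"
  by (rule DERIV_cong[OF DERIV_power[where n = 3]]) auto

lemma mod_dilog_ray_square:
  assumes "0 < t" "t < 1 / sqrt 2"
  shows "mod_dilog ((ray t)\<^sup>2) = Re (polylog 2 ((ray t)\<^sup>2)) + 2 * ln t * (lnp t + lnm t)"
    and "mod_dilog (ray t) + mod_dilog (- ray t) = mod_dilog ((ray t)\<^sup>2) / 2"
proof -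
  have t: "t \<in> {0<..<1 / sqrt 2}" using assms by simp
  have "(ray t)\<^sup>2 = exp (Complex (2 * ln t) (pi / 2))" "1 - (ray t)\<^sup>2 = exp (Complex (lnp t + lnm t) (argp t - argm t))"
    using path_ray_square t unfolding polar_path_def by blast+
  hence "norm ((ray t)\<^sup>2) = exp (2 * ln t)" "norm (1 - (ray t)\<^sup>2) = exp (lnp t + lnm t)"
    by (simp_all only: norm_exp_eq_Re complex.sel)
  thus "mod_dilog ((ray t)\<^sup>2) = Re (polylog 2 ((ray t)\<^sup>2)) + 2 * ln t * (lnp t + lnm t)"
    by (simp only: mod_dilog_def ln_exp)
  have "(1 + ray t) * (1 - ray t) \<noteq> 0" using ray_nz[of t] assms by simp
  hence "(ray t)\<^sup>2 \<noteq> 1" by (simp add: power2_eq_square algebra_simps)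
  moreover have "norm (ray t) \<le> 1" "ray t \<noteq> 0"
    using ray_args_in_cball(1)[of t] assms norm_ray[of t] by auto
  ultimately show "mod_dilog (ray t) + mod_dilog (- ray t) = mod_dilog ((ray t)\<^sup>2) / 2"
    by (intro mod_dilog_duplication)
qed

text \<open>The square of \<open>ray t\<close> has constant angle pi/2, so the first two summands of
  \<open>ray_primitive\<close> yield just the terms with ln t and ln 2. The remaining term comes
  from the product in the last summand, since Re Li_2 at the square has derivative -2 (lnp + lnm) /
  t.\<close>

lemma DERIV_ray_primitive:
  assumes t: "0 < t" "t < 1 / sqrt 2"
  shows "(ray_primitive has_real_derivative - 16 * (argm t - argp t) * (ln 2 + ln t - (lnp t + lnm t)) / t) (at t)"
proof -
  obtain P' p' M' m' where D: "(lnp has_real_derivative P') (at t)" "(argp has_real_derivative p') (at t)"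
      "(lnm has_real_derivative M') (at t)" "(argm has_real_derivative m') (at t)"
    by (rule that[OF DERIV_ray_logs[of t]]) (use t in auto)
  define i where "i = 1 / t"
  have Dln: "(ln has_real_derivative i) (at t)" using t by (auto intro!: derivative_eq_intros simp: i_def)
  have uT: "t \<in> {0<..<1 / sqrt 2}" using t by auto
  note Mq = DERIV_mod_trilog[OF path_cayley uT DERIV_diff[OF D(3) D(1)] DERIV_diff[OF DERIV_minus[OF D(4)] D(2)] DERIV_diff[OF DERIV_add[OF DERIV_const Dln] D(1)]]
  note Mmq = DERIV_mod_trilog[OF path_minus_cayley uT DERIV_diff[OF D(3) D(1)] DERIV_diff[OF DERIV_diff[OF DERIV_const D(4)] D(2)] DERIV_diff[OF DERIV_const D(1)]]
  note Ms = DERIV_mod_trilog[OF path_ray uT Dln DERIV_const D(3)]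
  note Ml = DERIV_mod_trilog[OF path_landen uT DERIV_diff[OF Dln D(3)] DERIV_add[OF DERIV_const D(4)] DERIV_minus[OF D(3)]]
  note Mi = DERIV_mod_trilog[OF path_inverse uT DERIV_minus[OF D(1)] DERIV_minus[OF D(2)] DERIV_diff[OF Dln D(1)]]
  note path2 = path_ray_square uT DERIV_cmult[OF Dln] DERIV_const DERIV_add[OF D(1) D(3)]
  note M2 = DERIV_mod_trilog[OF path2] and I2 = DERIV_Im_dilog[OF path2]
  have "((\<lambda>t. mod_dilog ((ray t)\<^sup>2) - 2 * ln t * (lnp t + lnm t)) has_real_derivative - 2 * i * (lnp t + lnm t)) (at t)"
    by (rule DERIV_cong[OF DERIV_diff[OF DERIV_mod_dilog[OF path2] DERIV_mult[OF DERIV_cmult[OF Dln] DERIV_add[OF D(1) D(3)]]]])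
       (simp add: algebra_simps)
  hence R2: "((\<lambda>t. Re (polylog 2 ((ray t)\<^sup>2))) has_real_derivative - 2 * i * (lnp t + lnm t)) (at t)"
    by (rule has_field_derivative_transform_within_open[OF _ open_greaterThanLessThan uT])
       (use mod_dilog_ray_square(1) in simp)
  have H': "(ray_trilog has_real_derivative
      2 * (mod_dilog ((1 - ray t) / (1 + ray t)) * (- m' - p') + (lnm t - lnp t) * (pi / 4 - argp t) * (M' - P'))
      - 2 * (mod_dilog (- ((1 - ray t) / (1 + ray t))) * (- m' - p') + (lnm t - lnp t) * - argp t * (M' - P'))
      + 4 * (ln t * - argm t * i)
      + 4 * (mod_dilog (- ray t / (1 - ray t)) * m' + (ln t - lnm t) * argm t * (i - M'))
      - 4 * (mod_dilog (1 / (1 + ray t)) * - p' + - lnp t * (pi / 4 - argp t) * - P')) (at t)"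
    unfolding ray_trilog_def[abs_def]
    by (rule DERIV_cong[OF DERIV_diff[OF DERIV_add[OF DERIV_add[OF DERIV_diff[OF DERIV_cmult[OF Mq] DERIV_cmult[OF Mmq]] DERIV_cmult[OF Ms]] DERIV_cmult[OF Ml]] DERIV_cmult[OF Mi]]]) simp
  have E': "(ray_elementary has_real_derivative
      4 * lnm t * M' * argm t + 2 * (lnm t)\<^sup>2 * m' - 4 * (i * lnm t * argm t + ln t * M' * argm t + ln t * lnm t * m')
      + 4 * lnp t * P' * argp t + 2 * (lnp t)\<^sup>2 * p' + 2 * (argm t)\<^sup>2 * m' + 2 * (argp t)\<^sup>2 * p'
      + pi / 2 * argm t * m' + pi / 2 * (p' * argm t + argp t * m') - pi / 2 * argp t * p'
      - pi\<^sup>2 / 2 * m' + pi\<^sup>2 / 6 * p' + pi / 2 * (lnm t - lnp t) * (M' - P') - pi * lnp t * P') (at t)"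
    unfolding ray_elementary_def[abs_def]
    by (rule DERIV_cong[OF DERIV_diff[OF DERIV_add[OF DERIV_add[OF DERIV_diff[OF DERIV_diff[OF DERIV_add[OF DERIV_add[OF DERIV_add[OF DERIV_add[OF DERIV_add[OF DERIV_diff[OF DERIV_cmult[OF DERIV_mult[OF DERIV_square[OF D(3)] D(4)]] DERIV_cmult[OF DERIV_mult[OF DERIV_mult[OF Dln D(3)] D(4)]]] DERIV_cmult[OF DERIV_mult[OF DERIV_square[OF D(1)] D(2)]]] DERIV_cmult[OF DERIV_cube[OF D(4)]]] DERIV_cmult[OF DERIV_cube[OF D(2)]]] DERIV_cmult[OF DERIV_square[OF D(4)]]] DERIV_cmult[OF DERIV_mult[OF D(2) D(4)]]] DERIV_cmult[OF DERIV_square[OF D(2)]]] DERIV_cmult[OF D(4)]] DERIV_cmult[OF D(2)]] DERIV_cmult[OF DERIV_square[OF DERIV_diff[OF D(3) D(1)]]]] DERIV_cmult[OF DERIV_square[OF D(1)]]]]) (simp add: field_simps)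
  have q: "mod_dilog ((1 - ray t) / (1 + ray t)) = mod_dilog (- ((1 - ray t) / (1 + ray t)))
      - mod_dilog (ray t) + mod_dilog (- ray t) + ln t * (lnm t - lnp t) - pi / 4 * (argm t + argp t) + pi\<^sup>2 / 4"
    and l: "mod_dilog (- ray t / (1 - ray t)) = - mod_dilog (ray t) + ((lnm t)\<^sup>2 + (argm t)\<^sup>2) / 2"
    and v: "mod_dilog (1 / (1 + ray t)) = mod_dilog (- ray t) - ln t * lnp t + (lnp t)\<^sup>2 / 2 - pi / 4 * argp t
      + (argp t)\<^sup>2 / 2 + pi\<^sup>2 / 6"
    and r: "mod_dilog (- ray t) = (Re (polylog 2 ((ray t)\<^sup>2)) + 2 * ln t * (lnp t + lnm t)) / 2 - mod_dilog (ray t)"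
  proof -
    show "mod_dilog (- ray t) = (Re (polylog 2 ((ray t)\<^sup>2)) + 2 * ln t * (lnp t + lnm t)) / 2 - mod_dilog (ray t)"
      unfolding mod_dilog_ray_square(1)[OF t, symmetric] using mod_dilog_ray_square(2)[OF t] by linarith
  qed (use mod_dilog_ray[of t] t in linarith)+
  \<comment> \<open>The dilogarithm values are replaced by variables subject to the four relations;
    what is left is a polynomial identity in logarithms, angles and their derivatives.\<close>
  have alg: "4 * (2 * ln t * (argp t - argm t) * (2 * i)) + 8 * ln 2 * ((argp t - argm t) * (2 * i))
      - 8 * ((2 * (Rq * (- m' - p') + (lnm t - lnp t) * (pi / 4 - argp t) * (M' - P'))
      - 2 * (Rmq * (- m' - p') + (lnm t - lnp t) * - argp t * (M' - P'))
      + 4 * (ln t * - argm t * i)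
      + 4 * (Rl * m' + (ln t - lnm t) * argm t * (i - M'))
      - 4 * (Rv * - p' + - lnp t * (pi / 4 - argp t) * - P')) -
     (4 * lnm t * M' * argm t + 2 * (lnm t)\<^sup>2 * m' - 4 * (i * lnm t * argm t + ln t * M' * argm t + ln t * lnm t * m')
      + 4 * lnp t * P' * argp t + 2 * (lnp t)\<^sup>2 * p' + 2 * (argm t)\<^sup>2 * m' + 2 * (argp t)\<^sup>2 * p'
      + pi / 2 * argm t * m' + pi / 2 * (p' * argm t + argp t * m') - pi / 2 * argp t * p'
      - pi\<^sup>2 / 2 * m' + pi\<^sup>2 / 6 * p' + pi / 2 * (lnm t - lnp t) * (M' - P') - pi * lnp t * P'))
      - 8 * (- 2 * i * (lnp t + lnm t) * (argm t - argp t) + (m' - p') * L)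
      = - 16 * (argm t - argp t) * (ln 2 + ln t - (lnp t + lnm t)) * i"
    if "Rq = Rmq - Rs + Rms + ln t * (lnm t - lnp t) - pi / 4 * (argm t + argp t) + pi\<^sup>2 / 4"
      "Rl = - Rs + ((lnm t)\<^sup>2 + (argm t)\<^sup>2) / 2"
      "Rv = Rms - ln t * lnp t + (lnp t)\<^sup>2 / 2 - pi / 4 * argp t + (argp t)\<^sup>2 / 2 + pi\<^sup>2 / 6"
      "Rms = (L + 2 * ln t * (lnp t + lnm t)) / 2 - Rs" for Rq Rmq Rl Rv Rs Rms L
    unfolding that by (simp add: field_simps power2_eq_square)
  show ?thesis
    unfolding ray_primitive_def[abs_def]
    by (rule DERIV_cong[OF DERIV_diff[OF DERIV_diff[OF DERIV_diff[OF DERIV_cmult[OF M2] DERIV_cmult[OF I2]] DERIV_cmult[OF DERIV_diff[OF H' E']]] DERIV_cmult[OF DERIV_mult[OF R2 DERIV_diff[OF D(4) D(2)]]]]])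
       (use alg[OF q l v r] in \<open>simp add: i_def\<close>)
qed

lemma ray_primitive_0 [simp]: "ray_primitive 0 = 0"
  using mod_trilog_of_real[of 0] mod_trilog_of_real[of 1] mod_trilog_of_real[of "- 1"]
  by (simp add: ray_primitive_def ray_trilog_def ray_elementary_def)

lemma continuous_on_ray_primitive:
  assumes "r < 1 / sqrt 2"
  shows "continuous_on {0..r} ray_primitive"
proof -
  have "continuous_on (cball 0 1) (\<lambda>z::complex. Im (polylog 2 z))" "continuous_on (cball 0 1) (\<lambda>z::complex. Re (polylog 2 z))"
    by (intro continuous_intros continuous_on_polylog; simp)+
  note cont = continuous_on_ray_args[OF assms this(1)] continuous_on_ray_args[OF assms this(2)]
    continuous_on_ray_args[OF assms continuous_on_mod_trilog] continuous_on_ray_logs[OF assms]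
  show ?thesis
    unfolding ray_primitive_def[abs_def] ray_trilog_def ray_elementary_def
    by (intro cont continuous_intros)
qed

section \<open>The value at the endpoint\<close>

lemma polylog_1_real:
  assumes "\<bar>x\<bar> < 1" shows "polylog 1 x = - ln (1 - x :: real)"
proof -
  have "(\<lambda>n. complex_of_real (x ^ Suc n / of_nat (Suc n))) sums of_real (- ln (1 - x))"
    using polylog_1_sums[of "of_real x"] assms by (simp flip: Ln_of_real)
  thus ?thesis unfolding sums_of_real_iff by (simp add: polylog_def sums_iff)
qed

lemma cis_arctan: "exp (Complex (ln (1 + u\<^sup>2) / 2) (arctan u)) = 1 + \<i> * of_real u"
proof -
  have "0 < 1 + u\<^sup>2" by (rule add_pos_nonneg) auto
  hence "exp (ln (1 + u\<^sup>2) / 2) = sqrt (1 + u\<^sup>2)" by (simp flip: ln_sqrt)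
  thus ?thesis
    using \<open>0 < 1 + u\<^sup>2\<close> by (simp add: exp_Complex_cis complex_eq_iff cos_arctan sin_arctan)
qed

lemma cis_minus_arctan: "exp (Complex (ln (1 + u\<^sup>2) / 2) (- arctan u)) = 1 - \<i> * of_real u"
  using cis_arctan[of "- u"] by (simp add: arctan_minus)

text \<open>As on the ray, z and 1 - z factor completely, here into i, 1 - i, u, 1 - u, 1 + i u and
  1 - i u up to powers.\<close>

lemma imaginary_axis_paths:
  shows path_imag: "polar_path {0<..<1} (\<lambda>u. \<i> * of_real u) ln (\<lambda>_. pi / 2)
      (\<lambda>u. ln (1 + u\<^sup>2) / 2) (\<lambda>u. - arctan u)"
    and path_imag_landen: "polar_path {0<..<1} (\<lambda>u. \<i> * of_real u / (1 + \<i> * of_real u))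
      (\<lambda>u. ln u - ln (1 + u\<^sup>2) / 2) (\<lambda>u. pi / 2 - arctan u) (\<lambda>u. - (ln (1 + u\<^sup>2) / 2)) (\<lambda>u. - arctan u)"
    and path_mixed: "polar_path {0<..<1} (\<lambda>u. (1 - of_real u) / (1 - \<i> * of_real u))
      (\<lambda>u. ln (1 - u) - ln (1 + u\<^sup>2) / 2) arctan
      (\<lambda>u. ln 2 / 2 + ln u - ln (1 + u\<^sup>2) / 2) (\<lambda>u. - (pi / 4) + arctan u)"
    and path_i_mixed: "polar_path {0<..<1} (\<lambda>u. \<i> * (1 - of_real u) / (1 - \<i> * of_real u))
      (\<lambda>u. ln (1 - u) - ln (1 + u\<^sup>2) / 2) (\<lambda>u. pi / 2 + arctan u)
      (\<lambda>u. ln 2 / 2 - ln (1 + u\<^sup>2) / 2) (\<lambda>u. - (pi / 4) + arctan u)"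
proof -
  have T: "open {0<..<1::real}" by simp
  have pos: "0 < 1 + u\<^sup>2" for u :: real by (rule add_pos_nonneg) auto
  have nz: "1 + \<i> * complex_of_real u \<noteq> 0" "1 - \<i> * complex_of_real u \<noteq> 0" for u
    by (simp_all add: complex_eq_iff)
  have L: "0 < ln (1 + u\<^sup>2)" if "u \<in> {0<..<1}" for u :: real using that by (intro ln_gt_zero) simp
  have arc: "0 < arctan u" "arctan u < pi / 4" if "u \<in> {0<..<1}" for u
    using that arctan_less_iff[of u 1] by (auto simp: arctan_one)
  have i: "exp (Complex r (pi / 2)) = \<i> * of_real (exp r)" for r
    by (simp add: exp_Complex_cis)
  have s2: "exp (Complex (ln 2 / 2) (- (pi / 4))) = 1 - \<i>"
  proof -
    have "exp (ln 2 / 2) = sqrt 2" by (simp flip: ln_sqrt)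
    thus ?thesis by (simp add: exp_Complex_cis complex_eq_iff cos_45 sin_45)
  qed
  have r: "exp (Complex r 0) = of_real (exp r)" for r by (simp add: exp_Complex_cis)
  show "polar_path {0<..<1} (\<lambda>u. \<i> * of_real u) ln (\<lambda>_. pi / 2)
      (\<lambda>u. ln (1 + u\<^sup>2) / 2) (\<lambda>u. - arctan u)"
  proof (rule polar_pathI[OF T])
    fix u :: real assume u: "u \<in> {0<..<1}"
    show "ln u < 0" using u by simp
    show "\<bar>- arctan u\<bar> < pi" using arc[OF u] by linarith
    show "\<i> * of_real u = exp (Complex (ln u) (pi / 2))" using u by (simp add: i)
    show "1 - \<i> * of_real u = exp (Complex (ln (1 + u\<^sup>2) / 2) (- arctan u))"
      by (rule cis_minus_arctan[symmetric])
  qed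
  show "polar_path {0<..<1} (\<lambda>u. \<i> * of_real u / (1 + \<i> * of_real u))
      (\<lambda>u. ln u - ln (1 + u\<^sup>2) / 2) (\<lambda>u. pi / 2 - arctan u) (\<lambda>u. - (ln (1 + u\<^sup>2) / 2)) (\<lambda>u. - arctan u)"
  proof (rule polar_pathI[OF T])
    fix u :: real assume u: "u \<in> {0<..<1}"
    have "ln u < 0" using u by simp
    thus "ln u - ln (1 + u\<^sup>2) / 2 < 0" using L[OF u] by linarith
    show "\<bar>- arctan u\<bar> < pi" using arc[OF u] by linarith
    show "\<i> * of_real u / (1 + \<i> * of_real u) = exp (Complex (ln u - ln (1 + u\<^sup>2) / 2) (pi / 2 - arctan u))"
      unfolding exp_Complex_diff[symmetric] cis_arctan i using u by simp
    have "1 - \<i> * of_real u / (1 + \<i> * of_real u) = 1 / (1 + \<i> * of_real u)"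
      using nz[of u] by (simp add: field_simps)
    thus "1 - \<i> * of_real u / (1 + \<i> * of_real u) = exp (Complex (- (ln (1 + u\<^sup>2) / 2)) (- arctan u))"
      unfolding exp_Complex_inverse[symmetric] cis_arctan .
  qed
  show "polar_path {0<..<1} (\<lambda>u. (1 - of_real u) / (1 - \<i> * of_real u))
      (\<lambda>u. ln (1 - u) - ln (1 + u\<^sup>2) / 2) arctan
      (\<lambda>u. ln 2 / 2 + ln u - ln (1 + u\<^sup>2) / 2) (\<lambda>u. - (pi / 4) + arctan u)"
  proof (rule polar_pathI[OF T])
    fix u :: real assume u: "u \<in> {0<..<1}"
    have "ln (1 - u) < 0" using u by simp
    thus "ln (1 - u) - ln (1 + u\<^sup>2) / 2 < 0" using L[OF u] by linarith
    show "\<bar>- (pi / 4) + arctan u\<bar> < pi" using arc[OF u] by linarith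
    show "(1 - of_real u) / (1 - \<i> * of_real u) = exp (Complex (ln (1 - u) - ln (1 + u\<^sup>2) / 2) (arctan u))"
      using exp_Complex_diff[of "ln (1 - u)" 0 "ln (1 + u\<^sup>2) / 2" "- arctan u"] u
      unfolding cis_minus_arctan r by simp
    have "1 - (1 - of_real u) / (1 - \<i> * of_real u) = (1 - \<i>) * of_real u / (1 - \<i> * of_real u)"
      using nz[of u] by (simp add: field_simps)
    also have "\<dots> = exp (Complex (ln 2 / 2 + ln u - ln (1 + u\<^sup>2) / 2) (- (pi / 4) + arctan u))"
      using exp_Complex_diff[of "ln 2 / 2 + ln u" "- (pi / 4) + 0" "ln (1 + u\<^sup>2) / 2" "- arctan u"] u
      unfolding cis_minus_arctan exp_Complex_mult[symmetric] r s2 by simp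
    finally show "1 - (1 - of_real u) / (1 - \<i> * of_real u) =
        exp (Complex (ln 2 / 2 + ln u - ln (1 + u\<^sup>2) / 2) (- (pi / 4) + arctan u))" .
  qed
  show "polar_path {0<..<1} (\<lambda>u. \<i> * (1 - of_real u) / (1 - \<i> * of_real u))
      (\<lambda>u. ln (1 - u) - ln (1 + u\<^sup>2) / 2) (\<lambda>u. pi / 2 + arctan u)
      (\<lambda>u. ln 2 / 2 - ln (1 + u\<^sup>2) / 2) (\<lambda>u. - (pi / 4) + arctan u)"
  proof (rule polar_pathI[OF T])
    fix u :: real assume u: "u \<in> {0<..<1}"
    have "ln (1 - u) < 0" using u by simp
    thus "ln (1 - u) - ln (1 + u\<^sup>2) / 2 < 0" using L[OF u] by linarith
    show "\<bar>- (pi / 4) + arctan u\<bar> < pi" using arc[OF u] by linarith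
    show "\<i> * (1 - of_real u) / (1 - \<i> * of_real u) = exp (Complex (ln (1 - u) - ln (1 + u\<^sup>2) / 2) (pi / 2 + arctan u))"
      using exp_Complex_diff[of "ln (1 - u)" "pi / 2" "ln (1 + u\<^sup>2) / 2" "- arctan u"] u
      unfolding cis_minus_arctan i by simp
    have "1 - \<i> * (1 - of_real u) / (1 - \<i> * of_real u) = (1 - \<i>) / (1 - \<i> * of_real u)"
      using nz[of u] by (simp add: field_simps)
    also have "\<dots> = exp (Complex (ln 2 / 2 - ln (1 + u\<^sup>2) / 2) (- (pi / 4) + arctan u))"
      using exp_Complex_diff[of "ln 2 / 2" "- (pi / 4)" "ln (1 + u\<^sup>2) / 2" "- arctan u"]
      unfolding cis_minus_arctan s2 by simp
    finally show "1 - \<i> * (1 - of_real u) / (1 - \<i> * of_real u) =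
        exp (Complex (ln 2 / 2 - ln (1 + u\<^sup>2) / 2) (- (pi / 4) + arctan u))" .
  qed
qed

lemma DERIV_half_ln_1_plus_square:
  "((\<lambda>u. ln (1 + u\<^sup>2) / 2) has_real_derivative u / (1 + u\<^sup>2)) (at u)"
proof -
  have "0 < 1 + u\<^sup>2" by (rule add_pos_nonneg) auto
  thus ?thesis by (auto intro!: derivative_eq_intros simp: field_simps)
qed

lemma continuous_on_half_ln_1_plus_square: "continuous_on A (\<lambda>u::real. ln (1 + u\<^sup>2) / 2)"
  by (intro continuous_at_imp_continuous_on ballI DERIV_isCont[OF DERIV_half_ln_1_plus_square])

lemma continuous_on_comp_cball:
  assumes "continuous_on (cball 0 1) f" "continuous_on A z" "\<And>u. u \<in> A \<Longrightarrow> norm (z u) \<le> 1"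
  shows "continuous_on A (\<lambda>u. f (z u))"
  by (rule continuous_on_compose2[OF assms(1,2)]) (use assms(3) in auto)

lemma norm_1_plus_i_mult: "norm (1 + \<i> * of_real u) = sqrt (1 + u\<^sup>2)" "norm (1 - \<i> * of_real u) = sqrt (1 + u\<^sup>2)"
  by (simp_all add: cmod_def)

text \<open>Landen's transformation sends i u to i u / (1 + i u), which is (1 + i)/2 at u = 1. The
  value Im Li_2(i) is Catalan's constant; expressing it through Im Li_2((1 + i)/2) lets it cancel at
  the endpoint.\<close>

lemma Im_dilog_half_1_plus_i:
  "Im (polylog 2 ((1 + \<i>) / 2)) = Im (polylog 2 \<i>) - pi / 8 * ln 2"
proof -
  define X where "X = (\<lambda>u. Im (polylog 2 (\<i> * of_real u / (1 + \<i> * of_real u)))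
     - Im (polylog 2 (\<i> * of_real u)) + ln (1 + u\<^sup>2) / 2 * arctan u)"
  have nz: "1 + \<i> * complex_of_real u \<noteq> 0" for u by (simp add: complex_eq_iff)
  have I: "continuous_on (cball 0 1) (\<lambda>z::complex. Im (polylog 2 z))"
    by (intro continuous_intros continuous_on_polylog) simp
  have "continuous_on {0..1} (\<lambda>u. Im (polylog 2 (\<i> * of_real u / (1 + \<i> * of_real u))))"
  proof (rule continuous_on_comp_cball[OF I])
    show "continuous_on {0..1} (\<lambda>u. \<i> * complex_of_real u / (1 + \<i> * of_real u))"
      by (intro continuous_intros) (use nz in blast)
    fix u :: real assume "u \<in> {0..1}"
    hence "u \<le> sqrt (1 + u\<^sup>2)" "0 < sqrt (1 + u\<^sup>2)" by (auto intro: real_le_rsqrt add_pos_nonneg)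
    thus "norm (\<i> * complex_of_real u / (1 + \<i> * of_real u)) \<le> 1" using \<open>u \<in> {0..1}\<close>
      by (simp add: norm_divide norm_mult norm_1_plus_i_mult divide_le_eq_1)
  qed
  note c1 = this
  have c2: "continuous_on {0..1} (\<lambda>u. Im (polylog 2 (\<i> * complex_of_real u)))"
    by (rule continuous_on_comp_cball[OF I]) (auto intro!: continuous_intros simp: norm_mult)
  have "continuous_on {0..1} X"
    unfolding X_def by (intro c1 c2 continuous_on_half_ln_1_plus_square continuous_intros)
  moreover have "(X has_real_derivative 0) (at u)" if u: "0 < u" "u < 1" for u
  proof -
    have uT: "u \<in> {0<..<1}" using u by simp
    note A = DERIV_arctan[of u] and L = DERIV_half_ln_1_plus_square[of u] and l = DERIV_ln_divide[OF u(1)]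
    show ?thesis unfolding X_def
      by (rule DERIV_cong[OF DERIV_add[OF DERIV_diff[OF
            DERIV_Im_dilog[OF path_imag_landen uT DERIV_diff[OF l L] DERIV_diff[OF DERIV_const A] DERIV_minus[OF L]]
            DERIV_Im_dilog[OF path_imag uT l DERIV_const L]] DERIV_mult[OF L A]]])
         (simp add: algebra_simps)
  qed
  ultimately have "X 1 = X 0" by (intro DERIV_isconst2[of 0 1 X]) auto
  moreover have e: "\<i> * of_real 1 / (1 + \<i> * of_real 1) = (1 + \<i>) / 2"
    by (simp add: complex_eq_iff Re_divide Im_divide)
  have "X 1 = Im (polylog 2 ((1 + \<i>) / 2)) - Im (polylog 2 \<i>) + ln 2 / 2 * (pi / 4)"
    unfolding X_def e by (simp add: arctan_one)
  moreover have "X 0 = 0" by (simp add: X_def)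
  ultimately show ?thesis by (simp add: mult.commute)
qed

text \<open>This is where Li_2 at a real point enters. For a = 2 - sqrt 3 the two arguments on the
  left are conjugate to 1/(1 + r) and -r/(1 - r) at the endpoint, and the equations on the ray
  evaluate the same difference by Re Li_2(i a) and elementary terms. Comparing the two evaluations
  determines Re Li_2(i a) from Li_2(a). The constant is zeta(2) - Re Li_2(i).\<close>

lemma mod_dilog_mixed:
  assumes a: "0 < a" "a < 1"
  shows "mod_dilog ((1 - of_real a) / (1 - \<i> * of_real a)) - mod_dilog (\<i> * (1 - of_real a) / (1 - \<i> * of_real a))
    = Re (polylog 2 (\<i> * of_real a)) - polylog 2 a + 3 * pi\<^sup>2 / 16"
proof -
  define X where "X = (\<lambda>u. mod_dilog ((1 - of_real u) / (1 - \<i> * of_real u))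
      - mod_dilog (\<i> * (1 - of_real u) / (1 - \<i> * of_real u)) - Re (polylog 2 (\<i> * of_real u)) + polylog 2 u)"
  have nz: "1 - \<i> * complex_of_real u \<noteq> 0" for u by (simp add: complex_eq_iff)
  have n: "norm ((1 - of_real u) / (1 - \<i> * of_real u)) \<le> 1" "norm (\<i> * (1 - of_real u) / (1 - \<i> * of_real u)) \<le> 1"
    if "u \<in> {0..a}" for u
  proof -
    have "1 - complex_of_real u = of_real (1 - u)" by simp
    hence "norm (1 - complex_of_real u) = 1 - u" using that a by (simp only: norm_of_real) simp
    moreover have "1 \<le> sqrt (1 + u\<^sup>2)" by simp
    moreover from this have "1 - u \<le> sqrt (1 + u\<^sup>2)" "0 < sqrt (1 + u\<^sup>2)"
      using that unfolding atLeastAtMost_iff by linarith+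
    ultimately show "norm ((1 - of_real u) / (1 - \<i> * of_real u)) \<le> 1" "norm (\<i> * (1 - of_real u) / (1 - \<i> * of_real u)) \<le> 1"
      unfolding norm_divide norm_mult norm_1_plus_i_mult norm_ii by simp_all
  qed
  have c1: "continuous_on {0..a} (\<lambda>u. mod_dilog ((1 - of_real u) / (1 - \<i> * of_real u)))"
    by (rule continuous_on_comp_cball[OF continuous_on_mod_dilog _ n(1)]) (intro continuous_intros; use nz in blast)
  have c2: "continuous_on {0..a} (\<lambda>u. mod_dilog (\<i> * (1 - of_real u) / (1 - \<i> * of_real u)))"
    by (rule continuous_on_comp_cball[OF continuous_on_mod_dilog _ n(2)]) (intro continuous_intros; use nz in blast)
  have R: "continuous_on (cball 0 1) (\<lambda>z::complex. Re (polylog 2 z))"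
    by (intro continuous_intros continuous_on_polylog) simp
  have c3: "continuous_on {0..a} (\<lambda>u. Re (polylog 2 (\<i> * complex_of_real u)))"
    by (rule continuous_on_comp_cball[OF R]) (use a in \<open>auto intro!: continuous_intros simp: norm_mult\<close>)
  have c4: "continuous_on {0..a} (polylog 2 :: real \<Rightarrow> real)"
    by (rule continuous_on_subset[OF continuous_on_polylog]) (use a in auto)
  have "continuous_on {0..a} X" unfolding X_def by (intro c1 c2 c3 c4 continuous_on_add continuous_on_diff)
  moreover have "(X has_real_derivative 0) (at u)" if u: "0 < u" "u < a" for u
  proof -
    have uT: "u \<in> {0<..<1}" and u1: "0 < 1 - u" using u a by simp_all
    note A = DERIV_arctan[of u] and L = DERIV_half_ln_1_plus_square[of u] and l = DERIV_ln_divide[OF u(1)]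
    have l1: "((\<lambda>u. ln (1 - u)) has_real_derivative - 1 / (1 - u)) (at u)"
      using u1 by (auto intro!: derivative_eq_intros)
    note \<rho> = DERIV_diff[OF l1 L]
    have i: "((\<lambda>u. Re (polylog 2 (\<i> * of_real u))) has_real_derivative - (ln (1 + u\<^sup>2) / 2) / u) (at u)"
    proof -
      have "((\<lambda>u. mod_dilog (\<i> * of_real u) - ln u * (ln (1 + u\<^sup>2) / 2)) has_real_derivative - (ln (1 + u\<^sup>2) / 2) / u) (at u)"
        by (rule DERIV_cong[OF DERIV_diff[OF DERIV_mod_dilog[OF path_imag uT l DERIV_const L] DERIV_mult[OF l L]]])
           (simp add: algebra_simps)
      thus ?thesis
      proof (rule has_field_derivative_transform_within_open[OF _ open_greaterThanLessThan uT])
        fix x :: real assume "x \<in> {0<..<1}"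
        moreover have "ln (sqrt (1 + x\<^sup>2)) = ln (1 + x\<^sup>2) / 2" by (rule ln_sqrt) (rule add_nonneg_nonneg; simp)
        ultimately show "mod_dilog (\<i> * of_real x) - ln x * (ln (1 + x\<^sup>2) / 2) = Re (polylog 2 (\<i> * of_real x))"
          by (simp add: mod_dilog_def norm_mult norm_1_plus_i_mult)
      qed
    qed
    have p: "(polylog 2 has_real_derivative - ln (1 - u) / u) (at u)"
      using DERIV_polylog[of u 1] polylog_1_real[of u] u a by (simp add: numeral_2_eq_2)
    show ?thesis unfolding X_def
      by (rule DERIV_cong[OF DERIV_add[OF DERIV_diff[OF DERIV_diff[OF
            DERIV_mod_dilog[OF path_mixed uT \<rho> A DERIV_diff[OF DERIV_add[OF DERIV_const l] L]]
            DERIV_mod_dilog[OF path_i_mixed uT \<rho> DERIV_add[OF DERIV_const A] DERIV_diff[OF DERIV_const L]]] i] p]])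
         (simp add: algebra_simps diff_divide_distrib add_divide_distrib)
  qed
  ultimately have X: "X a = X 0" using a by (intro DERIV_isconst2[of 0 a X]) auto
  \<comment> \<open>Duplication at i, whose negative is its conjugate, gives Re Li_2(i) =
    -pi^2/48.\<close>
  have "polylog 2 \<i> + polylog 2 (- \<i>) = polylog 2 (- 1) / 2"
    using polylog_duplication[of 2 \<i>] by simp
  moreover have "polylog 2 (- \<i>) = cnj (polylog 2 \<i>)" using polylog_cnj[of 2 \<i>] by simp
  ultimately have "polylog 2 \<i> + cnj (polylog 2 \<i>) = of_real (- pi\<^sup>2 / 24)"
    by (simp add: dilog_minus_1)
  from arg_cong[OF this, of Re] have "Re (polylog 2 \<i>) = - pi\<^sup>2 / 48" by simp
  hence "X 0 = 3 * pi\<^sup>2 / 16" by (simp add: X_def mod_dilog_norm_1 polylog_2_1 del: of_real_divide of_real_power)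
  with X show ?thesis by (simp add: X_def)
qed

text \<open>The partial fraction form of sin 3x = 4 sin x sin(pi/3 - x) sin(pi/3 + x).\<close>

lemma csc_triple:
  fixes x :: real
  assumes "sin (3 * x) \<noteq> 0"
  shows "3 / sin (3 * x) = 1 / sin x + 1 / sin (pi / 3 - x) - 1 / sin (pi / 3 + x)"
proof -
  have S: "sin (pi / 3 - x) * sin (pi / 3 + x) = 3 / 4 - (sin x)\<^sup>2"
  proof -
    have "sin (pi / 3 - x) * sin (pi / 3 + x) = 3 / 4 * (cos x)\<^sup>2 - (sin x)\<^sup>2 / 4"
      unfolding sin_add sin_diff sin_60 cos_60 by (simp add: field_simps power2_eq_square)
    thus ?thesis by (simp add: cos_squared_eq field_simps)
  qed
  have "sin (3 * x) = sin (2 * x + x)" by simp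
  also have "\<dots> = 2 * sin x * (cos x)\<^sup>2 + (1 - 2 * (sin x)\<^sup>2) * sin x"
    unfolding sin_add sin_double cos_double_sin by (simp add: power2_eq_square)
  also have "\<dots> = 4 * sin x * (sin (pi / 3 - x) * sin (pi / 3 + x))"
    unfolding S cos_squared_eq by (simp add: algebra_simps)
  finally have 3: "sin (3 * x) = 4 * sin x * (sin (pi / 3 - x) * sin (pi / 3 + x))" .
  hence nz: "sin x \<noteq> 0" "sin (pi / 3 - x) \<noteq> 0" "sin (pi / 3 + x) \<noteq> 0" using assms by auto
  have "sin (pi / 3 + x) - sin (pi / 3 - x) = sin x"
    by (simp add: sin_add sin_diff cos_60)
  hence "sin (pi / 3 - x) * sin (pi / 3 + x) + sin x * (sin (pi / 3 + x) - sin (pi / 3 - x)) = 3 / 4"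
    using S by (simp add: power2_eq_square)
  hence "3 = 4 * (sin (pi / 3 - x) * sin (pi / 3 + x) + sin x * sin (pi / 3 + x) - sin x * sin (pi / 3 - x))"
    by (simp add: algebra_simps)
  thus ?thesis unfolding 3 using nz by (simp add: divide_simps) (simp add: algebra_simps)
qed

lemma tan_pi_twelfth: "tan (pi / 12) = 2 - sqrt 3"
proof -
  have "tan (pi / 12) = tan (pi / 3 - pi / 4)" by (simp add: field_simps)
  also have "\<dots> = (sqrt 3 - 1) / (1 + sqrt 3)"
    by (subst tan_diff) (auto simp: cos_60 cos_45 tan_60 tan_45 cos_diff[symmetric] cos_gt_zero_pi less_imp_neq[symmetric])
  also have "\<dots> = 2 - sqrt 3"
  proof -
    have "0 < 1 + sqrt 3" by (simp add: add_pos_pos)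
    moreover have "(2 - sqrt 3) * (1 + sqrt 3) = sqrt 3 - 1" by (simp add: algebra_simps)
    ultimately show ?thesis by (simp add: divide_eq_eq)
  qed
  finally show ?thesis .
qed

text \<open>\<open>J\<close> is the inverse tangent integral, and J(tan x) has derivative 2x / sin
  2x. By \<open>csc_triple\<close> the triplication combination has no term proportional to x in its
  derivative, and the terms left over, multiples of pi/6, are integrated by ln tan. At x = pi/12 the
  angles 3x, x, pi/6 - x, pi/6 + x are pi/4, pi/12, pi/12, pi/4, so J(2 - sqrt 3) occurs twice and
  J(1) is all that remains.\<close>

lemma Im_dilog_tan_triple:
  "Im (polylog 2 (\<i> * of_real (2 - sqrt 3))) = 2 / 3 * Im (polylog 2 \<i>) + pi / 12 * ln (2 - sqrt 3)"
proof -
  define J where "J = (\<lambda>u. Im (polylog 2 (\<i> * complex_of_real u)))"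
  define W where "W = (\<lambda>x. J (tan (3 * x)) / 3 - J (tan x) - J (tan (pi / 6 - x)) + J (tan (pi / 6 + x))
      + pi / 6 * (ln (tan (pi / 6 - x)) - ln (tan (pi / 6 + x))))"
  have I: "continuous_on (cball 0 1) (\<lambda>z::complex. Im (polylog 2 z))"
    by (intro continuous_intros continuous_on_polylog) simp
  have contJ: "continuous_on {0..1} J"
    unfolding J_def by (rule continuous_on_comp_cball[OF I]) (auto intro!: continuous_intros simp: norm_mult)
  have tan01: "0 \<le> tan x \<and> tan x \<le> 1" if "0 \<le> x" "x \<le> pi / 4" for x
    using that tan_mono_le[of 0 x] tan_mono_le[of x "pi / 4"] pi_gt_zero by (auto simp: tan_45)
  have tan01': "0 < tan x \<and> tan x < 1" if "0 < x" "x < pi / 4" for x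
    using that tan_monotone[of 0 x] tan_monotone[of x "pi / 4"] pi_gt_zero by (auto simp: tan_45)
  have cos_nz: "cos x \<noteq> 0" if "0 \<le> x" "x \<le> pi / 4" for x
    using cos_gt_zero_pi[of x] that pi_gt_zero by auto
  have contT: "continuous_on {0..pi/12} (\<lambda>x. J (tan (f x)))"
    if "continuous_on {0..pi/12} f" "\<And>x. x \<in> {0..pi/12} \<Longrightarrow> 0 \<le> f x \<and> f x \<le> pi / 4" for f
    by (rule continuous_on_compose2[OF contJ])
       (use that tan01 cos_nz in \<open>auto intro!: continuous_intros\<close>)
  have contL: "continuous_on {0..pi/12} (\<lambda>x. ln (tan (f x)))"
    if "continuous_on {0..pi/12} f" "\<And>x. x \<in> {0..pi/12} \<Longrightarrow> 0 < f x \<and> f x \<le> pi / 4" for f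
  proof -
    have "0 < tan (f x)" if "x \<in> {0..pi/12}" for x
      using that \<open>\<And>x. x \<in> {0..pi/12} \<Longrightarrow> 0 < f x \<and> f x \<le> pi / 4\<close>[OF that] pi_gt_zero by (intro tan_gt_zero) auto
    moreover have "cos (f x) \<noteq> 0" if "x \<in> {0..pi/12}" for x
      using cos_nz[of "f x"] \<open>\<And>x. x \<in> {0..pi/12} \<Longrightarrow> 0 < f x \<and> f x \<le> pi / 4\<close>[OF that] by auto
    ultimately show ?thesis using that(1) by (intro continuous_intros ballI) force+
  qed
  have "continuous_on {0..pi/12} W"
    unfolding W_def by (intro contT contL continuous_on_add continuous_on_diff continuous_on_mult
        continuous_on_divide continuous_on_const continuous_on_id) (use pi_gt3 in auto)
  moreover have "(W has_real_derivative 0) (at x)" if x: "0 < x" "x < pi / 12" for x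
  proof -
    have DJ: "((\<lambda>x. J (tan (f x))) has_real_derivative 2 * f x * f' / sin (2 * f x)) (at x)"
      and DL: "((\<lambda>x. ln (tan (f x))) has_real_derivative 2 * f' / sin (2 * f x)) (at x)"
      if f: "(f has_real_derivative f') (at x)" "0 < f x" "f x < pi / 4" for f f'
    proof -
      have c: "0 < cos (f x)" "0 < sin (f x)" using f pi_gt_zero by (auto intro!: cos_gt_zero_pi sin_gt_zero)
      have t: "tan (f x) \<in> {0<..<1}" using tan01'[of "f x"] f by auto
      have T: "((\<lambda>x. tan (f x)) has_real_derivative inverse ((cos (f x))\<^sup>2) * f') (at x)"
        by (rule DERIV_chain2[OF DERIV_tan f(1)]) (use c in simp)
      have "arctan (tan (f x)) = f x" using f pi_gt_zero by (intro arctan_tan) auto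
      hence "(J has_real_derivative f x * (1 / tan (f x))) (at (tan (f x)))"
        unfolding J_def
        by (intro DERIV_cong[OF DERIV_Im_dilog[OF path_imag t DERIV_ln_divide DERIV_const DERIV_half_ln_1_plus_square]])
           (use t in auto)
      from DERIV_chain2[OF this T]
      show "((\<lambda>x. J (tan (f x))) has_real_derivative 2 * f x * f' / sin (2 * f x)) (at x)"
        unfolding sin_double tan_def by (rule DERIV_cong) (use c in \<open>simp add: field_simps power2_eq_square\<close>)
      have "0 < tan (f x)" using t by simp
      from DERIV_chain2[OF DERIV_ln_divide[OF this] T]
      show "((\<lambda>x. ln (tan (f x))) has_real_derivative 2 * f' / sin (2 * f x)) (at x)"
        unfolding sin_double tan_def by (rule DERIV_cong) (use c in \<open>simp add: field_simps power2_eq_square\<close>)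
    qed
    have d3: "((\<lambda>x. 3 * x) has_real_derivative 3) (at x)" and d1: "((\<lambda>x. x) has_real_derivative 1) (at x)"
      and dm: "((\<lambda>x. pi / 6 - x) has_real_derivative - 1) (at x)" and dp: "((\<lambda>x. pi / 6 + x) has_real_derivative 1) (at x)"
      by (auto intro!: derivative_eq_intros)
    have b: "0 < 3 * x" "3 * x < pi / 4" "0 < x" "x < pi / 4" "0 < pi / 6 - x" "pi / 6 - x < pi / 4"
      "0 < pi / 6 + x" "pi / 6 + x < pi / 4" using x by (simp_all add: field_simps)
    have "sin (6 * x) > 0" using x by (intro sin_gt_zero) auto
    hence csc: "3 / sin (6 * x) = 1 / sin (2 * x) + 1 / sin (pi / 3 - 2 * x) - 1 / sin (pi / 3 + 2 * x)"
      using csc_triple[of "2 * x"] by simp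
    have e: "2 * (3 * x) = 6 * x" "2 * (pi / 6 - x) = pi / 3 - 2 * x" "2 * (pi / 6 + x) = pi / 3 + 2 * x" by simp_all
    have "(W has_real_derivative 2 * (3 * x) * 3 / sin (2 * (3 * x)) / 3 - 2 * x * 1 / sin (2 * x)
        - 2 * (pi / 6 - x) * - 1 / sin (2 * (pi / 6 - x)) + 2 * (pi / 6 + x) * 1 / sin (2 * (pi / 6 + x))
        + pi / 6 * (2 * - 1 / sin (2 * (pi / 6 - x)) - 2 * 1 / sin (2 * (pi / 6 + x)))) (at x)"
      unfolding W_def
      by (intro DERIV_add DERIV_diff DERIV_cmult DERIV_cdivide DJ DL d3 d1 dm dp b)
    moreover have "2 * (3 * x) * 3 / sin (2 * (3 * x)) / 3 - 2 * x * 1 / sin (2 * x)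
        - 2 * (pi / 6 - x) * - 1 / sin (2 * (pi / 6 - x)) + 2 * (pi / 6 + x) * 1 / sin (2 * (pi / 6 + x))
        + pi / 6 * (2 * - 1 / sin (2 * (pi / 6 - x)) - 2 * 1 / sin (2 * (pi / 6 + x)))
      = 2 * x * (3 / sin (6 * x) - (1 / sin (2 * x) + 1 / sin (pi / 3 - 2 * x) - 1 / sin (pi / 3 + 2 * x)))"
      unfolding e by (simp add: algebra_simps diff_divide_distrib add_divide_distrib)
    ultimately show ?thesis unfolding csc by simp
  qed
  ultimately have "W (pi / 12) = W 0" by (intro DERIV_isconst2[of 0 "pi / 12" W]) auto
  moreover have "W 0 = 0" by (simp add: W_def J_def)
  moreover have e: "3 * (pi / 12) = pi / 4" "pi / 6 - pi / 12 = pi / 12" "pi / 6 + pi / 12 = pi / 4" by simp_all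
  have "W (pi / 12) = J 1 / 3 - J (2 - sqrt 3) - J (2 - sqrt 3) + J 1 + pi / 6 * (ln (2 - sqrt 3) - ln 1)"
    unfolding W_def e tan_pi_twelfth tan_45 ..
  ultimately show ?thesis by (simp add: J_def)
qed

section \<open>Evaluation of the primitive at t^2 = tan(pi/12)\<close>

lemma cos_sin_pi_twelfth: "cos (pi / 12) = sqrt 2 * (1 + sqrt 3) / 4" "sin (pi / 12) = sqrt 2 * (sqrt 3 - 1) / 4"
proof -
  have e: "pi / 12 = pi / 3 - pi / 4" by simp
  show "cos (pi / 12) = sqrt 2 * (1 + sqrt 3) / 4" "sin (pi / 12) = sqrt 2 * (sqrt 3 - 1) / 4"
    unfolding e cos_diff sin_diff cos_60 sin_60 cos_45 sin_45 by (simp_all add: field_simps)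
qed

text \<open>With r = \<open>ray t\<close> one has 1 + r of modulus sqrt 2 and angle pi/12, and 1 - r
  of modulus sqrt 3 - 1 and angle -pi/6. All logarithms reduce to ln 2, ln (2 - sqrt 3) and rational
  multiples of pi, and the arguments of the trilogarithms become those of
  \<open>mod_trilog_relation_root2_circle\<close> up to conjugation.\<close>

lemma ray_endpoint:
  defines "t \<equiv> (sqrt 3 - 1) / sqrt 2"
  shows endpoint_bounds: "0 < t" "t < 1 / sqrt 2"
    and endpoint_square: "t\<^sup>2 = 2 - sqrt 3"
    and endpoint_logs: "lnp t = ln 2 / 2" "argp t = pi / 12" "lnm t = (ln 2 + ln (2 - sqrt 3)) / 2"
      "argm t = pi / 6" "ln t = ln (2 - sqrt 3) / 2"
    and endpoint_args: "(ray t)\<^sup>2 = \<i> * of_real (2 - sqrt 3)"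
      "1 / (1 + ray t) = cnj (cis (pi / 12) / sqrt 2)"
      "- ray t / (1 - ray t) = cnj (cis (7 * pi / 12) / sqrt 2)"
      "(1 - ray t) / (1 + ray t) = cnj (ray t)"
      "(1 - of_real (2 - sqrt 3)) / (1 - \<i> * of_real (2 - sqrt 3)) = cis (pi / 12) / sqrt 2"
      "\<i> * (1 - of_real (2 - sqrt 3)) / (1 - \<i> * of_real (2 - sqrt 3)) = cis (7 * pi / 12) / sqrt 2"
proof -
  define a where "a = 2 - sqrt 3"
  have s3: "1 < sqrt 3" "sqrt 3 < 2" "sqrt 3 * sqrt 3 = 3" using real_sqrt_less_iff[of 3 4] by auto
  have a: "0 < a" using s3 by (simp add: a_def)
  show t: "0 < t" using s3 by (simp add: t_def)
  show t2: "t < 1 / sqrt 2" unfolding t_def using s3 by (intro divide_strict_right_mono) auto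
  \<comment> \<open>This identity turns the modulus sqrt 3 - 1 into sqrt (2 a), whence ln 2 and ln a
    suffice.\<close>
  have sq: "(sqrt 3 - 1)\<^sup>2 = 2 * a" using s3 by (simp add: a_def power2_eq_square algebra_simps)
  show ta: "t\<^sup>2 = 2 - sqrt 3" unfolding t_def power_divide sq by (simp add: a_def)
  have "ln (t\<^sup>2) = 2 * ln t" using t by (simp add: ln_realpow)
  thus "ln t = ln (2 - sqrt 3) / 2" unfolding ta by simp
  have r: "ray t = of_real t * cis (pi / 4)" by (simp add: ray_def)
  have ray: "ray t = Complex ((sqrt 3 - 1) / 2) ((sqrt 3 - 1) / 2)"
    unfolding ray_altdef t_def by (simp add: field_simps)
  have "sqrt (2 * a) = sqrt 3 - 1" unfolding sq[symmetric] using s3 by simp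
  moreover have "exp ((ln 2 + ln a) / 2) = sqrt (2 * a)"
  proof -
    have "(ln 2 + ln a) / 2 = ln (2 * a) / 2" using a by (simp add: ln_mult)
    also have "\<dots> = ln (sqrt (2 * a))" using a by (simp only: ln_sqrt)
    finally show ?thesis using a by (simp only: exp_ln real_sqrt_gt_0_iff mult_pos_pos zero_less_numeral)
  qed
  ultimately have ea: "exp ((ln 2 + ln a) / 2) = sqrt 3 - 1" by simp
  have e2: "exp (ln 2 / 2) = sqrt 2" by (simp flip: ln_sqrt)
  have p: "1 + ray t = exp (Complex (ln 2 / 2) (pi / 12))"
    unfolding exp_Complex_cis e2 ray by (simp add: complex_eq_iff cos_sin_pi_twelfth field_simps)
  have m: "1 - ray t = exp (Complex ((ln 2 + ln a) / 2) (- (pi / 6)))"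
    unfolding exp_Complex_cis ea ray using s3 by (simp add: complex_eq_iff cos_30 sin_30 field_simps)
  show "lnp t = ln 2 / 2" "lnm t = (ln 2 + ln (2 - sqrt 3)) / 2"
    unfolding lnp_def lnm_def p m norm_exp_eq_Re by (simp_all add: a_def)
  show "argp t = pi / 12" "argm t = pi / 6"
  proof -
    have Ln_C: "Ln (exp (Complex u v)) = Complex u v" if "- pi < v" "v \<le> pi" for u v
      by (rule Ln_exp) (simp_all only: complex.sel that)
    have b: "- pi < pi / 12" "pi / 12 \<le> pi" "- pi < - (pi / 6)" "- (pi / 6) \<le> pi"
      using pi_gt_zero by linarith+
    show "argp t = pi / 12" "argm t = pi / 6"
      unfolding argp_def argm_def p m Ln_C[OF b(1,2)] Ln_C[OF b(3,4)] by simp_all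
  qed
  have E: "exp (Complex (- (ln 2 / 2)) v) = cis v / sqrt 2" for v
    unfolding exp_Complex_cis exp_minus e2 by (simp only: of_real_inverse divide_inverse mult.commute)
  have cn: "cnj (cis v / sqrt 2) = cis (- v) / sqrt 2" for v
    by (simp only: complex_cnj_divide cis_cnj complex_cnj_complex_of_real)
  show "1 / (1 + ray t) = cnj (cis (pi / 12) / sqrt 2)"
    unfolding p exp_Complex_inverse E cn by (rule refl)
  have mr: "- ray t = exp (Complex (ln a / 2) (pi / 4 - pi))"
  proof -
    have "exp (ln a / 2) = t"
    proof -
      have "ln a / 2 = ln (sqrt a)" using a by (simp only: ln_sqrt)
      moreover have "sqrt a = t" using ta t unfolding a_def[symmetric] by (metis real_sqrt_unique less_imp_le)
      ultimately show ?thesis using t by simp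
    qed
    moreover have "cis (pi / 4 - pi) = - cis (pi / 4)" by (simp only: cis_divide[symmetric] cis_pi) simp
    ultimately show ?thesis by (simp add: exp_Complex_cis r)
  qed
  have "- ray t / (1 - ray t) = exp (Complex (- (ln 2 / 2)) (- (7 * pi / 12)))"
    unfolding mr m exp_Complex_diff by (simp add: field_simps)
  thus "- ray t / (1 - ray t) = cnj (cis (7 * pi / 12) / sqrt 2)" unfolding E cn .
  have nz: "1 + ray t \<noteq> 0" unfolding p by simp
  have "(1 + ray t) * cnj (ray t) = 1 - ray t"
    unfolding ray using s3 by (simp add: complex_eq_iff field_simps)
  thus "(1 - ray t) / (1 + ray t) = cnj (ray t)" using nz by (simp add: field_simps)
  have c4: "(cis (pi / 4))\<^sup>2 = \<i>" unfolding power2_eq_square cis_mult by simp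
  show c2: "(ray t)\<^sup>2 = \<i> * of_real (2 - sqrt 3)"
    unfolding r power_mult_distrib of_real_power[symmetric] ta c4 by (rule mult.commute)
  have "1 - \<i> * of_real (2 - sqrt 3) = (1 + ray t) * (1 - ray t)"
    unfolding c2[symmetric] by (simp add: power2_eq_square algebra_simps)
  also have "\<dots> = exp (Complex (ln 2 / 2 + (ln 2 + ln a) / 2) (- (pi / 12)))"
    unfolding p m exp_Complex_mult by simp
  finally have d: "1 - \<i> * of_real (2 - sqrt 3) = exp (Complex (ln 2 / 2 + (ln 2 + ln a) / 2) (- (pi / 12)))" .
  have n: "1 - of_real (2 - sqrt 3) = exp (Complex ((ln 2 + ln a) / 2) 0)"
    unfolding exp_Complex_cis ea by simp
  have "(1 - of_real (2 - sqrt 3)) / (1 - \<i> * of_real (2 - sqrt 3)) = exp (Complex (- (ln 2 / 2)) (pi / 12))"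
    unfolding d n exp_Complex_diff by simp
  thus al: "(1 - of_real (2 - sqrt 3)) / (1 - \<i> * of_real (2 - sqrt 3)) = cis (pi / 12) / sqrt 2"
    unfolding E .
  have "cis (7 * pi / 12) = \<i> * cis (pi / 12)"
  proof -
    have "7 * pi / 12 = pi / 2 + pi / 12" by simp
    thus ?thesis by (simp only: cis_mult[symmetric] cis_pi_half)
  qed
  thus "\<i> * (1 - of_real (2 - sqrt 3)) / (1 - \<i> * of_real (2 - sqrt 3)) = cis (7 * pi / 12) / sqrt 2"
    using al by (simp add: times_divide_eq_right[symmetric] del: times_divide_eq_right of_real_diff)
qed

text \<open>The quantities foreign to the closed form disappear as follows: \<open>C\<close>
  cancels, \<open>A\<close> and \<open>B\<close> enter only through B - A, which the circle relation
  evaluates, \<open>g\<close> occurs there and in Im Li_2(i a) with opposite total weight, and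
  \<open>L\<close> is determined by two evaluations of one dilogarithm difference.\<close>

lemma ray_primitive_endpoint:
  "ray_primitive ((sqrt 3 - 1) / sqrt 2) = 32 / 3 * Im (polylog 3 ((1 + \<i>) / 2))
     - 4 * pi / 3 * polylog 2 (2 - sqrt 3) - pi ^ 3 / 9 - pi / 3 * (ln 2 + ln (2 - sqrt 3))\<^sup>2"
proof -
  define t where "t = (sqrt 3 - 1) / sqrt 2"
  define a where "a = 2 - sqrt 3"
  define x where "x = ln (2::real)"
  define y where "y = ln a"
  note ends = ray_endpoint[folded t_def a_def]
  have tt: "0 < t" "t < 1 / sqrt 2" by (fact ends)+
  have n: "norm (cis u / complex_of_real (sqrt 2)) \<le> 1" for u by (simp add: norm_divide)
  have nr: "norm (ray t) \<le> 1" "ray t \<noteq> 0" using ray_args_in_cball(1)[of t] norm_ray[of t] tt by auto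
  define A where "A = mod_trilog (cis (pi / 12) / sqrt 2)"
  define B where "B = mod_trilog (cis (7 * pi / 12) / sqrt 2)"
  define C where "C = mod_trilog (\<i> * of_real a)"
  define L where "L = Re (polylog 2 (\<i> * of_real a))"
  define g where "g = Im (polylog 2 ((1 + \<i>) / 2))"
  define G where "G = Im (polylog 3 ((1 + \<i>) / 2))"
  \<comment> \<open>As (1 - r)/(1 + r) is the conjugate of r, its two terms are -2 and +2 times
    those at r and -r. Together with weight 4 at r this is the left side of the duplication formula,
    and the resulting \<open>C / 2\<close> cancels the leading \<open>4 * C\<close>.\<close>
  have "ray_trilog t = 2 * (mod_trilog (ray t) + mod_trilog (- ray t)) - 4 * B + 4 * A"
    using mod_trilog_cnj[of "ray t"] mod_trilog_cnj[of "- ray t"] nr(1)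
    unfolding ray_trilog_def ends complex_cnj_minus[symmetric] mod_trilog_cnj[OF n] A_def B_def by simp
  hence H: "ray_trilog t = C / 2 - 4 * B + 4 * A"
    unfolding mod_trilog_duplication[OF nr] ends C_def by simp
  have E: "ray_elementary t = 2 * (((x + y) / 2)\<^sup>2 * (pi / 6)) - 4 * (y / 2 * ((x + y) / 2) * (pi / 6))
      + 2 * ((x / 2)\<^sup>2 * (pi / 12)) + 2 / 3 * (pi / 6) ^ 3 + 2 / 3 * (pi / 12) ^ 3 + pi / 4 * (pi / 6)\<^sup>2
      + pi / 2 * (pi / 12 * (pi / 6)) - pi / 4 * (pi / 12)\<^sup>2 - pi\<^sup>2 / 2 * (pi / 6) + pi\<^sup>2 / 6 * (pi / 12)
      + pi / 4 * ((x + y) / 2 - x / 2)\<^sup>2 - pi / 2 * (x / 2)\<^sup>2"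
    unfolding ray_elementary_def ends x_def y_def ..
  have g': "cis (pi / 4) / sqrt 2 = (1 + \<i>) / 2"
    by (simp add: complex_eq_iff cos_45 sin_45)
  have "norm ((1 + \<i>) / 2) = 1 / sqrt 2" unfolding g'[symmetric] by (simp add: norm_divide)
  hence "mod_trilog ((1 + \<i>) / 2) = G + x / 2 * g"
    by (simp add: mod_trilog_def G_def g_def x_def ln_div ln_sqrt)
  hence BA: "B - A = (G + x / 2 * g) / 3 + pi * x\<^sup>2 / 96 + pi ^ 3 / 128"
    using mod_trilog_relation_root2_circle unfolding g' A_def B_def x_def by simp
  have J: "Im (polylog 2 (\<i> * of_real a)) = 2 / 3 * (g + pi / 8 * x) + pi / 12 * y"
    using Im_dilog_tan_triple Im_dilog_half_1_plus_i unfolding a_def[symmetric] g_def x_def y_def by simp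
  have a: "0 < a" "a < 1" using real_sqrt_less_iff[of 3 4] real_sqrt_less_iff[of 1 3] by (auto simp: a_def)
  have U: "mod_dilog (1 / (1 + ray t)) - mod_dilog (- ray t / (1 - ray t)) = L - polylog 2 a + 3 * pi\<^sup>2 / 16"
    using mod_dilog_mixed[OF a] unfolding ends mod_dilog_cnj[OF n] L_def .
  \<comment> \<open>The second evaluation of the difference in \<open>U\<close>. It contains L/2
    where \<open>U\<close> contains L, so the two can be solved for \<open>L\<close>.\<close>
  have "mod_dilog (1 / (1 + ray t)) - mod_dilog (- ray t / (1 - ray t)) = (L + 2 * (y / 2) * (x / 2 + (x + y) / 2)) / 2
      - y / 2 * (x / 2) + (x / 2)\<^sup>2 / 2 - pi / 4 * (pi / 12) + (pi / 12)\<^sup>2 / 2 + pi\<^sup>2 / 6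
      - (((x + y) / 2)\<^sup>2 + (pi / 6)\<^sup>2) / 2"
  proof -
    have l: "mod_dilog (- ray t / (1 - ray t)) = ((lnm t)\<^sup>2 + (argm t)\<^sup>2) / 2 - mod_dilog (ray t)"
      using mod_dilog_landen[OF less_imp_le[OF tt(1)] tt(2)] by linarith
    have i: "mod_dilog (1 / (1 + ray t)) = mod_dilog (- ray t) + (- (ln t * lnp t) + (lnp t)\<^sup>2 / 2
        - pi / 4 * argp t + (argp t)\<^sup>2 / 2 + pi\<^sup>2 / 6)"
      using mod_dilog_inverse[of t] tt by simp
    have m: "mod_dilog (- ray t) = (Re (polylog 2 ((ray t)\<^sup>2)) + 2 * ln t * (lnp t + lnm t)) / 2 - mod_dilog (ray t)"
      using mod_dilog_ray_square(2)[OF tt] unfolding mod_dilog_ray_square(1)[OF tt, symmetric] by simp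
    show ?thesis
      unfolding l i m unfolding ends(4-9) L_def[symmetric] x_def[symmetric] y_def[symmetric] by simp
  qed
  hence "L = 2 * polylog 2 a - 3 * pi\<^sup>2 / 8 + 2 * (y / 2 * (x / 2 + (x + y) / 2)
      - y / 2 * (x / 2) + (x / 2)\<^sup>2 / 2 - pi / 4 * (pi / 12) + (pi / 12)\<^sup>2 / 2 + pi\<^sup>2 / 6
      - (((x + y) / 2)\<^sup>2 + (pi / 6)\<^sup>2) / 2)"
    using U by (simp add: field_simps)
  note L = this
  have "ray_primitive t = 4 * C - 8 * x * (2 / 3 * (g + pi / 8 * x) + pi / 12 * y)
      - 8 * (C / 2 - 4 * (B - A) - ray_elementary t) - 8 * (L * (pi / 6 - pi / 12))"
    unfolding ray_primitive_def H ends J L_def[symmetric] C_def[symmetric] x_def[symmetric] by simp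
  also have "\<dots> = 32 / 3 * G - 4 * pi / 3 * polylog 2 a - pi ^ 3 / 9 - pi / 3 * (x + y)\<^sup>2"
    unfolding BA E L by (simp add: field_simps power2_eq_square power3_eq_cube)
  finally show ?thesis unfolding t_def a_def[symmetric] G_def x_def y_def .
qed

section \<open>The arcsine series\<close>

text \<open>Linear growth is a bound shared by all coefficient sequences used below, including the
  arcsine coefficients times 2n+1 and the harmonic numbers.\<close>

lemma summable_linear_coeffs:
  fixes c :: "nat \<Rightarrow> 'a::{real_normed_field,banach}"
  assumes c: "\<And>n. norm (c n) \<le> C * real (Suc n)" and z: "norm z < 1"
  shows "summable (\<lambda>n. c n * z ^ n)"
proof (rule summable_comparison_test')
  have "summable (\<lambda>n. real (Suc n) * norm z ^ n)"
    using geometric_deriv_sums[of "norm z"] z by (simp add: sums_iff)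
  thus "summable (\<lambda>n. C * (real (Suc n) * norm z ^ n))" by (rule summable_mult)
  show "norm (c n * z ^ n) \<le> C * (real (Suc n) * norm z ^ n)" for n
    using mult_right_mono[OF c[of n], of "norm z ^ n"] by (simp add: norm_mult norm_power mult.assoc)
qed

lemma power_even_odd:
  fixes x :: "'a::comm_monoid_mult"
  shows power_even: "x ^ (2 * n) = (x\<^sup>2) ^ n" and power_odd: "x ^ (2 * n + 1) = x * (x\<^sup>2) ^ n"
  by (simp_all add: power_mult)

text \<open>The series is written as x g(x^2); the derivative g(x^2) + 2 x^2 g'(x^2) restores the
  factor 2n+1 coefficientwise.\<close>

lemma DERIV_odd_powser:
  fixes c :: "nat \<Rightarrow> 'a::{real_normed_field,banach}"
  assumes c: "\<And>n. norm (c n) \<le> C * real (Suc n)" and x: "norm x < 1"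
  shows "((\<lambda>x. \<Sum>n. c n / of_nat (2 * n + 1) * x ^ (2 * n + 1)) has_field_derivative (\<Sum>n. c n * x ^ (2 * n))) (at x)"
proof -
  define b where "b n = c n / of_nat (2 * n + 1)" for n
  define g where "g w = (\<Sum>n. b n * w ^ n)" for w
  have "C * real (Suc n) \<ge> 0" for n using norm_ge_zero c order_trans by blast
  hence bC: "norm (b n) \<le> C * real (Suc n)" for n
  proof -
    have "norm (b n) = norm (c n) / real (2 * n + 1)" unfolding b_def norm_divide norm_of_nat ..
    also have "\<dots> \<le> norm (c n) / 1" by (intro divide_left_mono) auto
    finally show ?thesis using c[of n] by simp
  qed
  have x2: "norm (x\<^sup>2) < 1" using x by (simp add: norm_power power_less_one_iff)
  have sb: "summable (\<lambda>n. b n * w ^ n)" if "norm w < 1" for w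
    by (rule summable_linear_coeffs[OF bC that])
  obtain K where K: "norm (x\<^sup>2) < K" "K < 1" using dense[OF x2] by blast
  hence nK: "norm (of_real K :: 'a) = K" using norm_ge_zero[of "x\<^sup>2"] by (simp del: norm_ge_zero)
  have g': "(g has_field_derivative (\<Sum>n. diffs b n * (x\<^sup>2) ^ n)) (at (x\<^sup>2))"
    unfolding g_def by (rule termdiffs_strong[of b "of_real K"]) (use K nK sb in simp_all)
  define D where "D = (\<Sum>n. diffs b n * (x\<^sup>2) ^ n)"
  have "summable (\<lambda>n. diffs b n * (x\<^sup>2) ^ n)"
    by (rule termdiff_converges[of "x\<^sup>2" 1]) (use x2 sb in auto)
  hence "(\<lambda>n. x\<^sup>2 * (diffs b n * (x\<^sup>2) ^ n)) sums (x\<^sup>2 * D)"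
    unfolding D_def by (intro sums_mult summable_sums)
  hence "(\<lambda>n. of_nat (Suc n) * b (Suc n) * (x\<^sup>2) ^ Suc n) sums (x\<^sup>2 * D)"
    by (simp add: diffs_def mult_ac)
  hence "(\<lambda>n. of_nat n * b n * (x\<^sup>2) ^ n) sums (x\<^sup>2 * D)"
    by (subst (asm) sums_Suc_iff) simp
  moreover have "(\<lambda>n. b n * (x\<^sup>2) ^ n) sums g (x\<^sup>2)"
    unfolding g_def by (intro summable_sums sb x2)
  ultimately have "(\<lambda>n. b n * (x\<^sup>2) ^ n + 2 * (of_nat n * b n * (x\<^sup>2) ^ n)) sums (g (x\<^sup>2) + 2 * (x\<^sup>2 * D))"
    by (intro sums_add sums_mult)
  moreover have "b n * (x\<^sup>2) ^ n + 2 * (of_nat n * b n * (x\<^sup>2) ^ n) = c n * x ^ (2 * n)" for n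
  proof -
    have "of_nat (2 * n + 1) \<noteq> (0 :: 'a)" by (simp only: of_nat_eq_0_iff)
    hence "c n = b n * of_nat (2 * n + 1)" by (simp add: b_def)
    thus ?thesis unfolding power_even by (simp add: algebra_simps)
  qed
  ultimately have "(\<lambda>n. c n * x ^ (2 * n)) sums (g (x\<^sup>2) + 2 * (x\<^sup>2 * D))" by simp
  hence "(\<Sum>n. c n * x ^ (2 * n)) = 1 * g (x\<^sup>2) + D * (2 * x) * x"
    by (simp add: sums_iff power2_eq_square mult_ac)
  moreover have "((\<lambda>x. x * g (x\<^sup>2)) has_field_derivative 1 * g (x\<^sup>2) + D * (2 * x) * x) (at x)"
  proof (rule DERIV_mult[OF DERIV_ident])
    have "((\<lambda>x. x\<^sup>2) has_field_derivative 2 * x) (at x)"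
      by (rule DERIV_cong[OF DERIV_power[where n = 2, OF DERIV_ident]]) simp
    from DERIV_chain2[OF g' this] show "((\<lambda>x. g (x\<^sup>2)) has_field_derivative D * (2 * x)) (at x)"
      unfolding D_def .
  qed
  ultimately have "((\<lambda>x. x * g (x\<^sup>2)) has_field_derivative (\<Sum>n. c n * x ^ (2 * n))) (at x)" by simp
  thus ?thesis
  proof (rule has_field_derivative_transform_within_open[where S = "ball 0 1"])
    fix w :: 'a assume "w \<in> ball 0 1"
    hence "norm (w\<^sup>2) < 1" by (simp add: norm_power power_less_one_iff)
    from suminf_mult[OF sb[OF this], of w]
    show "w * g (w\<^sup>2) = (\<Sum>n. c n / of_nat (2 * n + 1) * w ^ (2 * n + 1))"
      by (simp only: g_def b_def power_odd mult.left_commute)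
  qed (use x in auto)
qed

text \<open>The Taylor coefficients of arcsin x / sqrt (1 - x^2) at odd powers.\<close>

definition arcsin_coeff :: "nat \<Rightarrow> real" where
  "arcsin_coeff n = 4 ^ n / (real (2 * n + 1) * real ((2 * n) choose n))"

text \<open>This recursion encodes the differential equation (1 - x^2) f' = 1 + x f, and also shows
  that the coefficients decrease.\<close>

lemma arcsin_coeff_Suc: "real (2 * n + 3) * arcsin_coeff (Suc n) = real (2 * n + 2) * arcsin_coeff n"
proof -
  define B where "B = ((2 * n) choose n)"
  define B' where "B' = ((2 * Suc n) choose Suc n)"
  have B': "fact (Suc n) * fact (Suc n) * B' = (fact (2 * Suc n) :: nat)"
  proof -
    have k: "Suc n \<le> 2 * Suc n" and d: "2 * Suc n - Suc n = Suc n" by (simp_all only: mult_2 le_add1 diff_add_inverse)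
    show ?thesis using binomial_fact_lemma[OF k] unfolding B'_def d .
  qed
  have B: "(fact (2 * n) :: nat) = fact n * fact n * B"
  proof -
    have "n \<le> 2 * n" "2 * n - n = n" by simp_all
    thus ?thesis using binomial_fact_lemma[of n "2 * n"] unfolding B_def by simp
  qed
  have "fact n * fact n * (Suc n * Suc n * B') = fact (Suc n) * fact (Suc n) * B'"
    by (simp only: fact_Suc of_nat_id mult_ac)
  also have "\<dots> = (2 * n + 2) * (2 * n + 1) * fact (2 * n)" unfolding B' by (simp add: algebra_simps)
  also have "\<dots> = fact n * fact n * ((2 * n + 2) * (2 * n + 1) * B)" unfolding B by (simp only: mult_ac)
  finally have "Suc n * Suc n * B' = (2 * n + 2) * (2 * n + 1) * B"
    by (subst (asm) mult_left_cancel) simp_all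
  hence "Suc n * (Suc n * B') = Suc n * (2 * (2 * n + 1) * B)" by (simp add: algebra_simps)
  hence "Suc n * B' = 2 * (2 * n + 1) * B" by (subst (asm) mult_left_cancel) simp_all
  hence "real (Suc n * B') = real (2 * (2 * n + 1) * B)" by (rule arg_cong)
  hence e: "real (Suc n) * real B' = 2 * real (2 * n + 1) * real B"
    by (simp only: of_nat_mult of_nat_numeral)
  have "0 < B" "0 < B'" unfolding B_def B'_def by (simp_all only: zero_less_binomial_iff mult_2 le_add1)
  hence "0 < real B" by simp
  have "2 * Suc n + 1 = 2 * n + 3" by simp
  hence "real (2 * n + 3) * arcsin_coeff (Suc n) = 4 * 4 ^ n / real B'"
    unfolding arcsin_coeff_def B'_def[symmetric] by (simp add: divide_simps)
  also have "real B' = 2 * real (2 * n + 1) * real B / real (Suc n)"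
    using e by (simp add: field_simps)
  also have "4 * 4 ^ n / \<dots> = real (2 * n + 2) * arcsin_coeff n"
  proof -
    have "4 * P / (2 * m * b / s) = 2 * s * (P / (m * b))" if "0 < b" "0 < m" "0 < s" for P b m s :: real
      using that by (simp add: field_simps)
    moreover have "real (2 * n + 2) = 2 * real (Suc n)" by simp
    moreover have "0 < real (2 * n + 1)" "0 < real (Suc n)" by simp_all
    ultimately show ?thesis
      unfolding arcsin_coeff_def B_def[symmetric] using \<open>0 < real B\<close> by (simp only:)
  qed
  finally show ?thesis .
qed

lemma arcsin_coeff_bounds: "0 < arcsin_coeff n" "arcsin_coeff n \<le> 1"
proof -
  show pos: "0 < arcsin_coeff n" for n by (simp add: arcsin_coeff_def zero_less_binomial_iff)
  show "arcsin_coeff n \<le> 1"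
  proof (induction n)
    case (Suc n)
    have "real (2 * n + 3) * arcsin_coeff (Suc n) \<le> real (2 * n + 3) * arcsin_coeff n"
      unfolding arcsin_coeff_Suc using pos[of n] by (intro mult_right_mono) auto
    thus ?case using Suc by (simp only: mult_le_cancel_left_pos of_nat_0_less_iff)
  qed (simp add: arcsin_coeff_def)
qed

lemma norm_arcsin_coeff: "norm (arcsin_coeff n) \<le> 1 * real (Suc n)"
  using arcsin_coeff_bounds[of n] by simp

text \<open>By the differential equation for the series f, the function f(sin t) cos t - t has
  derivative 0, and it vanishes at t = 0.\<close>

lemma arcsin_series:
  assumes "0 \<le> \<theta>" "\<theta> < pi / 2"
  shows "(\<Sum>n. arcsin_coeff n * sin \<theta> ^ (2 * n + 1)) * cos \<theta> = \<theta>"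
proof -
  define f where "f x = (\<Sum>n. arcsin_coeff n * x ^ (2 * n + 1))" for x
  define d where "d n = real (2 * n + 1) * arcsin_coeff n" for n
  define D where "D x = (\<Sum>n. d n * x ^ (2 * n))" for x
  have db: "norm (d n) \<le> 2 * real (Suc n)" for n
    using mult_mono[of "real (2 * n + 1)" "2 * real (Suc n)" "arcsin_coeff n" 1] arcsin_coeff_bounds[of n]
    by (simp add: d_def)
  have f': "(f has_real_derivative D x) (at x)" if "\<bar>x\<bar> < 1" for x
  proof -
    have "d n / of_nat (2 * n + 1) = arcsin_coeff n" for n unfolding d_def by (simp add: divide_simps)
    thus ?thesis using DERIV_odd_powser[OF db, of x] that unfolding f_def[abs_def] D_def by simp
  qed
  have ode: "D x = 1 + x\<^sup>2 * D x + x * f x" if "\<bar>x\<bar> < 1" for x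
  proof -
    have x2: "norm (x\<^sup>2) < 1" using that by (simp add: abs_square_less_1)
    have D: "(\<lambda>n. d n * (x\<^sup>2) ^ n) sums D x"
      unfolding D_def power_mult by (intro summable_sums summable_linear_coeffs[OF db x2])
    have "(\<lambda>n. arcsin_coeff n * (x\<^sup>2) ^ n) sums (\<Sum>n. arcsin_coeff n * (x\<^sup>2) ^ n)"
      by (intro summable_sums summable_linear_coeffs[OF norm_arcsin_coeff x2])
    from sums_mult[OF this, of x] have "(\<lambda>n. x * (arcsin_coeff n * (x\<^sup>2) ^ n)) sums (x * (\<Sum>n. arcsin_coeff n * (x\<^sup>2) ^ n))" .
    moreover have "x * (arcsin_coeff n * (x\<^sup>2) ^ n) = arcsin_coeff n * x ^ (2 * n + 1)" for n
      by (simp add: power_mult[of x 2 n])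
    ultimately have "(\<lambda>n. arcsin_coeff n * x ^ (2 * n + 1)) sums (x * (\<Sum>n. arcsin_coeff n * (x\<^sup>2) ^ n))" by simp
    hence "(\<lambda>n. arcsin_coeff n * x ^ (2 * n + 1)) sums f x"
      unfolding f_def by (simp add: sums_iff)
    hence "(\<lambda>n. x * (arcsin_coeff n * x ^ (2 * n + 1)) + x\<^sup>2 * (d n * (x\<^sup>2) ^ n)) sums (x * f x + x\<^sup>2 * D x)"
      by (intro sums_add sums_mult D)
    moreover have "x * (arcsin_coeff n * x ^ (2 * n + 1)) + x\<^sup>2 * (d n * (x\<^sup>2) ^ n) = d (Suc n) * (x\<^sup>2) ^ Suc n" for n
    proof -
      have "d (Suc n) = real (2 * n + 2) * arcsin_coeff n"
        using arcsin_coeff_Suc[of n] by (simp add: d_def numeral_3_eq_3)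
      thus ?thesis by (simp add: d_def power_mult[of x 2 n]) (simp add: power2_eq_square algebra_simps)
    qed
    ultimately have "(\<lambda>n. d (Suc n) * (x\<^sup>2) ^ Suc n) sums (x * f x + x\<^sup>2 * D x)" by simp
    hence "(\<lambda>n. d n * (x\<^sup>2) ^ n) sums (x * f x + x\<^sup>2 * D x + d 0)"
      by (subst (asm) sums_Suc_iff) simp
    with D have "D x = x * f x + x\<^sup>2 * D x + d 0" by (rule sums_unique2)
    thus ?thesis by (simp add: d_def arcsin_coeff_def)
  qed
  define h where "h t = f (sin t) * cos t - t" for t
  have h': "(h has_real_derivative 0) (at t)" if "0 \<le> t" "t < pi / 2" for t
  proof -
    have s: "\<bar>sin t\<bar> < 1"
    proof -
      have "0 < cos t" using that pi_gt_zero by (intro cos_gt_zero_pi) linarith+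
      hence "0 < (cos t)\<^sup>2" by simp
      hence "(sin t)\<^sup>2 < 1" using sin_squared_eq[of t] by linarith
      thus ?thesis by (simp add: abs_square_less_1)
    qed
    have "(h has_real_derivative D (sin t) * cos t * cos t + - sin t * f (sin t) - 1) (at t)"
      unfolding h_def[abs_def]
      by (intro DERIV_diff DERIV_mult DERIV_chain2[where f = f and g = sin, OF f'[OF s] DERIV_sin] DERIV_cos DERIV_ident)
    moreover have "D (sin t) * cos t * cos t + - sin t * f (sin t) - 1 = 0"
    proof -
      have "D (sin t) * cos t * cos t = D (sin t) * (1 - (sin t)\<^sup>2)"
        unfolding cos_squared_eq[symmetric] by (simp add: power2_eq_square)
      thus ?thesis using ode[OF s] by (simp add: algebra_simps)
    qed
    ultimately show ?thesis by simp
  qed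
  have "h \<theta> = h 0"
  proof (cases "\<theta> = 0")
    case False
    have "continuous_on {0..\<theta>} h"
      using assms by (intro continuous_at_imp_continuous_on ballI DERIV_isCont[OF h']) auto
    thus ?thesis using assms False by (intro DERIV_isconst2[of 0 \<theta> h] h') auto
  qed simp
  thus ?thesis by (simp add: h_def f_def)
qed

text \<open>The first of two successive primitives, with respect to dx/x, of 2 arcsin x / sqrt (1 -
  x^2). The factor 2 is a normalization: at x = 1/2 it cancels with 4^n (1/2)^(2n+1), so that the
  second primitive becomes the given series.\<close>

definition arcsin_primitive :: "real \<Rightarrow> real" where
  "arcsin_primitive x = (\<Sum>n. 2 * arcsin_coeff n / real (2 * n + 1) * x ^ (2 * n + 1))"

definition arcsin_primitive2 :: "real \<Rightarrow> real" where
  "arcsin_primitive2 x = (\<Sum>n. 2 * arcsin_coeff n / real (2 * n + 1) / real (2 * n + 1) * x ^ (2 * n + 1))"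

lemma DERIV_arcsin_primitive:
  assumes "0 < \<theta>" "\<theta> < pi / 2"
  shows "(arcsin_primitive has_real_derivative 2 * \<theta> / (sin \<theta> * cos \<theta>)) (at (sin \<theta>))"
    and "(arcsin_primitive2 has_real_derivative arcsin_primitive (sin \<theta>) / sin \<theta>) (at (sin \<theta>))"
proof -
  have c: "0 < cos \<theta>" and s0: "0 < sin \<theta>"
    using assms by (auto intro!: cos_gt_zero_pi sin_gt_zero)
  have "0 < (cos \<theta>)\<^sup>2" using c by simp
  hence "(sin \<theta>)\<^sup>2 < 1" using sin_squared_eq[of \<theta>] by linarith
  hence s: "norm (sin \<theta>) < 1" by (simp add: abs_square_less_1)
  hence s2: "norm ((sin \<theta>)\<^sup>2) < 1" by (simp add: abs_square_less_1)
  have b1: "norm (2 * arcsin_coeff n) \<le> 2 * real (Suc n)" for n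
    using arcsin_coeff_bounds[of n] by simp
  have b2: "norm (2 * arcsin_coeff n / real (2 * n + 1)) \<le> 2 * real (Suc n)" for n
  proof -
    have "2 * arcsin_coeff n / real (2 * n + 1) \<le> 2 * arcsin_coeff n / 1"
      using arcsin_coeff_bounds[of n] by (intro divide_left_mono) auto
    thus ?thesis using b1[of n] arcsin_coeff_bounds[of n] by simp
  qed
  have shift: "(\<Sum>n. a n * sin \<theta> ^ (2 * n)) = (\<Sum>n. a n * sin \<theta> ^ (2 * n + 1)) / sin \<theta>"
    if "\<And>n. norm (a n) \<le> 2 * real (Suc n)" for a
  proof -
    have "(\<Sum>n. a n * sin \<theta> ^ (2 * n + 1)) = (\<Sum>n. sin \<theta> * (a n * ((sin \<theta>)\<^sup>2) ^ n))"
      by (simp only: power_odd mult.left_commute)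
    also have "\<dots> = sin \<theta> * (\<Sum>n. a n * ((sin \<theta>)\<^sup>2) ^ n)"
      by (rule suminf_mult[OF summable_linear_coeffs[OF that s2]])
    finally show ?thesis unfolding power_even using s0 by simp
  qed
  have "(\<Sum>n. 2 * arcsin_coeff n * sin \<theta> ^ (2 * n)) = (\<Sum>n. 2 * arcsin_coeff n * sin \<theta> ^ (2 * n + 1)) / sin \<theta>"
    by (rule shift[OF b1])
  also have "(\<Sum>n. 2 * arcsin_coeff n * sin \<theta> ^ (2 * n + 1)) = 2 * (\<Sum>n. arcsin_coeff n * sin \<theta> ^ (2 * n + 1))"
  proof -
    have "summable (\<lambda>n. sin \<theta> * (arcsin_coeff n * ((sin \<theta>)\<^sup>2) ^ n))"
      by (intro summable_mult summable_linear_coeffs[OF norm_arcsin_coeff s2])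
    hence "summable (\<lambda>n. arcsin_coeff n * sin \<theta> ^ (2 * n + 1))"
      by (simp only: power_odd mult.left_commute)
    from suminf_mult[OF this, of 2] show ?thesis by (simp only: mult.assoc)
  qed
  also have "(\<Sum>n. arcsin_coeff n * sin \<theta> ^ (2 * n + 1)) = \<theta> / cos \<theta>"
    using arcsin_series[of \<theta>] assms c by (simp add: field_simps)
  finally have "(\<Sum>n. 2 * arcsin_coeff n * sin \<theta> ^ (2 * n)) = 2 * \<theta> / (sin \<theta> * cos \<theta>)" by simp
  with DERIV_odd_powser[OF b1 s]
  show "(arcsin_primitive has_real_derivative 2 * \<theta> / (sin \<theta> * cos \<theta>)) (at (sin \<theta>))"
    unfolding arcsin_primitive_def[abs_def] by simp
  have "(\<Sum>n. 2 * arcsin_coeff n / real (2 * n + 1) * sin \<theta> ^ (2 * n)) = arcsin_primitive (sin \<theta>) / sin \<theta>"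
    unfolding arcsin_primitive_def by (rule shift[OF b2])
  with DERIV_odd_powser[OF b2 s]
  show "(arcsin_primitive2 has_real_derivative arcsin_primitive (sin \<theta>) / sin \<theta>) (at (sin \<theta>))"
    unfolding arcsin_primitive2_def[abs_def] by simp
qed

text \<open>Integration by parts removes the inner primitive: differentiating the second primitive
  produces the first one times cot \<theta>, and the derivative of the logarithm cancels precisely
  this. The 2 inside the logarithm makes the correction vanish at \<theta> = pi/6, where the value
  is the given series.\<close>

definition sin_sum :: "real \<Rightarrow> real" where
  "sin_sum \<theta> = arcsin_primitive2 (sin \<theta>) - ln (2 * sin \<theta>) * arcsin_primitive (sin \<theta>)"

lemma DERIV_sin_sum:
  assumes "0 < \<theta>" "\<theta> < pi / 2"
  shows "(sin_sum has_real_derivative - 2 * \<theta> * ln (2 * sin \<theta>) / sin \<theta>) (at \<theta>)"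
proof -
  have c: "0 < cos \<theta>" and s: "0 < sin \<theta>"
    using assms by (auto intro!: cos_gt_zero_pi sin_gt_zero)
  note d = DERIV_arcsin_primitive[OF assms]
  have d1: "((\<lambda>x. arcsin_primitive (sin x)) has_real_derivative 2 * \<theta> / (sin \<theta> * cos \<theta>) * cos \<theta>) (at \<theta>)"
    by (rule DERIV_chain2[where f = arcsin_primitive and g = sin, OF d(1) DERIV_sin])
  have d2: "((\<lambda>x. arcsin_primitive2 (sin x)) has_real_derivative arcsin_primitive (sin \<theta>) / sin \<theta> * cos \<theta>) (at \<theta>)"
    by (rule DERIV_chain2[where f = arcsin_primitive2 and g = sin, OF d(2) DERIV_sin])
  have "0 < 2 * sin \<theta>" using s by simp
  have d3: "((\<lambda>x. ln (2 * sin x)) has_real_derivative 1 / (2 * sin \<theta>) * (2 * cos \<theta>)) (at \<theta>)"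
    by (rule DERIV_chain2[where f = ln and g = "\<lambda>x. 2 * sin x", OF DERIV_ln_divide[OF \<open>0 < 2 * sin \<theta>\<close>] DERIV_cmult[OF DERIV_sin]])
  show ?thesis
    unfolding sin_sum_def[abs_def]
    by (rule DERIV_cong[OF DERIV_diff[OF d2 DERIV_mult[OF d3 d1]]]) (use c s in \<open>simp add: field_simps\<close>)
qed

lemma continuous_on_mult_ln: "continuous_on {0..} (\<lambda>x::real. x * ln x)"
proof -
  have "isCont (\<lambda>z::complex. norm z * ln (norm z)) z" for z
    using isCont_norm_mult_ln by (cases "z = 0") (auto intro!: continuous_intros)
  hence "continuous_on UNIV (\<lambda>z::complex. norm z * ln (norm z))"
    by (simp add: continuous_at_imp_continuous_on)
  hence "continuous_on {0..} (\<lambda>x. norm (complex_of_real x) * ln (norm (complex_of_real x)))"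
    by (rule continuous_on_compose2) (auto intro!: continuous_intros)
  thus ?thesis by (rule continuous_on_cong[THEN iffD1, rotated -1]) auto
qed

text \<open>Only \<theta> = 0 is delicate, because of ln (2 sin \<theta>). The first primitive has
  the form x e(x^2), so the logarithm can be grouped with a factor 2 sin \<theta>, and x ln x is
  continuous at 0.\<close>

lemma continuous_on_sin_sum:
  assumes "r < pi / 2"
  shows "continuous_on {0..r} sin_sum"
proof -
  define e where "e w = (\<Sum>n. 2 * arcsin_coeff n / real (2 * n + 1) * w ^ n)" for w :: real
  define e2 where "e2 w = (\<Sum>n. 2 * arcsin_coeff n / real (2 * n + 1) / real (2 * n + 1) * w ^ n)" for w :: real
  have b: "norm (2 * arcsin_coeff n / real (2 * n + 1)) \<le> 2 * real (Suc n)"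
    "norm (2 * arcsin_coeff n / real (2 * n + 1) / real (2 * n + 1)) \<le> 2 * real (Suc n)" for n
  proof -
    have "2 * arcsin_coeff n / real (2 * n + 1) \<le> 2 * arcsin_coeff n / 1"
      using arcsin_coeff_bounds[of n] by (intro divide_left_mono) auto
    thus 1: "norm (2 * arcsin_coeff n / real (2 * n + 1)) \<le> 2 * real (Suc n)"
      using arcsin_coeff_bounds[of n] by simp
    have "2 * arcsin_coeff n / real (2 * n + 1) / real (2 * n + 1) \<le> 2 * arcsin_coeff n / real (2 * n + 1) / 1"
      using arcsin_coeff_bounds[of n] by (intro divide_left_mono) auto
    thus "norm (2 * arcsin_coeff n / real (2 * n + 1) / real (2 * n + 1)) \<le> 2 * real (Suc n)"
      using 1 arcsin_coeff_bounds[of n] by simp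
  qed
  have isC: "isCont (\<lambda>w. \<Sum>n. a n * w ^ n) w" if a: "\<And>n. norm (a n) \<le> 2 * real (Suc n)" and w: "\<bar>w\<bar> < 1"
    for a :: "nat \<Rightarrow> real" and w
  proof -
    obtain K where K: "\<bar>w\<bar> < K" "K < 1" using dense[OF w] by blast
    hence "summable (\<lambda>n. a n * K ^ n)" by (intro summable_linear_coeffs[OF a]) auto
    thus ?thesis by (rule DERIV_isCont[OF termdiffs_strong]) (use K in auto)
  qed
  have eq: "arcsin_primitive x = x * e (x\<^sup>2)" "arcsin_primitive2 x = x * e2 (x\<^sup>2)" if "\<bar>x\<bar> < 1" for x
  proof -
    have x2: "norm (x\<^sup>2) < 1" using that by (simp add: abs_square_less_1)
    have "x * e (x\<^sup>2) = (\<Sum>n. x * (2 * arcsin_coeff n / real (2 * n + 1) * (x\<^sup>2) ^ n))"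
      unfolding e_def by (rule suminf_mult[symmetric, OF summable_linear_coeffs[OF b(1) x2]])
    thus "arcsin_primitive x = x * e (x\<^sup>2)" by (simp only: arcsin_primitive_def power_odd mult.left_commute)
    have "x * e2 (x\<^sup>2) = (\<Sum>n. x * (2 * arcsin_coeff n / real (2 * n + 1) / real (2 * n + 1) * (x\<^sup>2) ^ n))"
      unfolding e2_def by (rule suminf_mult[symmetric, OF summable_linear_coeffs[OF b(2) x2]])
    thus "arcsin_primitive2 x = x * e2 (x\<^sup>2)" by (simp only: arcsin_primitive2_def power_odd mult.left_commute)
  qed
  have s: "0 \<le> sin \<theta>" "\<bar>sin \<theta>\<bar> < 1" if "\<theta> \<in> {0..r}" for \<theta>
  proof -
    show "0 \<le> sin \<theta>" using that assms by (intro sin_ge_zero) auto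
    have "0 < cos \<theta>" using that assms by (intro cos_gt_zero_pi) auto
    hence "0 < (cos \<theta>)\<^sup>2" by simp
    hence "(sin \<theta>)\<^sup>2 < 1" using sin_squared_eq[of \<theta>] by linarith
    thus "\<bar>sin \<theta>\<bar> < 1" by (simp add: abs_square_less_1)
  qed
  have ce: "continuous_on {0..r} (\<lambda>\<theta>. e ((sin \<theta>)\<^sup>2))" "continuous_on {0..r} (\<lambda>\<theta>. e2 ((sin \<theta>)\<^sup>2))"
  proof -
    have "isCont e w" "isCont e2 w" if "\<bar>w\<bar> < 1" for w
      unfolding e_def[abs_def] e2_def[abs_def] using isC[OF b(1) that] isC[OF b(2) that] .
    hence "continuous_on {-1<..<1} e" "continuous_on {-1<..<1} e2"
      by (auto intro!: continuous_at_imp_continuous_on)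
    moreover have "(\<lambda>\<theta>. (sin \<theta>)\<^sup>2) ` {0..r} \<subseteq> {-1<..<1}"
    proof (rule image_subsetI)
      fix \<theta> assume "\<theta> \<in> {0..r}"
      hence "(sin \<theta>)\<^sup>2 < 1" using s(2) by (simp add: abs_square_less_1)
      moreover have "0 \<le> (sin \<theta>)\<^sup>2" by simp
      ultimately show "(sin \<theta>)\<^sup>2 \<in> {-1<..<1}" unfolding greaterThanLessThan_iff by linarith
    qed
    moreover have "continuous_on {0..r} (\<lambda>\<theta>. (sin \<theta>)\<^sup>2)" by (intro continuous_intros)
    ultimately show "continuous_on {0..r} (\<lambda>\<theta>. e ((sin \<theta>)\<^sup>2))" "continuous_on {0..r} (\<lambda>\<theta>. e2 ((sin \<theta>)\<^sup>2))"
      using continuous_on_compose2 by blast+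
  qed
  have cl: "continuous_on {0..r} (\<lambda>\<theta>. (2 * sin \<theta>) * ln (2 * sin \<theta>))"
    by (rule continuous_on_compose2[OF continuous_on_mult_ln]) (use s in \<open>auto intro!: continuous_intros\<close>)
  have "continuous_on {0..r} (\<lambda>\<theta>. sin \<theta> * e2 ((sin \<theta>)\<^sup>2) - (2 * sin \<theta>) * ln (2 * sin \<theta>) * e ((sin \<theta>)\<^sup>2) / 2)"
    by (intro continuous_on_diff continuous_on_mult[OF cl ce(1)] continuous_on_divide continuous_on_const
        continuous_on_mult[OF _ ce(2)] continuous_on_sin continuous_on_id) auto
  thus ?thesis
    by (rule continuous_on_cong[THEN iffD1, rotated -1]) (use s(2) eq in \<open>auto simp: sin_sum_def\<close>)
qed

lemma sin_sum_pi_sixth: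
  "(\<lambda>n. 1 / ((2 * real n + 1) ^ 3 * real ((2 * n) choose n))) sums sin_sum (pi / 6)"
proof -
  have s: "sin (pi / 6) = 1 / 2" by (rule sin_30)
  have p: "(1 / 2 :: real) ^ (2 * n + 1) = 1 / 2 * (1 / 4) ^ n" for n
    unfolding power_odd by (simp add: power2_eq_square)
  have b: "norm (2 * arcsin_coeff n / real (2 * n + 1) / real (2 * n + 1)) \<le> 2 * real (Suc n)" for n
  proof -
    have "2 * arcsin_coeff n / real (2 * n + 1) / real (2 * n + 1) \<le> 2 * arcsin_coeff n / real (2 * n + 1) / 1"
      using arcsin_coeff_bounds[of n] by (intro divide_left_mono) auto
    also have "\<dots> \<le> 2 * arcsin_coeff n / 1"
      using arcsin_coeff_bounds[of n] unfolding div_by_1 by (subst div_by_1[symmetric]) (intro divide_left_mono; simp)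
    finally show ?thesis using arcsin_coeff_bounds[of n] by simp
  qed
  have "summable (\<lambda>n. 1 / 2 * (2 * arcsin_coeff n / real (2 * n + 1) / real (2 * n + 1) * (1 / 4) ^ n))"
    by (intro summable_mult summable_linear_coeffs[OF b]) simp
  moreover have "1 / 2 * (2 * arcsin_coeff n / real (2 * n + 1) / real (2 * n + 1) * (1 / 4) ^ n)
      = 2 * arcsin_coeff n / real (2 * n + 1) / real (2 * n + 1) * (1 / 2) ^ (2 * n + 1)" for n
    unfolding p by simp
  ultimately have "summable (\<lambda>n. 2 * arcsin_coeff n / real (2 * n + 1) / real (2 * n + 1) * (1 / 2) ^ (2 * n + 1))"
    by (simp only:)
  hence "(\<lambda>n. 2 * arcsin_coeff n / real (2 * n + 1) / real (2 * n + 1) * (1 / 2) ^ (2 * n + 1)) sums arcsin_primitive2 (1 / 2)"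
    unfolding arcsin_primitive2_def by (rule summable_sums)
  moreover have "2 * arcsin_coeff n / real (2 * n + 1) / real (2 * n + 1) * (1 / 2) ^ (2 * n + 1)
      = 1 / ((2 * real n + 1) ^ 3 * real ((2 * n) choose n))" for n
    unfolding p arcsin_coeff_def by (simp add: power3_eq_cube power_one_over add_ac mult_ac)
  ultimately show ?thesis by (simp add: sin_sum_def s)
qed

text \<open>For \<theta> = 2 arctan (t^2) one has d\<theta> / sin \<theta> = 2 dt / t. Moreover
  \<theta>/2 is \<open>argm - argp\<close>, and ln (2 sin \<theta>) is twice ln 2 + ln t - (lnp +
  lnm). Hence both sides have the same derivative in t, and both vanish at 0.\<close>

lemma sin_sum_eq_ray_primitive:
  assumes t: "0 \<le> t" "t < 1 / sqrt 2"
  shows "sin_sum (2 * arctan (t\<^sup>2)) = ray_primitive t"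
proof -
  define Z where "Z = (\<lambda>t. sin_sum (2 * arctan (t\<^sup>2)) - ray_primitive t)"
  have sq: "0 \<le> u\<^sup>2 \<and> u\<^sup>2 \<le> t\<^sup>2 \<and> t\<^sup>2 < 1 / 2" if "0 \<le> u" "u \<le> t" for u
  proof -
    have "t\<^sup>2 < (1 / sqrt 2)\<^sup>2" using t by (intro power_strict_mono) auto
    thus ?thesis using that by (auto intro!: power_mono simp: power_divide)
  qed
  have arc: "0 \<le> 2 * arctan (u\<^sup>2)" "2 * arctan (u\<^sup>2) \<le> 2 * arctan (t\<^sup>2)" "2 * arctan (t\<^sup>2) < pi / 2"
    if "0 \<le> u" "u \<le> t" for u
  proof -
    show "0 \<le> 2 * arctan (u\<^sup>2)" "2 * arctan (u\<^sup>2) \<le> 2 * arctan (t\<^sup>2)"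
      using sq[OF that] by (simp_all add: arctan_le_iff)
    have "arctan (t\<^sup>2) < arctan 1" using sq[OF that] unfolding arctan_less_iff by linarith
    thus "2 * arctan (t\<^sup>2) < pi / 2" by (simp add: arctan_one)
  qed
  have "continuous_on {0..t} (\<lambda>t. sin_sum (2 * arctan (t\<^sup>2)))"
    by (rule continuous_on_compose2[OF continuous_on_sin_sum[OF arc(3)[OF t(1) order.refl]]])
       (use arc in \<open>auto intro!: continuous_intros\<close>)
  hence "continuous_on {0..t} Z"
    unfolding Z_def by (intro continuous_on_diff continuous_on_ray_primitive[OF t(2)])
  moreover have "(Z has_real_derivative 0) (at u)" if u: "0 < u" "u < t" for u
  proof -
    have u2: "0 < u\<^sup>2" and w: "0 < 1 + (u\<^sup>2)\<^sup>2" using u by (auto intro: add_pos_nonneg)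
    have uT: "u \<in> {0<..<1 / sqrt 2}" using u t by auto
    define \<phi> where "\<phi> = arctan (u\<^sup>2)"
    have \<phi>: "0 < 2 * \<phi>" "2 * \<phi> < pi / 2" using arc[of u] u u2 by (auto simp: \<phi>_def)
    have c4: "(cis (pi / 4))\<^sup>2 = \<i>" unfolding power2_eq_square cis_mult by simp
    have E: "exp (Complex (lnp u + lnm u) (argp u - argm u)) = exp (Complex (ln (1 + (u\<^sup>2)\<^sup>2) / 2) (- \<phi>))"
    proof -
      have "1 - (ray u)\<^sup>2 = exp (Complex (lnp u + lnm u) (argp u - argm u))"
        using path_ray_square uT unfolding polar_path_def by blast
      moreover have "(ray u)\<^sup>2 = \<i> * of_real (u\<^sup>2)"
        unfolding ray_def power_mult_distrib of_real_power c4 by (rule mult.commute)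
      ultimately show ?thesis unfolding \<phi>_def cis_minus_arctan by simp
    qed
    have b: "\<bar>argp u\<bar> < pi / 2" "\<bar>argm u\<bar> < pi / 2" using argp_bound[of u] argm_bound[of u] uT by auto
    have Ln_C: "Ln (exp (Complex r v)) = Complex r v" if "- pi < v" "v < pi" for r v
      by (rule Ln_exp) (use that in simp_all)
    \<comment> \<open>Both exponents have imaginary part in the principal range, so equal
      exponentials force equal exponents.\<close>
    have "- pi < argp u - argm u" "argp u - argm u < pi" "- pi < - \<phi>" "- \<phi> < pi"
      using b \<phi> by linarith+
    hence "Complex (lnp u + lnm u) (argp u - argm u) = Complex (ln (1 + (u\<^sup>2)\<^sup>2) / 2) (- \<phi>)"
      using arg_cong[OF E, of Ln] by (simp only: Ln_C)
    hence lm: "argm u - argp u = \<phi>" "lnp u + lnm u = ln (1 + (u\<^sup>2)\<^sup>2) / 2" by simp_all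
    have sn: "sin (2 * \<phi>) = 2 * u\<^sup>2 / (1 + (u\<^sup>2)\<^sup>2)"
      unfolding sin_double \<phi>_def sin_arctan cos_arctan using w by (simp flip: real_sqrt_mult add: power2_eq_square[symmetric])
    have "ln (2 * sin (2 * \<phi>)) = ln (4 * u\<^sup>2) - ln (1 + (u\<^sup>2)\<^sup>2)"
      unfolding sn using u2 w by (simp add: ln_div)
    also have "ln (4 * u\<^sup>2) = 2 * ln 2 + 2 * ln u"
      using u ln_realpow[of 2 2] by (simp add: ln_mult ln_realpow)
    finally have ls: "ln (2 * sin (2 * \<phi>)) = 2 * (ln 2 + ln u - (lnp u + lnm u))" unfolding lm by simp
    have d: "((\<lambda>t. 2 * arctan (t\<^sup>2)) has_real_derivative 2 * (inverse (1 + (u\<^sup>2)\<^sup>2) * (2 * u))) (at u)"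
    proof -
      have "((\<lambda>t. t\<^sup>2) has_real_derivative 2 * u) (at u)"
        by (rule DERIV_cong[OF DERIV_power[where n = 2, OF DERIV_ident]]) simp
      thus ?thesis by (intro DERIV_cmult DERIV_chain2[where f = arctan, OF DERIV_arctan])
    qed
    have s: "(sin_sum has_real_derivative - 2 * (2 * \<phi>) * ln (2 * sin (2 * \<phi>)) / sin (2 * \<phi>)) (at (2 * arctan (u\<^sup>2)))"
      using DERIV_sin_sum[OF \<phi>] by (simp add: \<phi>_def)
    have r: "(ray_primitive has_real_derivative - 16 * \<phi> * (ln 2 + ln u - (lnp u + lnm u)) / u) (at u)"
      using DERIV_ray_primitive[of u] uT by (simp add: lm(1))
    have gen: "- 2 * (2 * \<phi>) * (2 * X) / (2 * u\<^sup>2 / W) * (2 * (inverse W * (2 * u))) - - 16 * \<phi> * X / u = 0"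
      if "0 < W" for W X :: real
      using u that by (simp add: field_simps power2_eq_square)
    have "- 2 * (2 * \<phi>) * (2 * X) / sin (2 * \<phi>) * (2 * (inverse (1 + (u\<^sup>2)\<^sup>2) * (2 * u))) - - 16 * \<phi> * X / u = 0" for X
      unfolding sn by (rule gen[OF w])
    thus ?thesis
      unfolding Z_def
      by (intro DERIV_cong[OF DERIV_diff[OF DERIV_chain2[where f = sin_sum and g = "\<lambda>t. 2 * arctan (t\<^sup>2)", OF s d] r]]) (simp only: ls)
  qed
  ultimately have "Z t = Z 0" using t by (cases "t = 0") (auto intro!: DERIV_isconst2[of 0 t Z])
  thus ?thesis by (simp add: Z_def sin_sum_def arcsin_primitive2_def arcsin_primitive_def)
qed

lemma series_closed_form:
  "(\<lambda>n. 1 / ((2 * real n + 1) ^ 3 * real ((2 * n) choose n))) sums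
     (32 * Im (polylog 3 ((1 + \<i>) / 2)) / 3 - 4 * pi * polylog 2 (2 - sqrt 3) / 3 - pi ^ 3 / 9
        - pi * (ln 2 - ln (2 + sqrt 3))\<^sup>2 / 3)"
proof -
  have "arctan (2 - sqrt 3) = pi / 12"
    by (rule arctan_unique) (use pi_gt_zero tan_pi_twelfth in auto)
  hence "2 * arctan (2 - sqrt 3) = pi / 6" by simp
  hence "sin_sum (pi / 6) = ray_primitive ((sqrt 3 - 1) / sqrt 2)"
    using sin_sum_eq_ray_primitive[of "(sqrt 3 - 1) / sqrt 2"] endpoint_bounds unfolding endpoint_square by (simp only: less_imp_le)
  moreover have "ln (2 - sqrt 3) = - ln (2 + sqrt 3)"
  proof -
    have "(2 - sqrt 3) * (2 + sqrt 3) = 1" by (simp add: algebra_simps)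
    moreover have "0 < 2 + sqrt 3" by (simp add: add_pos_pos)
    ultimately have "2 - sqrt 3 = inverse (2 + sqrt 3)" by (simp add: field_simps)
    thus ?thesis using \<open>0 < 2 + sqrt 3\<close> by (simp add: ln_inverse)
  qed
  ultimately have "sin_sum (pi / 6) = 32 * Im (polylog 3 ((1 + \<i>) / 2)) / 3 - 4 * pi * polylog 2 (2 - sqrt 3) / 3
      - pi ^ 3 / 9 - pi * (ln 2 - ln (2 + sqrt 3))\<^sup>2 / 3"
    unfolding ray_primitive_endpoint by simp
  with sin_sum_pi_sixth show ?thesis by (simp only:)
qed

section \<open>Integration along the unit circle\<close>

text \<open>Abel's theorem. With tails t_n, partial sum minus limit, summation by parts turns the
  difference into (1 - x) times the sum of t_n x^n. The factor 1 - x makes the finite initial part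
  small, and the rest is at most e/2 because (1 - x) times the geometric series is 1.\<close>

lemma Abel_limit:
  fixes a :: "nat \<Rightarrow> complex"
  assumes a: "a sums s" and r: "\<And>k. 0 \<le> r k" "\<And>k. r k < (1::real)" "r \<longlonglongrightarrow> 1"
  shows "(\<lambda>k. \<Sum>n. a n * of_real (r k) ^ n) \<longlonglongrightarrow> s"
proof -
  define t where "t n = (\<Sum>j<Suc n. a j) - s" for n
  have S: "(\<lambda>n. \<Sum>j<n. a j) \<longlonglongrightarrow> s" using a by (simp add: sums_def)
  have "(\<lambda>n. (\<Sum>j<Suc n. a j) - s) \<longlonglongrightarrow> s - s" by (rule tendsto_diff[OF LIMSEQ_Suc[OF S] tendsto_const])
  hence t: "t \<longlonglongrightarrow> 0" unfolding t_def[symmetric] diff_self .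
  have "Bseq t" by (rule convergent_imp_Bseq[OF convergentI[OF t]])
  then obtain M where M: "0 < M" "\<And>n. norm (t n) \<le> M" by (rule BseqE) blast
  have eq: "(\<Sum>n. a n * of_real x ^ n) - s = of_real (1 - x) * (\<Sum>n. t n * of_real x ^ n)"
    and sm: "summable (\<lambda>n. t n * of_real x ^ n)" if x: "0 \<le> x" "x < 1" for x
  proof -
    show sm: "summable (\<lambda>n. t n * of_real x ^ n)"
    proof (rule summable_comparison_test'[OF summable_mult[OF summable_geometric[of x], of M]])
      fix n show "norm (t n * of_real x ^ n) \<le> M * x ^ n"
        using M(2)[of n] x by (simp add: norm_mult norm_power mult_right_mono)
    qed (use x in auto)
    have "(\<lambda>n. t (Suc n) * of_real x ^ Suc n - of_real x * (t n * of_real x ^ n))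
       sums ((\<Sum>n. t n * of_real x ^ n) - t 0 - of_real x * (\<Sum>n. t n * of_real x ^ n))"
    proof (rule sums_diff[OF _ sums_mult[OF summable_sums[OF sm]]])
      show "(\<lambda>n. t (Suc n) * of_real x ^ Suc n) sums ((\<Sum>n. t n * of_real x ^ n) - t 0)"
        using summable_sums[OF sm] sums_Suc_iff[of "\<lambda>n. t n * of_real x ^ n"] by simp
    qed
    moreover have "t (Suc n) * of_real x ^ Suc n - of_real x * (t n * of_real x ^ n) = a (Suc n) * of_real x ^ Suc n" for n
      by (simp add: t_def algebra_simps)
    ultimately have "(\<lambda>n. a (Suc n) * of_real x ^ Suc n)
       sums ((\<Sum>n. t n * of_real x ^ n) - t 0 - of_real x * (\<Sum>n. t n * of_real x ^ n))" by simp
    hence "(\<lambda>n. a n * of_real x ^ n)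
       sums ((\<Sum>n. t n * of_real x ^ n) - t 0 - of_real x * (\<Sum>n. t n * of_real x ^ n) + a 0)"
      by (subst (asm) sums_Suc_iff) simp
    thus "(\<Sum>n. a n * of_real x ^ n) - s = of_real (1 - x) * (\<Sum>n. t n * of_real x ^ n)"
      by (simp add: sums_iff t_def algebra_simps)
  qed
  have "(\<lambda>k. (\<Sum>n. a n * of_real (r k) ^ n) - s) \<longlonglongrightarrow> 0"
  proof (rule LIMSEQ_I)
    fix e :: real assume e: "0 < e"
    obtain N where N: "\<And>n. n \<ge> N \<Longrightarrow> norm (t n) < e / 2"
      using LIMSEQ_D[OF t, of "e / 2"] e by auto
    have "(\<lambda>k. (1 - r k) * (real N * M)) \<longlonglongrightarrow> (1 - 1) * (real N * M)"
      by (intro tendsto_intros r)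
    hence "\<forall>\<^sub>F k in sequentially. (1 - r k) * (real N * M) < e / 2"
      by (rule order_tendstoD) (use e in simp)
    then obtain K where K: "\<And>k. k \<ge> K \<Longrightarrow> (1 - r k) * (real N * M) < e / 2"
      by (auto simp: eventually_sequentially)
    have "norm ((\<Sum>n. a n * of_real (r k) ^ n) - s - 0) < e" if "k \<ge> K" for k
    proof -
      define x where "x = r k"
      have x: "0 \<le> x" "x < 1" using r by (auto simp: x_def)
      have n1: "summable (\<lambda>n. norm (t n * of_real x ^ n))"
      proof (rule summable_comparison_test'[OF summable_mult[OF summable_geometric[of x], of M]])
        fix n show "norm (norm (t n * of_real x ^ n)) \<le> M * x ^ n"
          using M(2)[of n] x by (simp add: norm_mult norm_power mult_right_mono)
      qed (use x in auto)
      have "norm (\<Sum>n. t n * of_real x ^ n) \<le> (\<Sum>n. norm (t n * of_real x ^ n))"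
        by (rule summable_norm[OF n1])
      also have "\<dots> = (\<Sum>n. norm (t (n + N) * of_real x ^ (n + N))) + (\<Sum>n<N. norm (t n * of_real x ^ n))"
        by (rule suminf_split_initial_segment[OF n1])
      also have "(\<Sum>n<N. norm (t n * of_real x ^ n)) \<le> (\<Sum>n<N. M * 1)"
      proof (rule sum_mono)
        fix n
        have "x ^ n \<le> 1" using x by (intro power_le_one) auto
        hence "norm (t n) * x ^ n \<le> M * 1" using M x by (intro mult_mono) auto
        thus "norm (t n * of_real x ^ n) \<le> M * 1" using x by (simp add: norm_mult norm_power)
      qed
      also have "(\<Sum>n. norm (t (n + N) * of_real x ^ (n + N))) \<le> (\<Sum>n. e / 2 * x ^ n)"
      proof (rule suminf_le)
        fix n
        have "x ^ (n + N) \<le> x ^ n" using x by (intro power_decreasing) auto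
        hence "norm (t (n + N)) * x ^ (n + N) \<le> e / 2 * x ^ n"
          using N[of "n + N"] x e by (intro mult_mono) auto
        thus "norm (t (n + N) * of_real x ^ (n + N)) \<le> e / 2 * x ^ n"
          using x by (simp add: norm_mult norm_power)
        show "summable (\<lambda>n. norm (t (n + N) * of_real x ^ (n + N)))"
          using n1 by (subst summable_iff_shift)
        show "summable (\<lambda>n. e / 2 * x ^ n)" using x by (intro summable_mult summable_geometric) auto
      qed
      also have "(\<Sum>n. e / 2 * x ^ n) = e / 2 * (1 / (1 - x))"
        using x by (subst suminf_mult) (auto simp: suminf_geometric)
      finally have "norm (\<Sum>n. t n * of_real x ^ n) \<le> e / 2 * (1 / (1 - x)) + real N * M" by simp
      hence "(1 - x) * norm (\<Sum>n. t n * of_real x ^ n) \<le> (1 - x) * (e / 2 * (1 / (1 - x)) + real N * M)"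
        using x by (intro mult_left_mono) auto
      also have "\<dots> = e / 2 + (1 - x) * (real N * M)" using x by (simp add: field_simps)
      also have "\<dots> < e" using K[OF that] by (simp add: x_def)
      finally have "(1 - x) * norm (\<Sum>n. t n * of_real x ^ n) < e" .
      moreover have "norm (complex_of_real (1 - x)) = 1 - x" unfolding norm_of_real using x by (intro abs_of_nonneg) simp
      ultimately show ?thesis unfolding x_def[symmetric] eq[OF x] diff_0_right norm_mult by simp
    qed
    thus "\<exists>no. \<forall>n\<ge>no. norm ((\<Sum>na. a na * of_real (r n) ^ na) - s - 0) < e" by blast
  qed
  thus ?thesis by (rule LIM_zero_cancel)
qed

section \<open>Generating functions of harmonic numbers in the open disc\<close>

definition harm_series :: "complex \<Rightarrow> complex" where
  "harm_series x = (\<Sum>n. harm n / of_nat (2 * n + 1) * x ^ (2 * n + 1))"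

definition harm_series2 :: "complex \<Rightarrow> complex" where
  "harm_series2 x = (\<Sum>n. harm n / of_nat (2 * n + 1) / of_nat (2 * n + 1) * x ^ (2 * n + 1))"

lemma norm_harm_le: "norm (harm n :: complex) \<le> 1 * real (Suc n)"
proof -
  have "norm (harm n :: complex) \<le> real n"
  proof (induction n)
    case (Suc n)
    have "norm (harm (Suc n) :: complex) \<le> norm (harm n :: complex) + norm (inverse (of_nat (Suc n)) :: complex)"
      unfolding harm_Suc by (rule norm_triangle_ineq)
    also have "norm (inverse (of_nat (Suc n)) :: complex) = 1 / real (Suc n)"
      unfolding norm_inverse norm_of_nat by (rule inverse_eq_divide)
    also have "\<dots> \<le> 1" by (simp add: divide_le_eq)
    finally show ?case using Suc by simp
  qed (simp add: harm_def)
  thus ?thesis by simp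
qed

lemma norm_harm_div_le: "norm (harm n / of_nat (2 * n + 1) :: complex) \<le> 1 * real (Suc n)"
proof -
  have "norm (harm n / of_nat (2 * n + 1) :: complex) = norm (harm n :: complex) / real (2 * n + 1)"
    unfolding norm_divide norm_of_nat ..
  also have "\<dots> \<le> norm (harm n :: complex) / 1" by (intro divide_left_mono) auto
  finally show ?thesis using norm_harm_le[of n] by simp
qed

text \<open>Multiplication by 1 - w turns the coefficients into the differences of harmonic numbers,
  that is, into 1/n.\<close>

lemma harm_generating:
  fixes w :: complex
  assumes w: "norm w < 1"
  shows "(1 - w) * (\<Sum>n. harm n * w ^ n) = - Ln (1 - w)"
proof -
  define H where "H = (\<Sum>n. harm n * w ^ n)"
  have s: "(\<lambda>n. harm n * w ^ n) sums H"
    unfolding H_def by (intro summable_sums summable_linear_coeffs[OF norm_harm_le w])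
  have "(\<lambda>n. harm (Suc n) * w ^ Suc n - w * (harm n * w ^ n)) sums (H - w * H)"
  proof (rule sums_diff[OF _ sums_mult[OF s]])
    show "(\<lambda>n. harm (Suc n) * w ^ Suc n) sums H"
      using s sums_Suc_iff[of "\<lambda>n. harm n * w ^ n" H] by (simp add: harm_def)
  qed
  moreover have "harm (Suc n) * w ^ Suc n - w * (harm n * w ^ n) = w ^ Suc n / of_nat (Suc n)" for n
    by (simp add: harm_Suc field_simps del: of_nat_Suc)
  ultimately have "(\<lambda>n. w ^ Suc n / of_nat (Suc n)) sums (H - w * H)" by simp
  from sums_unique2[OF this polylog_1_sums[OF w]] show ?thesis by (simp add: H_def algebra_simps)
qed

text \<open>The function \<Phi> of the overview, built like \<open>sin_sum\<close>: the derivative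
  of \<open>Ln x\<close> cancels the derivative \<open>harm_series x / x\<close> of the first
  summand, leaving only products of logarithms over 1 - x^2.\<close>

definition harm_primitive :: "complex \<Rightarrow> complex" where
  "harm_primitive x = harm_series2 x - Ln x * harm_series x"

lemma DERIV_harm_primitive:
  assumes x: "norm x < 1" "x \<notin> \<real>\<^sub>\<le>\<^sub>0"
  shows "(harm_primitive has_field_derivative Ln x * Ln (1 - x\<^sup>2) / (1 - x\<^sup>2)) (at x)"
proof -
  have nz: "x \<noteq> 0" using x by auto
  have x2: "norm (x\<^sup>2) < 1" using x by (simp add: norm_power power_less_one_iff)
  hence n1: "1 - x\<^sup>2 \<noteq> 0" by auto
  have d1: "(harm_series has_field_derivative - Ln (1 - x\<^sup>2) / (1 - x\<^sup>2)) (at x)"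
  proof -
    have "(\<Sum>n. harm n * x ^ (2 * n)) = - Ln (1 - x\<^sup>2) / (1 - x\<^sup>2)"
      using harm_generating[OF x2] n1 unfolding power_even by (simp add: field_simps)
    thus ?thesis using DERIV_odd_powser[OF norm_harm_le x(1)] unfolding harm_series_def[abs_def] by simp
  qed
  have d2: "(harm_series2 has_field_derivative harm_series x / x) (at x)"
  proof -
    have "harm_series x = (\<Sum>n. x * (harm n / of_nat (2 * n + 1) * (x\<^sup>2) ^ n))"
      by (simp only: harm_series_def power_odd mult.left_commute)
    also have "\<dots> = x * (\<Sum>n. harm n / of_nat (2 * n + 1) * (x\<^sup>2) ^ n)"
      by (rule suminf_mult[OF summable_linear_coeffs[OF norm_harm_div_le x2]])
    finally have "(\<Sum>n. harm n / of_nat (2 * n + 1) * x ^ (2 * n)) = harm_series x / x"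
      unfolding power_even using nz by simp
    thus ?thesis using DERIV_odd_powser[OF norm_harm_div_le x(1)] unfolding harm_series2_def[abs_def] by simp
  qed
  show ?thesis
    unfolding harm_primitive_def[abs_def]
    by (rule DERIV_cong[OF DERIV_diff[OF d2 DERIV_mult[OF has_field_derivative_Ln[OF x(2)] d1]]])
       (simp add: divide_inverse mult_ac)
qed

text \<open>Real coefficients and a positive argument leave nothing imaginary; thus the integral
  along an arc starting on the real axis has no contribution from its starting point.\<close>

lemma harm_primitive_of_real:
  assumes "0 < r" "r < 1"
  shows "Im (harm_primitive (of_real r)) = 0"
proof -
  have r2: "norm ((complex_of_real r)\<^sup>2) < 1" using assms by (simp add: norm_power power_less_one_iff)
  have re: "Im (\<Sum>n. a n * complex_of_real r ^ (2 * n + 1)) = 0"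
    if a: "\<And>n. norm (a n) \<le> 1 * real (Suc n)" "\<And>n. a n \<in> \<real>" for a :: "nat \<Rightarrow> complex"
  proof -
    have "summable (\<lambda>n. complex_of_real r * (a n * ((complex_of_real r)\<^sup>2) ^ n))"
      by (intro summable_mult summable_linear_coeffs[OF a(1) r2])
    hence "summable (\<lambda>n. a n * complex_of_real r ^ (2 * n + 1))"
      by (simp only: power_odd mult.left_commute)
    moreover have "Im (a n * complex_of_real r ^ (2 * n + 1)) = 0" for n
      using a(2)[of n] by (intro complex_is_Real_iff[THEN iffD1] Reals_mult Reals_power Reals_of_real)
    ultimately show ?thesis by (simp only: Im_suminf suminf_zero)
  qed
  have hR: "harm n \<in> (\<real> :: complex set)" for n unfolding harm_def by (intro sum_in_Reals) auto
  have "norm (harm n / of_nat (2 * n + 1) / of_nat (2 * n + 1) :: complex) \<le> 1 * real (Suc n)" for n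
  proof -
    have "norm (harm n / of_nat (2 * n + 1) / of_nat (2 * n + 1) :: complex) = norm (harm n / of_nat (2 * n + 1) :: complex) / real (2 * n + 1)"
      unfolding norm_divide norm_of_nat ..
    also have "\<dots> \<le> norm (harm n / of_nat (2 * n + 1) :: complex) / 1" by (intro divide_left_mono) auto
    finally show ?thesis using norm_harm_div_le[of n] by simp
  qed
  hence "Im (harm_series2 (of_real r)) = 0" unfolding harm_series2_def
    by (rule re) (intro Reals_divide hR Reals_of_nat)
  moreover have "Im (harm_series (of_real r)) = 0" unfolding harm_series_def
    by (rule re[OF norm_harm_div_le]) (intro Reals_divide hR Reals_of_nat)
  ultimately show ?thesis using assms by (simp add: harm_primitive_def Ln_of_real)
qed

section \<open>Dominated passage to the unit circle\<close>

lemma half_le_sin: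
  assumes "0 \<le> \<theta>" "\<theta> \<le> pi / 6"
  shows "\<theta> / 2 \<le> sin \<theta>"
proof -
  have "sin 0 - 0 / 2 \<le> sin \<theta> - \<theta> / 2"
  proof (rule DERIV_nonneg_imp_nondecreasing[of 0 \<theta> "\<lambda>x. sin x - x / 2", OF assms(1)])
    fix x assume x: "0 \<le> x" "x \<le> \<theta>"
    have "cos (pi / 3) \<le> cos x" using x assms pi_gt_zero by (intro cos_monotone_0_pi_le) auto
    hence "0 \<le> cos x - 1 / 2" by (simp add: cos_60)
    moreover have "((\<lambda>x. sin x - x / 2) has_real_derivative cos x - 1 / 2) (at x)"
      by (auto intro!: derivative_eq_intros)
    ultimately show "\<exists>y. ((\<lambda>x. sin x - x / 2) has_real_derivative y) (at x) \<and> 0 \<le> y" by blast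
  qed
  thus ?thesis by simp
qed

text \<open>The pole of 1/(1 - x^2) at x = 1 is compensated by the zero of Ln x: |Ln x| is at most 4
  |1 - x|, and r at least 1/2 is used for |ln r| to be at most 2 (1 - r). Only the logarithmic
  singularity of Ln (1 - x^2) is left, and since |1 - x^2| is at least \<theta>/2 it is dominated by
  -ln \<theta>, uniformly in r.\<close>

lemma arc_integrand_bound:
  assumes r: "1 / 2 \<le> r" "r < 1" and \<theta>: "0 < \<theta>" "\<theta> \<le> pi / 6"
  defines "x \<equiv> of_real r * cis \<theta>"
  shows "norm (Ln x * Ln (1 - x\<^sup>2) / (1 - x\<^sup>2) * (\<i> * x)) \<le> 4 * (ln 2 + pi - ln \<theta>)"
proof -
  have s: "\<theta> / 2 \<le> sin \<theta>" using half_le_sin \<theta> by simp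
  have c: "0 < cos \<theta>" using \<theta> pi_gt_zero by (intro cos_gt_zero_pi) auto
  have th1: "\<theta> < 1" using \<theta> pi_less_4 by linarith
  have nx: "norm x = r" using r by (simp add: x_def norm_mult)
  have xe: "x = exp (Complex (ln r) \<theta>)" using r by (simp add: x_def exp_Complex_cis)
  have Lx: "Ln x = Complex (ln r) \<theta>" unfolding xe using \<theta> pi_gt_zero by (intro Ln_exp) auto
  have d1: "1 - r \<le> norm (1 - x)" using norm_triangle_ineq2[of 1 x] nx by simp
  have d2: "sin \<theta> \<le> norm (1 - x)"
  proof -
    \<comment> \<open>For s^2 + c^2 = 1 the last summand vanishes, and the squared distance from 1
      to r cis \<theta> is visibly at least (sin \<theta>)^2.\<close>
    have id: "(1 - r * c)\<^sup>2 + (r * s)\<^sup>2 = (r - c)\<^sup>2 + s\<^sup>2 + (1 - r\<^sup>2) * (1 - (s\<^sup>2 + c\<^sup>2))" for c s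
      by (simp add: power2_eq_square algebra_simps)
    have "(norm (1 - x))\<^sup>2 = (1 - r * cos \<theta>)\<^sup>2 + (r * sin \<theta>)\<^sup>2" by (simp add: cmod_power2 x_def)
    also have "\<dots> = (r - cos \<theta>)\<^sup>2 + (sin \<theta>)\<^sup>2" unfolding id by simp
    finally have "(sin \<theta>)\<^sup>2 \<le> (norm (1 - x))\<^sup>2" by simp
    thus ?thesis by (rule power2_le_imp_le) simp
  qed
  have pos: "0 < norm (1 - x)" using d2 s \<theta> by linarith
  have lnr: "\<bar>ln r\<bar> \<le> 2 * (1 - r)"
  proof -
    have "ln (1 / r) \<le> 1 / r - 1" using r by (intro ln_le_minus_one) auto
    also have "\<dots> = (1 - r) * (1 / r)" using r by (simp add: field_simps)
    also have "\<dots> \<le> (1 - r) * 2" using r by (intro mult_left_mono) (auto simp: field_simps)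
    finally show ?thesis using r by (simp add: ln_div)
  qed
  have "norm (Ln x) \<le> \<bar>ln r\<bar> + \<theta>" unfolding Lx using cmod_le[of "Complex (ln r) \<theta>"] \<theta>(1) by simp
  hence nL: "norm (Ln x) \<le> 4 * norm (1 - x)"
  proof -
    have "\<bar>ln r\<bar> \<le> 2 * norm (1 - x)" using order.trans[OF lnr mult_left_mono[OF d1]] by simp
    moreover have "\<theta> \<le> 2 * norm (1 - x)" using d2 s by linarith
    ultimately show ?thesis using \<open>norm (Ln x) \<le> \<bar>ln r\<bar> + \<theta>\<close> by linarith
  qed
  have p1: "1 \<le> norm (1 + x)"
  proof -
    have "1 \<le> Re (1 + x)" using r c by (simp add: x_def)
    thus ?thesis using complex_Re_le_cmod[of "1 + x"] by linarith
  qed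
  have f: "1 - x\<^sup>2 = (1 - x) * (1 + x)" by (simp add: power2_eq_square algebra_simps)
  have n2: "norm (1 - x\<^sup>2) \<ge> norm (1 - x)"
    unfolding f norm_mult using p1 pos by (simp add: mult_le_cancel_left1)
  have nle2: "norm (1 - x\<^sup>2) \<le> 2"
  proof -
    have "norm (1 - x\<^sup>2) \<le> 1 + norm (x\<^sup>2)" using norm_triangle_ineq4[of 1 "x\<^sup>2"] by simp
    also have "norm (x\<^sup>2) \<le> 1" using nx r by (simp add: norm_power power_le_one)
    finally show ?thesis by simp
  qed
  have n2pos: "0 < norm (1 - x\<^sup>2)" using n2 pos by linarith
  have "ln (\<theta> / 2) \<le> ln (norm (1 - x\<^sup>2))" "ln (norm (1 - x\<^sup>2)) \<le> ln 2"
    using n2 d2 s \<theta> nle2 n2pos by (auto intro!: ln_mono)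
  moreover have "ln (\<theta> / 2) = ln \<theta> - ln 2" "ln \<theta> \<le> 0" using \<theta> th1 by (auto simp: ln_div)
  ultimately have "\<bar>ln (norm (1 - x\<^sup>2))\<bar> \<le> ln 2 - ln \<theta>" by linarith
  moreover have "norm (Ln (1 - x\<^sup>2)) \<le> \<bar>Re (Ln (1 - x\<^sup>2))\<bar> + \<bar>Im (Ln (1 - x\<^sup>2))\<bar>" by (rule cmod_le)
  moreover have "Re (Ln (1 - x\<^sup>2)) = ln (norm (1 - x\<^sup>2))" "\<bar>Im (Ln (1 - x\<^sup>2))\<bar> \<le> pi"
  proof -
    have "1 - x\<^sup>2 \<noteq> 0" using n2pos by auto
    thus "Re (Ln (1 - x\<^sup>2)) = ln (norm (1 - x\<^sup>2))" "\<bar>Im (Ln (1 - x\<^sup>2))\<bar> \<le> pi"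
      using mpi_less_Im_Ln[of "1 - x\<^sup>2"] Im_Ln_le_pi[of "1 - x\<^sup>2"] by (auto simp: abs_le_iff)
  qed
  ultimately have nL2: "norm (Ln (1 - x\<^sup>2)) \<le> ln 2 + pi - ln \<theta>" by linarith
  have "norm (Ln x) / norm (1 - x\<^sup>2) \<le> 4"
  proof -
    have "norm (Ln x) \<le> 4 * norm (1 - x\<^sup>2)" using nL n2 by linarith
    thus ?thesis using n2pos by (simp add: divide_le_eq)
  qed
  moreover have "0 \<le> ln 2 + pi - ln \<theta>" using nL2 norm_ge_zero[of "Ln (1 - x\<^sup>2)"] by linarith
  ultimately have "norm (Ln x) / norm (1 - x\<^sup>2) * norm (Ln (1 - x\<^sup>2)) * r \<le> 4 * (ln 2 + pi - ln \<theta>) * 1"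
    using nL2 r by (intro mult_mono) auto
  thus ?thesis by (simp add: norm_mult norm_divide nx mult_ac)
qed

text \<open>For w on the unit circle 1 - w^2 = -2 i w sin \<theta>, so the quotient cancels w. Since
  Ln w = i \<theta> is purely imaginary, only Re Ln (1 - w^2) = ln (2 sin \<theta>) survives in the
  imaginary part.\<close>

lemma arc_integrand_tendsto:
  assumes \<theta>: "0 < \<theta>" "\<theta> \<le> pi / 6" and r: "r \<longlonglongrightarrow> 1"
  shows "(\<lambda>k. Im (Ln (of_real (r k) * cis \<theta>) * Ln (1 - (of_real (r k) * cis \<theta>)\<^sup>2) / (1 - (of_real (r k) * cis \<theta>)\<^sup>2)
           * (\<i> * (of_real (r k) * cis \<theta>)))) \<longlonglongrightarrow> - \<theta> * ln (2 * sin \<theta>) / (2 * sin \<theta>)"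
proof -
  have c: "0 < cos \<theta>" and s: "0 < sin \<theta>"
    using \<theta> pi_gt_zero by (auto intro!: cos_gt_zero_pi sin_gt_zero)
  define w where "w = cis \<theta>"
  have w1: "w \<notin> \<real>\<^sub>\<le>\<^sub>0" using c by (auto simp: w_def complex_nonpos_Reals_iff)
  have f: "1 - w\<^sup>2 = of_real (2 * sin \<theta>) * (- \<i> * w)"
  proof -
    have "cos \<theta> * cos \<theta> = 1 - sin \<theta> * sin \<theta>" using sin_cos_squared_add[of \<theta>] by (simp add: power2_eq_square)
    thus ?thesis by (simp add: w_def complex_eq_iff power2_eq_square algebra_simps)
  qed
  have "Re (1 - w\<^sup>2) = 2 * sin \<theta> * sin \<theta>" unfolding f by (simp add: w_def)
  hence w2: "1 - w\<^sup>2 \<notin> \<real>\<^sub>\<le>\<^sub>0" using s by (metis complex_nonpos_Reals_iff mult_pos_pos not_le zero_less_numeral)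
  hence nz: "1 - w\<^sup>2 \<noteq> 0" by auto
  have "(\<lambda>k. of_real (r k) * w) \<longlonglongrightarrow> of_real 1 * w" by (intro tendsto_intros r)
  hence x: "(\<lambda>k. of_real (r k) * w) \<longlonglongrightarrow> w" by simp
  have "(\<lambda>k. Im (Ln (of_real (r k) * w) * Ln (1 - (of_real (r k) * w)\<^sup>2) / (1 - (of_real (r k) * w)\<^sup>2)
           * (\<i> * (of_real (r k) * w)))) \<longlonglongrightarrow> Im (Ln w * Ln (1 - w\<^sup>2) / (1 - w\<^sup>2) * (\<i> * w))"
    by (intro tendsto_Im tendsto_mult tendsto_divide tendsto_Ln tendsto_diff tendsto_power tendsto_const x w1 w2 nz)
  moreover have "Ln w = \<i> * of_real \<theta>"
  proof -
    have "w = exp (\<i> * of_real \<theta>)" by (simp add: w_def cis_conv_exp)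
    thus ?thesis using \<theta> pi_gt_zero by (simp only:) (rule Ln_exp; simp)
  qed
  moreover have "Re (Ln (1 - w\<^sup>2)) = ln (2 * sin \<theta>)"
  proof -
    have "norm (1 - w\<^sup>2) = 2 * sin \<theta>" unfolding f using s by (simp add: norm_mult w_def)
    thus ?thesis using Re_Ln[OF nz] by simp
  qed
  moreover have "Im (\<i> * of_real \<theta> * L / (1 - w\<^sup>2) * (\<i> * w)) = - \<theta> * Re L / (2 * sin \<theta>)" for L
  proof -
    have "w \<noteq> 0" by (simp add: w_def)
    hence "\<i> * of_real \<theta> * L / (1 - w\<^sup>2) * (\<i> * w) = - (\<i> * of_real (\<theta> / (2 * sin \<theta>)) * L)"
      unfolding f using s by (simp add: divide_simps)
    thus ?thesis by simp
  qed
  ultimately show ?thesis by (simp only: w_def)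
qed

text \<open>The integrand \<open>F\<close> is prescribed for t > 0 only, which leaves its value at t
  = 0 free for the limit argument.\<close>

lemma harm_primitive_arc_integral:
  assumes r: "0 < r" "r < 1"
    and F: "\<And>t. 0 < t \<Longrightarrow> F t = Im (Ln (of_real r * cis t) * Ln (1 - (of_real r * cis t)\<^sup>2) / (1 - (of_real r * cis t)\<^sup>2) * (\<i> * (of_real r * cis t)))"
  shows "(F has_integral Im (harm_primitive (of_real r * cis (pi / 6)))) {0..pi / 6}"
proof -
  define D where "D x = Ln x * Ln (1 - x\<^sup>2) / (1 - x\<^sup>2) * (\<i> * x)" for x :: complex
  have d: "((\<lambda>t. Im (harm_primitive (of_real r * cis t))) has_vector_derivative Im (D (of_real r * cis t))) (at t)"
    if t: "0 \<le> t" "t \<le> pi / 6" for t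
  proof -
    have "- (pi / 2) < t" "t < pi / 2" using t pi_gt_zero by linarith+
    hence c: "0 < cos t" by (rule cos_gt_zero_pi)
    define x where "x = of_real r * exp (\<i> * of_real t)"
    have xc: "x = of_real r * cis t" by (simp add: x_def cis_conv_exp)
    have n: "norm x < 1" unfolding xc using r by (simp add: norm_mult)
    have "0 < Re x" unfolding xc using r c by simp
    hence np: "x \<notin> \<real>\<^sub>\<le>\<^sub>0" by (auto simp: complex_nonpos_Reals_iff)
    have e: "((\<lambda>z. of_real r * exp (\<i> * z)) has_field_derivative \<i> * x) (at (of_real t))"
      unfolding x_def by (auto intro!: derivative_eq_intros)
    have "((\<lambda>z. harm_primitive (of_real r * exp (\<i> * z))) has_field_derivative D x) (at (of_real t))"
      unfolding D_def
      by (rule DERIV_chain2[where f = harm_primitive and g = "\<lambda>z. of_real r * exp (\<i> * z)", OF _ e])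
         (use DERIV_harm_primitive[OF n np] in \<open>simp only: x_def\<close>)
    from bounded_linear.has_vector_derivative[OF bounded_linear_Im has_vector_derivative_real_field[OF this]]
    show ?thesis unfolding xc cis_conv_exp .
  qed
  have "(F has_integral (Im (harm_primitive (of_real r * cis (pi / 6))) - Im (harm_primitive (of_real r * cis 0)))) {0..pi / 6}"
  proof (rule fundamental_theorem_of_calculus_interior)
    show "continuous_on {0..pi / 6} (\<lambda>t. Im (harm_primitive (of_real r * cis t)))"
      by (intro continuous_at_imp_continuous_on ballI has_vector_derivative_continuous[OF d]) auto
    fix t assume t: "t \<in> {0<..<pi / 6}"
    show "((\<lambda>t. Im (harm_primitive (of_real r * cis t))) has_vector_derivative F t) (at t)"
      using d[of t] t by (simp add: F D_def)
  qed simp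
  thus ?thesis using harm_primitive_of_real[OF r] by simp
qed

lemma arc_bound_integrable: "(\<lambda>\<theta>. 4 * (ln 2 + pi - ln \<theta>)) integrable_on {0..pi / 6}"
proof (rule has_integral_integrable, rule fundamental_theorem_of_calculus_interior)
  have c: "continuous_on {0..pi / 6} (\<lambda>x::real. x * ln x)"
    by (rule continuous_on_subset[OF continuous_on_mult_ln]) auto
  show "continuous_on {0..pi / 6} (\<lambda>\<theta>. 4 * ((ln 2 + pi) * \<theta> - (\<theta> * ln \<theta> - \<theta>)))"
    by (intro continuous_on_mult continuous_on_diff continuous_on_const continuous_on_id c)
  fix \<theta> assume t: "\<theta> \<in> {0<..<pi / 6}"
  hence "((\<lambda>\<theta>. 4 * ((ln 2 + pi) * \<theta> - (\<theta> * ln \<theta> - \<theta>))) has_real_derivative 4 * (ln 2 + pi - ln \<theta>)) (at \<theta>)"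
    by (auto intro!: derivative_eq_intros)
  thus "((\<lambda>\<theta>. 4 * ((ln 2 + pi) * \<theta> - (\<theta> * ln \<theta> - \<theta>))) has_vector_derivative 4 * (ln 2 + pi - ln \<theta>)) (at \<theta>)"
    by (simp only: has_real_derivative_iff_has_vector_derivative)
qed simp

lemma sin_sum_integral:
  "((\<lambda>\<theta>. - \<theta> * ln (2 * sin \<theta>) / (2 * sin \<theta>)) has_integral sin_sum (pi / 6) / 4) {0..pi / 6}"
proof -
  have "((\<lambda>\<theta>. - \<theta> * ln (2 * sin \<theta>) / (2 * sin \<theta>)) has_integral (sin_sum (pi / 6) / 4 - sin_sum 0 / 4)) {0..pi / 6}"
  proof (rule fundamental_theorem_of_calculus_interior)
    show "continuous_on {0..pi / 6} (\<lambda>\<theta>. sin_sum \<theta> / 4)"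
      using pi_gt_zero by (intro continuous_intros continuous_on_sin_sum) auto
    fix \<theta> assume t: "\<theta> \<in> {0<..<pi / 6}"
    have "0 < \<theta>" "\<theta> < pi / 2" using t pi_gt_zero by auto
    from DERIV_cdivide[OF DERIV_sin_sum[OF this], of 4]
    show "((\<lambda>\<theta>. sin_sum \<theta> / 4) has_vector_derivative - \<theta> * ln (2 * sin \<theta>) / (2 * sin \<theta>)) (at \<theta>)"
      by (simp add: has_real_derivative_iff_has_vector_derivative)
  qed simp
  moreover have "sin_sum 0 = 0" by (simp add: sin_sum_def arcsin_primitive_def arcsin_primitive2_def)
  ultimately show ?thesis by simp
qed

lemma tendsto_Im_harm_primitive:
  assumes r: "\<And>k. 1 / 2 \<le> r k" "\<And>k. r k < 1" "r \<longlonglongrightarrow> 1"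
  shows "(\<lambda>k. Im (harm_primitive (of_real (r k) * cis (pi / 6)))) \<longlonglongrightarrow> sin_sum (pi / 6) / 4"
proof -
  define D where "D x = Ln x * Ln (1 - x\<^sup>2) / (1 - x\<^sup>2) * (\<i> * x)" for x :: complex
  \<comment> \<open>On the real axis the integrand grows without bound as r tends to 1. Replacing
    its value at t = 0 by 0 keeps both the majorant and the pointwise limit valid there.\<close>
  define F where "F k t = (if t = 0 then 0 else Im (D (of_real (r k) * cis t)))" for k t
  have int: "(F k has_integral Im (harm_primitive (of_real (r k) * cis (pi / 6)))) {0..pi / 6}" for k
    by (rule harm_primitive_arc_integral) (use r(1)[of k] r(2)[of k] in \<open>auto simp: F_def D_def\<close>)
  have "(\<lambda>k. integral {0..pi / 6} (F k)) \<longlonglongrightarrow> integral {0..pi / 6} (\<lambda>\<theta>. - \<theta> * ln (2 * sin \<theta>) / (2 * sin \<theta>))"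
  proof (rule dominated_convergence(2)[OF _ arc_bound_integrable])
    show "F k integrable_on {0..pi / 6}" for k using int by (rule has_integral_integrable)
    fix t assume t: "t \<in> {0..pi / 6}"
    show "norm (F k t) \<le> 4 * (ln 2 + pi - ln t)" for k
    proof (cases "t = 0")
      case False
      hence "norm (F k t) \<le> norm (D (of_real (r k) * cis t))" by (simp add: F_def abs_Im_le_cmod)
      also have "\<dots> \<le> 4 * (ln 2 + pi - ln t)" unfolding D_def
        using t False by (intro arc_integrand_bound r) auto
      finally show ?thesis .
    qed (simp add: F_def)
    show "(\<lambda>k. F k t) \<longlonglongrightarrow> - t * ln (2 * sin t) / (2 * sin t)"
    proof (cases "t = 0")
      case False
      hence "0 < t" "t \<le> pi / 6" using t by auto
      from arc_integrand_tendsto[OF this r(3)] show ?thesis using False by (simp add: F_def D_def)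
    qed (simp add: F_def)
  qed
  thus ?thesis unfolding integral_unique[OF int] integral_unique[OF sin_sum_integral] .
qed

text \<open>One factor r is split off the odd power, and \<open>Abel_limit\<close> is applied with
  radius r^2.\<close>

lemma odd_series_radial_limit:
  fixes a :: "nat \<Rightarrow> complex"
  assumes a: "(\<lambda>n. a n * x ^ (2 * n + 1)) sums s" and r: "\<And>k. 0 \<le> r k" "\<And>k. r k < (1::real)" "r \<longlonglongrightarrow> 1"
  shows "(\<lambda>k. \<Sum>n. a n * (of_real (r k) * x) ^ (2 * n + 1)) \<longlonglongrightarrow> s"
proof -
  have r2: "(r k)\<^sup>2 < 1" for k using r(1,2)[of k] by (simp add: power_less_one_iff)
  have "(\<lambda>k. (r k)\<^sup>2) \<longlonglongrightarrow> 1\<^sup>2" by (intro tendsto_power r)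
  hence "(\<lambda>k. \<Sum>n. a n * x ^ (2 * n + 1) * of_real ((r k)\<^sup>2) ^ n) \<longlonglongrightarrow> s"
    by (intro Abel_limit[OF a] r2) auto
  hence "(\<lambda>k. of_real (r k) * (\<Sum>n. a n * x ^ (2 * n + 1) * of_real ((r k)\<^sup>2) ^ n)) \<longlonglongrightarrow> of_real 1 * s"
    by (intro tendsto_mult tendsto_of_real r)
  moreover have "of_real (r k) * (\<Sum>n. a n * x ^ (2 * n + 1) * of_real ((r k)\<^sup>2) ^ n) = (\<Sum>n. a n * (of_real (r k) * x) ^ (2 * n + 1))" for k
  proof -
    have sm: "summable (\<lambda>n. a n * x ^ (2 * n + 1) * of_real ((r k)\<^sup>2) ^ n)"
    proof (rule powser_inside[of "\<lambda>n. a n * x ^ (2 * n + 1)" 1])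
      show "summable (\<lambda>n. a n * x ^ (2 * n + 1) * 1 ^ n)" using sums_summable[OF a] by simp
      show "norm (of_real ((r k)\<^sup>2) :: complex) < norm (1 :: complex)" using r2[of k] unfolding norm_of_real by simp
    qed
    have "of_real (r k) * (a n * x ^ (2 * n + 1) * of_real ((r k)\<^sup>2) ^ n) = a n * (of_real (r k) * x) ^ (2 * n + 1)" for n
    proof -
      have "complex_of_real (r k) ^ (2 * n + 1) = of_real (r k) * of_real ((r k)\<^sup>2) ^ n"
        by (simp only: power_odd of_real_power)
      thus ?thesis by (simp only: power_mult_distrib mult_ac)
    qed
    thus ?thesis unfolding suminf_mult[OF sm, symmetric] by (simp only:)
  qed
  ultimately show ?thesis by simp
qed

text \<open>The radial limit of \<open>harm_primitive\<close> at cis(pi/6) is computed twice, by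
  dominated convergence of the arc integrals and by Abel's theorem for the two series. The logarithm
  tends to i pi/6, which is why the real part of \<open>A\<close> appears.\<close>

lemma sin_sum_eq_harm_sums:
  assumes A: "(\<lambda>n. harm n / of_nat (2 * n + 1) * cis (pi / 6) ^ (2 * n + 1)) sums A"
    and B: "(\<lambda>n. harm n / of_nat (2 * n + 1) ^ 2 * cis (pi / 6) ^ (2 * n + 1)) sums B"
  shows "sin_sum (pi / 6) = 4 * (Im B - pi / 6 * Re A)"
proof -
  \<comment> \<open>Starts at 1/2 and increases to 1, so it stays in the range where
    \<open>arc_integrand_bound\<close> applies.\<close>
  define r where "r k = 1 - (1 / 2) * (1 / real (Suc k))" for k
  define w where "w = cis (pi / 6)"
  have "(\<lambda>k. 1 - (1 / 2) * (1 / real (Suc k))) \<longlonglongrightarrow> 1 - (1 / 2) * 0"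
    by (intro tendsto_diff tendsto_mult tendsto_const LIMSEQ_Suc[OF lim_1_over_n])
  hence r3: "r \<longlonglongrightarrow> 1" by (simp add: r_def[abs_def])
  have r1: "1 / 2 \<le> r k" and r2: "r k < 1" for k
    by (simp_all add: r_def field_simps)
  have r0: "0 \<le> r k" for k using r1[of k] by linarith
  have a: "(\<lambda>k. harm_series (of_real (r k) * w)) \<longlonglongrightarrow> A"
    unfolding harm_series_def by (rule odd_series_radial_limit[OF _ r0 r2 r3]) (use A in \<open>simp only: w_def\<close>)
  have b: "(\<lambda>k. harm_series2 (of_real (r k) * w)) \<longlonglongrightarrow> B"
    unfolding harm_series2_def by (rule odd_series_radial_limit[OF _ r0 r2 r3]) (use B in \<open>simp only: w_def power2_eq_square divide_divide_eq_left\<close>)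
  have "0 < Re w" by (simp add: w_def cos_30)
  hence "w \<notin> \<real>\<^sub>\<le>\<^sub>0" by (auto simp: complex_nonpos_Reals_iff)
  moreover have "(\<lambda>k. of_real (r k) * w) \<longlonglongrightarrow> of_real 1 * w" by (intro tendsto_intros r3)
  ultimately have "(\<lambda>k. Ln (of_real (r k) * w)) \<longlonglongrightarrow> Ln w" by (intro tendsto_Ln) simp_all
  hence "(\<lambda>k. Im (harm_primitive (of_real (r k) * w))) \<longlonglongrightarrow> Im (B - Ln w * A)"
    unfolding harm_primitive_def by (intro tendsto_Im tendsto_diff tendsto_mult a b)
  from LIMSEQ_unique[OF this[unfolded w_def] tendsto_Im_harm_primitive[OF r1 r2 r3]]
  have "sin_sum (pi / 6) / 4 = Im (B - Ln (cis (pi / 6)) * A)" by simp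
  moreover have "Ln (cis (pi / 6)) = \<i> * of_real (pi / 6)"
    unfolding cis_conv_exp by (rule Ln_exp) (use pi_gt_zero in auto)
  ultimately show ?thesis by simp
qed

section \<open>Cyclotomic multiple zeta values\<close>

text \<open>Summation by parts against z^n, whose partial sums stay bounded for z different from 1.
  Bounded variation replaces monotonicity because the coefficients will be truncated multiple
  polylogarithms over n, which are complex.\<close>

lemma summable_power_mult_bounded_variation:
  fixes b :: "nat \<Rightarrow> complex"
  assumes z: "norm z = 1" "z \<noteq> 1" and b: "b \<longlonglongrightarrow> 0" and var: "summable (\<lambda>n. norm (b (Suc n) - b n))"
  shows "summable (\<lambda>n. z ^ n * b n)"
proof -
  have eq: "(z - 1) * (\<Sum>n<N. z ^ n * b n) = z ^ N * b N - b 0 - (\<Sum>n<N. z ^ Suc n * (b (Suc n) - b n))" for N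
    by (induction N) (simp_all add: algebra_simps)
  have "summable (\<lambda>n. z ^ Suc n * (b (Suc n) - b n))"
    by (rule summable_norm_cancel) (use var z in \<open>simp add: norm_mult norm_power\<close>)
  hence c: "convergent (\<lambda>N. \<Sum>n<N. z ^ Suc n * (b (Suc n) - b n))" by (simp only: summable_iff_convergent)
  have "(\<lambda>N. norm (z ^ N * b N)) \<longlonglongrightarrow> 0"
    using tendsto_norm_zero[OF b] z by (simp add: norm_mult norm_power)
  hence "convergent (\<lambda>N. z ^ N * b N)" by (auto intro: convergentI dest: tendsto_norm_zero_cancel)
  from convergent_diff[OF convergent_diff[OF this convergent_const[of "b 0"]] c]
  have "convergent (\<lambda>N. (z - 1) * (\<Sum>n<N. z ^ n * b n))" by (simp only: eq)
  from convergent_mult[OF convergent_const[of "1 / (z - 1)"] this]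
  have "convergent (\<lambda>N. \<Sum>n<N. z ^ n * b n)" using z by simp
  thus ?thesis by (simp only: summable_iff_convergent)
qed

lemma mpl_trunc_Cons_Suc:
  "mpl_trunc (s # ss) (z # zs) (Suc N) =
     mpl_trunc (s # ss) (z # zs) N + z ^ Suc N / of_nat (Suc N) ^ s * mpl_trunc ss zs N"
  by simp

lemma mpl_trunc_Cons_eq:
  "mpl_trunc (s # ss) (z # zs) N = (\<Sum>n<N. z ^ Suc n / of_nat (Suc n) ^ s * mpl_trunc ss zs n)"
  by (induction N) (simp_all del: mpl_trunc.simps(2) add: mpl_trunc_Cons_Suc, simp)

lemma sum_inverse_sqrt_le: "(\<Sum>n<N. 1 / sqrt (real (Suc n))) \<le> 2 * sqrt (real N)"
proof (induction N)
  case (Suc N)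
  have "1 / sqrt (real (Suc N)) \<le> 2 * sqrt (real (Suc N)) - 2 * sqrt (real N)"
  proof -
    have "sqrt (real N) * sqrt (real (Suc N)) \<le> real N + 1 / 2"
    proof (rule power2_le_imp_le)
      show "(sqrt (real N) * sqrt (real (Suc N)))\<^sup>2 \<le> (real N + 1 / 2)\<^sup>2"
        by (simp add: power_mult_distrib) (simp add: power2_eq_square algebra_simps)
    qed simp
    hence "1 + 2 * sqrt (real N) * sqrt (real (Suc N)) \<le> 2 * (sqrt (real (Suc N)) * sqrt (real (Suc N)))" by simp
    hence "1 \<le> (2 * sqrt (real (Suc N)) - 2 * sqrt (real N)) * sqrt (real (Suc N))" by (simp add: algebra_simps)
    thus ?thesis by (subst divide_le_eq) auto
  qed
  with Suc show ?case by simp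
qed simp

text \<open>A crude growth bound that is stable under the recursion and suffices for convergence.\<close>

lemma norm_mpl_trunc_le:
  assumes "length ss = length zs" "\<forall>s\<in>set ss. 0 < s" "\<forall>z\<in>set zs. norm z = 1"
  shows "norm (mpl_trunc ss zs N) \<le> 2 ^ length ss * sqrt (real (Suc N))"
  using assms
proof (induction ss zs arbitrary: N rule: list_induct2')
  case (4 s ss z zs)
  have "norm (z ^ Suc n / of_nat (Suc n) ^ s * mpl_trunc ss zs n) \<le> 2 ^ length ss * (1 / sqrt (real (Suc n)))" for n
  proof -
    have "real (Suc n) ^ 1 \<le> real (Suc n) ^ s" using 4 by (intro power_increasing) auto
    hence "1 / real (Suc n) ^ s \<le> 1 / real (Suc n)" by (simp add: frac_le)
    moreover have "norm (mpl_trunc ss zs n) \<le> 2 ^ length ss * sqrt (real (Suc n))" using 4 by simp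
    ultimately have "1 / real (Suc n) ^ s * norm (mpl_trunc ss zs n) \<le> 1 / real (Suc n) * (2 ^ length ss * sqrt (real (Suc n)))"
      by (intro mult_mono) auto
    also have "\<dots> = 2 ^ length ss * (sqrt (real (Suc n)) / real (Suc n))" by simp
    also have "sqrt (real (Suc n)) / real (Suc n) = 1 / sqrt (real (Suc n))"
      by (simp add: field_simps del: of_nat_Suc)
    finally show ?thesis using 4 by (simp add: norm_mult norm_divide norm_power del: of_nat_Suc power_Suc)
  qed
  hence "norm (mpl_trunc (s # ss) (z # zs) N) \<le> (\<Sum>n<N. 2 ^ length ss * (1 / sqrt (real (Suc n))))"
    unfolding mpl_trunc_Cons_eq by (intro sum_norm_le) blast
  also have "\<dots> = 2 ^ length ss * (\<Sum>n<N. 1 / sqrt (real (Suc n)))" by (simp add: sum_distrib_left)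
  also have "\<dots> \<le> 2 ^ length ss * (2 * sqrt (real N))" by (intro mult_left_mono sum_inverse_sqrt_le) auto
  also have "\<dots> \<le> 2 ^ length ss * (2 * sqrt (real (Suc N)))" by (intro mult_left_mono) auto
  finally show ?case by simp
qed auto

text \<open>Growth of order sqrt n against 1/n^2 gives the exponent 3/2; this majorant serves both
  cases of \<open>convergent_mpl_trunc\<close>.\<close>

lemma summable_three_halves: "summable (\<lambda>n. sqrt (real (Suc n)) / real (Suc n) ^ 2)"
proof -
  have "summable (\<lambda>n. real n powr (- 3 / 2))" by (subst summable_real_powr_iff) simp
  hence "summable (\<lambda>n. real (Suc n) powr (- 3 / 2))" by (subst summable_Suc_iff)
  moreover have "real (Suc n) powr (- 3 / 2) = sqrt (real (Suc n)) / real (Suc n) ^ 2" for n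
  proof -
    have "real (Suc n) powr (- 3 / 2) = real (Suc n) powr (1 / 2 - 2)" by simp
    also have "\<dots> = sqrt (real (Suc n)) / real (Suc n) ^ 2"
      by (subst powr_diff) (simp add: powr_half_sqrt powr_numeral del: of_nat_Suc)
    finally show ?thesis .
  qed
  ultimately show ?thesis by simp
qed

text \<open>For a leading exponent of at least 2 the outer series converges absolutely, as the inner
  sums are O(sqrt n). For leading exponent 1 the outer root z is not 1; the inner sum over n tends
  to 0, its increments are O(n^(-3/2)), and the bounded variation test applies.\<close>

lemma convergent_mpl_trunc:
  assumes len: "length ss = length zs" and pos: "\<forall>s\<in>set ss. 0 < s" and nrm: "\<forall>z\<in>set zs. norm z = 1"
    and hd: "ss \<noteq> [] \<longrightarrow> (hd ss, hd zs) \<noteq> (1, 1)"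
  shows "convergent (mpl_trunc ss zs)"
proof (cases ss)
  case Nil
  hence "mpl_trunc ss zs = (\<lambda>_. 1)" using len by (auto simp: fun_eq_iff)
  thus ?thesis by (simp add: convergent_const)
next
  case (Cons s ss')
  then obtain z zs' where zs: "zs = z # zs'" using len by (cases zs) auto
  define h where "h = mpl_trunc ss' zs'"
  define C where "C = (2 :: real) ^ length ss'"
  have "0 \<le> C" by (simp add: C_def)
  have h: "norm (h n) \<le> C * sqrt (real (Suc n))" for n
    unfolding h_def C_def by (rule norm_mpl_trunc_le) (use len pos nrm Cons zs in auto)
  have z: "norm z = 1" using nrm zs by simp
  have "summable (\<lambda>n. z ^ Suc n / of_nat (Suc n) ^ s * h n)"
  proof (cases "s = 1")
    case False
    hence s: "2 \<le> s" using pos Cons by (cases s) auto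
    show ?thesis
    proof (rule summable_comparison_test'[OF summable_mult[OF summable_three_halves, of C]])
      fix n
      have "real (Suc n) ^ 2 \<le> real (Suc n) ^ s" using s by (intro power_increasing) auto
      hence "1 / real (Suc n) ^ s \<le> 1 / real (Suc n) ^ 2" by (simp add: frac_le)
      hence "1 / real (Suc n) ^ s * norm (h n) \<le> 1 / real (Suc n) ^ 2 * (C * sqrt (real (Suc n)))"
        using h[of n] by (intro mult_mono) auto
      thus "norm (z ^ Suc n / of_nat (Suc n) ^ s * h n) \<le> C * (sqrt (real (Suc n)) / real (Suc n) ^ 2)"
        using z by (simp add: norm_mult norm_divide norm_power mult_ac del: of_nat_Suc power_Suc)
    qed
  next
    case True
    hence z1: "z \<noteq> 1" using hd Cons zs by simp
    define b where "b n = h n / of_nat (Suc n)" for n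
    \<comment> \<open>One step of truncation adds a single term of the inner sum, with a denominator
      of at least n+1; for the empty inner index nothing changes.\<close>
    have hd: "norm (h (Suc n) - h n) \<le> C * sqrt (real (Suc n)) / real (Suc n)" for n
    proof (cases ss')
      case Nil
      hence "h = (\<lambda>_. 1)" using len Cons zs by (auto simp: h_def fun_eq_iff)
      thus ?thesis by (simp add: C_def)
    next
      case (Cons t ts)
      then obtain y ys where ys: "zs' = y # ys" using len \<open>ss = s # ss'\<close> zs by (cases zs') auto
      have t: "0 < t" "norm y = 1" using pos nrm \<open>ss = s # ss'\<close> zs Cons ys by auto
      have "norm (mpl_trunc ts ys n) \<le> 2 ^ length ts * sqrt (real (Suc n))"
        by (rule norm_mpl_trunc_le) (use len pos nrm \<open>ss = s # ss'\<close> zs Cons ys in auto)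
      also have "\<dots> \<le> C * sqrt (real (Suc n))" by (intro mult_right_mono) (auto simp: C_def Cons)
      finally have *: "norm (mpl_trunc ts ys n) \<le> C * sqrt (real (Suc n))" .
      have "real (Suc n) ^ 1 \<le> real (Suc n) ^ t" using t by (intro power_increasing) auto
      hence "1 / real (Suc n) ^ t \<le> 1 / real (Suc n)" by (simp add: frac_le)
      hence "1 / real (Suc n) ^ t * norm (mpl_trunc ts ys n) \<le> 1 / real (Suc n) * (C * sqrt (real (Suc n)))"
        using * by (intro mult_mono) auto
      thus ?thesis
        unfolding h_def Cons ys mpl_trunc_Cons_Suc
        using t by (simp add: norm_mult norm_divide norm_power del: of_nat_Suc power_Suc)
    qed
    have bd: "norm (b (Suc n) - b n) \<le> 2 * C * (sqrt (real (Suc n)) / real (Suc n) ^ 2)" for n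
    proof -
      have "b (Suc n) - b n = (h (Suc n) - h n) / of_nat (Suc (Suc n)) - h n / (of_nat (Suc n) * of_nat (Suc (Suc n)))"
      proof -
        have "of_nat (Suc n) \<noteq> (0 :: complex)" "of_nat (Suc (Suc n)) \<noteq> (0 :: complex)" by (simp_all only: of_nat_eq_0_iff)
        thus ?thesis unfolding b_def by (simp add: divide_simps) (simp add: algebra_simps)
      qed
      hence "norm (b (Suc n) - b n) \<le> norm (h (Suc n) - h n) / real (Suc (Suc n)) + norm (h n) / (real (Suc n) * real (Suc (Suc n)))"
        using norm_triangle_ineq4 by (metis norm_divide norm_mult norm_of_nat)
      also have "\<dots> \<le> (C * sqrt (real (Suc n)) / real (Suc n)) / real (Suc n) + (C * sqrt (real (Suc n))) / (real (Suc n) * real (Suc n))"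
        using h[of n] hd[of n] \<open>0 \<le> C\<close> by (intro add_mono frac_le mult_left_mono) auto
      finally show ?thesis by (simp add: power2_eq_square)
    qed
    have "summable (\<lambda>n. norm (b (Suc n) - b n))"
      by (rule summable_comparison_test'[OF summable_mult[OF summable_three_halves, of "2 * C"]]) (use bd in simp)
    moreover have "b \<longlonglongrightarrow> 0"
    proof (rule Lim_null_comparison)
      show "\<forall>\<^sub>F n in sequentially. norm (b n) \<le> C * (1 / sqrt (real (Suc n)))"
      proof (intro always_eventually allI)
        fix n
        have "norm (b n) \<le> C * sqrt (real (Suc n)) / real (Suc n)"
          unfolding b_def norm_divide norm_of_nat using h[of n] by (intro divide_right_mono) auto
        also have "\<dots> = C * (1 / sqrt (real (Suc n)))" by (simp add: field_simps del: of_nat_Suc)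
        finally show "norm (b n) \<le> C * (1 / sqrt (real (Suc n)))" .
      qed
      have "(\<lambda>n. C * sqrt (1 / real n)) \<longlonglongrightarrow> C * sqrt 0"
        by (intro tendsto_intros lim_1_over_n)
      hence "(\<lambda>n. C * (1 / sqrt (real n))) \<longlonglongrightarrow> 0" by (simp add: real_sqrt_divide)
      thus "(\<lambda>n. C * (1 / sqrt (real (Suc n)))) \<longlonglongrightarrow> 0" by (rule LIMSEQ_Suc)
    qed
    ultimately have "summable (\<lambda>n. z ^ n * b n)"
      by (intro summable_power_mult_bounded_variation[OF z z1])
    hence "summable (\<lambda>n. z * (z ^ n * b n))" by (rule summable_mult)
    thus ?thesis using True by (simp add: b_def mult_ac)
  qed
  thus ?thesis unfolding Cons zs h_def summable_iff_convergent by (simp only: mpl_trunc_Cons_eq[abs_def])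
qed

text \<open>Discharges the convergence clause of \<open>cmzv_index\<close>: roots of unity have norm
  1, so \<open>convergent_mpl_trunc\<close> applies.\<close>

lemma cmzv_indexI:
  assumes "0 < N" "length s = length z" "\<forall>j\<in>set s. 0 < j" "sum_list s = k" "\<forall>w\<in>set z. w ^ N = 1"
    "s \<noteq> [] \<longrightarrow> (hd s, hd z) \<noteq> (1, 1)"
  shows "cmzv_index k N s z"
proof -
  have "norm w = 1" if "w ^ N = 1" for w :: complex
  proof -
    have "norm w ^ N = 1" using that by (metis norm_one norm_power)
    thus ?thesis using \<open>0 < N\<close> power_eq_imp_eq_base[of "norm w" N 1] by simp
  qed
  hence "convergent (mpl_trunc s z)" using assms by (intro convergent_mpl_trunc) auto
  thus ?thesis using assms by (simp add: cmzv_index_def)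
qed

section \<open>The rational span and the stuffle product\<close>

lemma mpl_LIMSEQ: "cmzv_index k N s z \<Longrightarrow> mpl_trunc s z \<longlonglongrightarrow> mpl s z"
  by (simp add: cmzv_index_def mpl_def convergent_LIMSEQ_iff)

lemma mpl_in_cmzv_space: "cmzv_index k N s z \<Longrightarrow> mpl s z \<in> cmzv_space k N"
  unfolding cmzv_space_def
  by (intro CollectI exI[of _ "{(s, z)}"] exI[of _ "\<lambda>_. 1"]) simp

lemma cmzv_space_0: "0 \<in> cmzv_space k N"
  unfolding cmzv_space_def by (intro CollectI exI[of _ "{}"]) simp

lemma cmzv_space_add:
  assumes "x \<in> cmzv_space k N" "y \<in> cmzv_space k N"
  shows "x + y \<in> cmzv_space k N"
proof -
  define f where "f = (\<lambda>p. mpl (fst p) (snd p))"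
  obtain A c where A: "finite A" "\<forall>(s, z)\<in>A. cmzv_index k N s z" "x = (\<Sum>p\<in>A. of_rat (c p) * f p)"
    using assms(1) by (auto simp: cmzv_space_def f_def case_prod_unfold)
  obtain B d where B: "finite B" "\<forall>(s, z)\<in>B. cmzv_index k N s z" "y = (\<Sum>p\<in>B. of_rat (d p) * f p)"
    using assms(2) by (auto simp: cmzv_space_def f_def case_prod_unfold)
  \<comment> \<open>Coefficients are extended by 0 outside their own index set, so both combinations
    run over the union.\<close>
  define e where "e p = (if p \<in> A then c p else 0) + (if p \<in> B then d p else 0)" for p
  have "(\<Sum>p\<in>A. of_rat (c p) * f p) = (\<Sum>p\<in>A \<union> B. of_rat (if p \<in> A then c p else 0) * f p)"
    using A B by (intro sum.mono_neutral_cong_left) auto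
  moreover have "(\<Sum>p\<in>B. of_rat (d p) * f p) = (\<Sum>p\<in>A \<union> B. of_rat (if p \<in> B then d p else 0) * f p)"
    using A B by (intro sum.mono_neutral_cong_left) auto
  ultimately have "x + y = (\<Sum>p\<in>A \<union> B. of_rat (e p) * f p)"
    unfolding A B e_def of_rat_add distrib_right sum.distrib by simp
  thus ?thesis
    unfolding cmzv_space_def using A B
    by (intro CollectI exI[of _ "A \<union> B"] exI[of _ e]) (auto simp: f_def case_prod_unfold)
qed

lemma cmzv_space_scale:
  assumes "x \<in> cmzv_space k N"
  shows "of_rat q * x \<in> cmzv_space k N"
proof -
  obtain A c where A: "finite A" "\<forall>(s, z)\<in>A. cmzv_index k N s z" "x = (\<Sum>(s, z)\<in>A. of_rat (c (s, z)) * mpl s z)"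
    using assms by (auto simp: cmzv_space_def)
  have "of_rat q * x = (\<Sum>(s, z)\<in>A. of_rat (q * c (s, z)) * mpl s z)"
    unfolding A sum_distrib_left by (simp add: case_prod_unfold of_rat_mult mult.assoc)
  thus ?thesis unfolding cmzv_space_def using A
    by (intro CollectI exI[of _ A] exI[of _ "\<lambda>p. q * c p"]) simp
qed

lemma cmzv_space_diff: "x \<in> cmzv_space k N \<Longrightarrow> y \<in> cmzv_space k N \<Longrightarrow> x - y \<in> cmzv_space k N"
  using cmzv_space_add[of x k N "of_rat (- 1) * y"] cmzv_space_scale[of y k N "- 1"] by simp

lemma cmzv_space_sum:
  "(\<And>i. i \<in> I \<Longrightarrow> f i \<in> cmzv_space k N) \<Longrightarrow> sum f I \<in> cmzv_space k N"
  by (induction I rule: infinite_finite_induct) (auto intro: cmzv_space_0 cmzv_space_add)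

text \<open>The quasi-shuffle of the single letter (s, w) with a word. The three alternatives
  correspond to the new summation index being larger than, equal to or smaller than the leading
  index of the word. Depth one suffices, because the factor to be multiplied in is built from mpl
  values of depth one.\<close>

fun stuffle1 :: "nat \<Rightarrow> complex \<Rightarrow> nat list \<Rightarrow> complex list \<Rightarrow> (nat list \<times> complex list) list" where
  "stuffle1 s w (t # ts) (z # zs) = (s # t # ts, w # z # zs) # ((s + t) # ts, (w * z) # zs) #
     map (\<lambda>(a, b). (t # a, z # b)) (stuffle1 s w ts zs)"
| "stuffle1 s w _ _ = [([s], [w])]"

text \<open>The product formula is exact at every truncation level: raising the bound by 1 adds the
  boundary terms f, g and f g, which match the three alternatives. Limits are taken only afterwards,
  when all terms are known to converge.\<close>

lemma mpl_trunc_stuffle1: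
  assumes "length ts = length zs"
  shows "mpl_trunc [s] [w] N * mpl_trunc ts zs N = (\<Sum>(a, b)\<leftarrow>stuffle1 s w ts zs. mpl_trunc a b N)"
  using assms
proof (induction ts zs arbitrary: N rule: list_induct2)
  case (Cons t ts z zs)
  have sum: "(\<Sum>(a, b)\<leftarrow>map (\<lambda>(a, b). (t # a, z # b)) xs. mpl_trunc a b (Suc N)) =
      (\<Sum>(a, b)\<leftarrow>map (\<lambda>(a, b). (t # a, z # b)) xs. mpl_trunc a b N) +
      z ^ Suc N / of_nat (Suc N) ^ t * (\<Sum>(a, b)\<leftarrow>xs. mpl_trunc a b N)" for xs N
    by (induction xs) (auto simp: mpl_trunc_Cons_Suc algebra_simps simp del: mpl_trunc.simps(2) power_Suc of_nat_Suc)
  show ?case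
  proof (induction N)
    case 0
    have "(\<Sum>(a, b)\<leftarrow>map (\<lambda>(a, b). (t # a, z # b)) xs. mpl_trunc a b 0) = 0" for xs
      by (induction xs) auto
    thus ?case by simp
  next
    case (Suc N)
    define f where "f = w ^ Suc N / of_nat (Suc N) ^ s"
    define g where "g = z ^ Suc N / of_nat (Suc N) ^ t"
    have fg: "(w * z) ^ Suc N / of_nat (Suc N) ^ (s + t) = f * g"
      by (simp only: f_def g_def power_mult_distrib power_add times_divide_times_eq)
    have "mpl_trunc [s] [w] (Suc N) * mpl_trunc (t # ts) (z # zs) (Suc N) =
        mpl_trunc [s] [w] N * mpl_trunc (t # ts) (z # zs) N + f * mpl_trunc (t # ts) (z # zs) N
        + g * (mpl_trunc [s] [w] N * mpl_trunc ts zs N) + f * g * mpl_trunc ts zs N"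
      unfolding mpl_trunc_Cons_Suc f_def[symmetric] g_def[symmetric] by (simp add: algebra_simps del: mpl_trunc.simps(2))
    also have "\<dots> = (\<Sum>(a, b)\<leftarrow>stuffle1 s w (t # ts) (z # zs). mpl_trunc a b (Suc N))"
      unfolding Suc Cons.IH stuffle1.simps list.map sum_list.Cons prod.case mpl_trunc_Cons_Suc sum
        f_def[symmetric] g_def[symmetric] fg by (simp only: algebra_simps)
    finally show ?case .
  qed
qed simp

lemma stuffle1_admissible:
  assumes "length ts = length zs" "\<forall>t\<in>set ts. 0 < t" "\<forall>z\<in>set zs. z ^ N = 1" "0 < s" "w ^ N = 1"
    "(a, b) \<in> set (stuffle1 s w ts zs)"
  shows "length a = length b \<and> (\<forall>t\<in>set a. 0 < t) \<and> (\<forall>z\<in>set b. z ^ N = 1) \<and> sum_list a = s + sum_list ts"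
  using assms(1-3,6)
proof (induction ts zs arbitrary: a b rule: list_induct2)
  case Nil
  thus ?case using assms(4,5) by simp
next
  case (Cons t ts z zs)
  have wz: "(w * z) ^ N = 1" using Cons.prems(2) assms(5) by (simp add: power_mult_distrib)
  from Cons.prems(3) consider "a = s # t # ts" "b = w # z # zs" | "a = (s + t) # ts" "b = (w * z) # zs"
    | a' b' where "(a', b') \<in> set (stuffle1 s w ts zs)" "a = t # a'" "b = z # b'"
    by auto
  thus ?case
  proof cases
    case 1
    thus ?thesis using Cons.prems(1,2) Cons.hyps assms(4,5) by simp
  next
    case 2
    thus ?thesis using Cons.prems(1,2) Cons.hyps assms(4) wz by simp
  next
    case 3
    have "length a' = length b' \<and> (\<forall>t\<in>set a'. 0 < t) \<and> (\<forall>z\<in>set b'. z ^ N = 1) \<and> sum_list a' = s + sum_list ts"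
      using Cons.prems(1,2) by (intro Cons.IH[OF _ _ 3(1)]) auto
    thus ?thesis using Cons.prems(1,2) 3 by simp
  qed
qed

text \<open>The leading pair of a term comes from one of the two factors or is a merged one, and a
  merged exponent s + t is at least 2; so no term starts with (1, 1).\<close>

lemma stuffle1_hd:
  assumes "length ts = length zs" "\<forall>t\<in>set ts. 0 < t" "0 < s" "(s, w) \<noteq> (1, 1)"
    "ts \<noteq> [] \<longrightarrow> (hd ts, hd zs) \<noteq> (1, 1)" "(a, b) \<in> set (stuffle1 s w ts zs)"
  shows "(hd a, hd b) \<noteq> (1, 1)"
  using assms by (cases ts; cases zs) auto

lemma cmzv_space_mult_mpl:
  assumes N: "0 < N" and s: "cmzv_index s N [s] [w]" and t: "cmzv_index k N ts zs"
  shows "mpl [s] [w] * mpl ts zs \<in> cmzv_space (s + k) N"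
proof -
  have s': "0 < s" "w ^ N = 1" "(s, w) \<noteq> (1, 1)" using s by (auto simp: cmzv_index_def)
  have t': "length ts = length zs" "\<forall>t\<in>set ts. 0 < t" "\<forall>z\<in>set zs. z ^ N = 1" "sum_list ts = k"
    "ts \<noteq> [] \<longrightarrow> (hd ts, hd zs) \<noteq> (1, 1)"
    using t by (auto simp: cmzv_index_def)
  have adm: "cmzv_index (s + k) N a b" if "(a, b) \<in> set (stuffle1 s w ts zs)" for a b
    using stuffle1_admissible[OF t'(1-3) s'(1,2) that] stuffle1_hd[OF t'(1,2) s'(1,3) t'(5) that] t'(4) N
    by (intro cmzv_indexI) auto
  have "(\<lambda>M. mpl_trunc [s] [w] M * mpl_trunc ts zs M) \<longlonglongrightarrow> mpl [s] [w] * mpl ts zs"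
    by (intro tendsto_mult mpl_LIMSEQ[OF s] mpl_LIMSEQ[OF t])
  moreover have "(\<lambda>M. \<Sum>(a, b)\<leftarrow>xs. mpl_trunc a b M) \<longlonglongrightarrow> (\<Sum>(a, b)\<leftarrow>xs. mpl a b)"
    if "\<forall>(a, b)\<in>set xs. cmzv_index (s + k) N a b" for xs
    using that by (induction xs) (auto intro!: tendsto_add mpl_LIMSEQ)
  from this[of "stuffle1 s w ts zs"] adm
  have "(\<lambda>M. mpl_trunc [s] [w] M * mpl_trunc ts zs M) \<longlonglongrightarrow> (\<Sum>(a, b)\<leftarrow>stuffle1 s w ts zs. mpl a b)"
    unfolding mpl_trunc_stuffle1[OF t'(1)] by blast
  ultimately have "mpl [s] [w] * mpl ts zs = (\<Sum>(a, b)\<leftarrow>stuffle1 s w ts zs. mpl a b)"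
    by (rule LIMSEQ_unique)
  moreover have "(\<Sum>(a, b)\<leftarrow>xs. mpl a b) \<in> cmzv_space (s + k) N"
    if "\<forall>(a, b)\<in>set xs. cmzv_index (s + k) N a b" for xs
    using that by (induction xs) (auto intro!: cmzv_space_add cmzv_space_0 mpl_in_cmzv_space)
  ultimately show ?thesis using adm by auto
qed

lemma cmzv_space_mult:
  assumes N: "0 < N" and s: "cmzv_index s N [s] [w]" and x: "x \<in> cmzv_space k N"
  shows "mpl [s] [w] * x \<in> cmzv_space (s + k) N"
proof -
  obtain A c where A: "finite A" "\<forall>(t, z)\<in>A. cmzv_index k N t z" "x = (\<Sum>p\<in>A. of_rat (c p) * mpl (fst p) (snd p))"
    using x by (auto simp: cmzv_space_def case_prod_unfold)
  have "mpl [s] [w] * x = (\<Sum>p\<in>A. of_rat (c p) * (mpl [s] [w] * mpl (fst p) (snd p)))"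
    unfolding A sum_distrib_left by (simp add: mult_ac)
  also have "\<dots> \<in> cmzv_space (s + k) N"
    using A(2) by (intro cmzv_space_sum cmzv_space_scale cmzv_space_mult_mpl[OF N s]) auto
  finally show ?thesis .
qed

text \<open>The Leibniz series: Li_1(i) - Li_1(-i) is 2 i arctan 1, half of i pi.\<close>

lemma i_pi_mpl:
  "\<i> * of_real pi = 2 * (mpl [1] [\<i>] - mpl [1] [- \<i>])"
proof -
  have adm: "cmzv_index 1 12 [1] [\<i>]" "cmzv_index 1 12 [1] [- \<i>]"
    by (intro cmzv_indexI; simp add: complex_eq_iff)+
  have "(\<lambda>n. mpl_trunc [1] [\<i>] n - mpl_trunc [1] [- \<i>] n) \<longlonglongrightarrow> mpl [1] [\<i>] - mpl [1] [- \<i>]"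
    by (intro tendsto_diff mpl_LIMSEQ[OF adm(1)] mpl_LIMSEQ[OF adm(2)])
  hence 1: "(\<lambda>n. mpl_trunc [1] [\<i>] (2 * n) - mpl_trunc [1] [- \<i>] (2 * n)) \<longlonglongrightarrow> mpl [1] [\<i>] - mpl [1] [- \<i>]"
    by (rule LIMSEQ_subseq_LIMSEQ[unfolded o_def]) (simp add: strict_mono_def)
  \<comment> \<open>Even powers of i and -i agree and drop out, so a truncation at 2n leaves n terms
    of the Leibniz series.\<close>
  have eq: "mpl_trunc [1] [\<i>] (2 * n) - mpl_trunc [1] [- \<i>] (2 * n) =
      2 * \<i> * of_real (\<Sum>k<n. (- 1) ^ k * 1 / real (k * 2 + 1))" for n
  proof (induction n)
    case (Suc n)
    define a b :: complex where "a = 1 / of_nat (Suc (2 * n))" and "b = 1 / of_nat (Suc (Suc (2 * n)))"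
    have pw: "\<i> ^ Suc (2 * n) = (- 1) ^ n * \<i>" "(- \<i>) ^ Suc (2 * n) = - ((- 1) ^ n * \<i>)"
      "\<i> ^ Suc (Suc (2 * n)) = - ((- 1) ^ n)" "(- \<i>) ^ Suc (Suc (2 * n)) = - ((- 1) ^ n)"
      by (simp_all add: power_mult)
    have "2 * Suc n = Suc (Suc (2 * n))" by simp
    hence "mpl_trunc [1] [\<i>] (2 * Suc n) - mpl_trunc [1] [- \<i>] (2 * Suc n)
        = mpl_trunc [1] [\<i>] (2 * n) - mpl_trunc [1] [- \<i>] (2 * n) + 2 * ((- 1) ^ n * \<i>) * a"
      unfolding a_def by (simp only: mpl_trunc_Cons_Suc mpl_trunc.simps(1) pw power_one_right) (simp add: algebra_simps del: mpl_trunc.simps(2))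
    also have "a = of_real (1 / real (n * 2 + 1))" by (simp add: a_def add.commute mult.commute)
    finally show ?case unfolding Suc.IH by (simp add: algebra_simps)
  qed simp
  have "summable (\<lambda>k. (- 1) ^ k * 1 / real (k * 2 + 1))"
    using summable_arctan_series[of 1] by simp
  hence "(\<lambda>k. (- 1) ^ k * 1 / real (k * 2 + 1)) sums (pi / 4)"
    unfolding pi_series by (rule summable_sums)
  hence "(\<lambda>n. 2 * \<i> * of_real (\<Sum>k<n. (- 1) ^ k * 1 / real (k * 2 + 1))) \<longlonglongrightarrow> 2 * \<i> * of_real (pi / 4)"
    unfolding sums_def by (intro tendsto_intros)
  with 1 have e: "mpl [1] [\<i>] - mpl [1] [- \<i>] = 2 * \<i> * of_real (pi / 4)"
    unfolding eq by (rule LIMSEQ_unique)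
  show ?thesis unfolding e by simp
qed

text \<open>Subtracting the values at -x from those at x keeps only odd outer indices, doubled,
  hence the factor 1/2. For the outer index 2n+1 the inner index runs up to 2n, and adding the inner
  roots 1 and -1 yields exactly H_n. As x is neither 1 nor -1, the leading pair is admissible even
  for p = 1.\<close>

lemma odd_harmonic_sums:
  assumes p: "0 < p" and x: "x ^ N = 1" "(- x) ^ N = 1" "even N" "0 < N" and x2: "x \<noteq> 1" "x \<noteq> - 1"
  shows "\<exists>X\<in>cmzv_space (p + 1) N. (\<lambda>n. harm n / of_nat (2 * n + 1) ^ p * x ^ (2 * n + 1)) sums X"
proof -
  have adm: "cmzv_index (p + 1) N [p, 1] [y, e]" if "y \<in> {x, - x}" "e \<in> {1, -1}" for y e
  proof (rule cmzv_indexI)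
    have "y ^ N = 1" "e ^ N = 1" using that x by auto
    thus "\<forall>w\<in>set [y, e]. w ^ N = 1" by simp
    have "y \<noteq> 1" using that(1) x2 by (metis insertE singletonD minus_minus)
    thus "[p, 1] \<noteq> [] \<longrightarrow> (hd [p, 1], hd [y, e]) \<noteq> (1, 1)" by simp
  qed (use p x in simp_all)
  define T where "T n = mpl_trunc [p, 1] [x, 1] n + mpl_trunc [p, 1] [x, - 1] n
      - mpl_trunc [p, 1] [- x, 1] n - mpl_trunc [p, 1] [- x, - 1] n" for n
  define X where "X = of_rat (1 / 2) * (mpl [p, 1] [x, 1] + mpl [p, 1] [x, - 1] - mpl [p, 1] [- x, 1] - mpl [p, 1] [- x, - 1])"
  have "(\<lambda>n. of_rat (1 / 2) * T n) \<longlonglongrightarrow> X"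
    unfolding T_def X_def by (intro tendsto_intros mpl_LIMSEQ[OF adm]) auto
  hence "(\<lambda>n. of_rat (1 / 2) * T (2 * n)) \<longlonglongrightarrow> X"
    by (rule LIMSEQ_subseq_LIMSEQ[unfolded o_def]) (simp add: strict_mono_def)
  moreover have "of_rat (1 / 2) * T (2 * n) = (\<Sum>k<n. harm k / of_nat (2 * k + 1) ^ p * x ^ (2 * k + 1))" for n
  proof (induction n)
    case (Suc n)
    have in1: "mpl_trunc [1] [1] (2 * n) + mpl_trunc [1] [- 1] (2 * n) = harm n"
    proof (induction n)
      case (Suc n)
      define a b :: complex where "a = 1 / of_nat (Suc (2 * n))" and "b = 1 / of_nat (Suc (Suc (2 * n)))"
      have "2 * Suc n = Suc (Suc (2 * n))" by simp
      hence "mpl_trunc [1] [1] (2 * Suc n) + mpl_trunc [1] [- 1] (2 * Suc n)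
          = mpl_trunc [1] [1] (2 * n) + mpl_trunc [1] [- 1] (2 * n) + (a + b - a + b)"
        unfolding a_def b_def
        by (simp only: mpl_trunc_Cons_Suc mpl_trunc.simps(1) power_one_right) (simp del: mpl_trunc.simps(2) of_nat_Suc)
      also have "a + b - a + b = inverse (of_nat (Suc n))"
      proof -
        have "of_nat (Suc (Suc (2 * n))) = 2 * (of_nat (Suc n) :: complex)" by simp
        hence b: "b = inverse (of_nat (Suc n)) / 2" unfolding b_def by (simp add: field_simps del: of_nat_Suc)
        have halves: "y / 2 + y / 2 = y" for y :: complex by (simp add: field_simps)
        have "a + b - a + b = b + b" by simp
        also have "\<dots> = inverse (of_nat (Suc n))" unfolding b by (rule halves)
        finally show ?thesis .
      qed
      finally show ?case unfolding Suc.IH harm_Suc .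
    qed (simp add: harm_def)
    define u v where "u = x ^ Suc (2 * n) / of_nat (Suc (2 * n)) ^ p" and "v = x ^ Suc (Suc (2 * n)) / of_nat (Suc (Suc (2 * n))) ^ p"
    have pw: "(- x) ^ Suc (2 * n) / of_nat (Suc (2 * n)) ^ p = - u" "(- x) ^ Suc (Suc (2 * n)) / of_nat (Suc (Suc (2 * n))) ^ p = v"
      by (simp_all add: u_def v_def)
    have "2 * Suc n = Suc (Suc (2 * n))" by simp
    \<comment> \<open>The terms \<open>v\<close> of even outer index occur with both signs and
      cancel.\<close>
    hence "T (2 * Suc n) = T (2 * n) + 2 * u * (mpl_trunc [1] [1] (2 * n) + mpl_trunc [1] [- 1] (2 * n))
      + v * (mpl_trunc [1] [1] (Suc (2 * n)) + mpl_trunc [1] [- 1] (Suc (2 * n)))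
      - v * (mpl_trunc [1] [1] (Suc (2 * n)) + mpl_trunc [1] [- 1] (Suc (2 * n)))"
      unfolding T_def
      by (simp only: mpl_trunc_Cons_Suc[of p] pw u_def[symmetric] v_def[symmetric]) (simp add: algebra_simps del: mpl_trunc.simps(2))
    hence "T (2 * Suc n) = T (2 * n) + 2 * u * harm n" unfolding in1 by simp
    hence "of_rat (1 / 2) * T (2 * Suc n) = of_rat (1 / 2) * T (2 * n) + u * harm n"
      by (simp add: of_rat_divide)
    also have "u * harm n = harm n / of_nat (2 * n + 1) ^ p * x ^ (2 * n + 1)"
      by (simp add: u_def)
    finally show ?case unfolding Suc.IH sum.lessThan_Suc .
  qed (simp add: T_def)
  ultimately have "(\<lambda>n. harm n / of_nat (2 * n + 1) ^ p * x ^ (2 * n + 1)) sums X"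
    unfolding sums_def by simp
  moreover have "X \<in> cmzv_space (p + 1) N"
    unfolding X_def by (intro cmzv_space_scale cmzv_space_diff cmzv_space_add mpl_in_cmzv_space adm) auto
  ultimately show ?thesis by blast
qed

text \<open>Real and imaginary parts are not operations of the space, but conjugation merely
  replaces the root cis(pi/6) by its conjugate. So B - B' stands for 2 i Im B and A + A' for 2 Re A.
  Dividing the value by i makes both contributions rational: the first i disappears, and pi is
  accompanied by the i needed to write it in weight 1.\<close>

lemma sin_sum_in_cmzv_space: "complex_of_real (sin_sum (pi / 6)) \<in> (\<lambda>x. \<i> * x) ` cmzv_space 3 12"
proof -
  define w where "w = cis (pi / 6)"
  have im: "Im w = 1 / 2" by (simp add: w_def sin_30)
  have w12: "w ^ 12 = 1"
  proof -
    have "w ^ 12 = cis (real 12 * (pi / 6))" unfolding w_def by (rule Complex.DeMoivre)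
    also have "real 12 * (pi / 6) = 2 * pi" by simp
    finally show ?thesis by simp
  qed
  have root: "x ^ 12 = 1" "(- x) ^ 12 = 1" "x \<noteq> 1" "x \<noteq> - 1" if "x \<in> {w, cnj w}" for x
  proof -
    have "cnj w ^ 12 = 1" using w12 by (metis complex_cnj_one complex_cnj_power)
    thus "x ^ 12 = 1" using that w12 by auto
    thus "(- x) ^ 12 = 1" by simp
    have "Im x \<noteq> 0" using that im by auto
    thus "x \<noteq> 1" "x \<noteq> - 1" by auto
  qed
  have ex: "\<exists>X\<in>cmzv_space k 12. (\<lambda>n. harm n / of_nat (2 * n + 1) ^ p * x ^ (2 * n + 1)) sums X"
    if "x \<in> {w, cnj w}" "0 < p" "k = p + 1" for x p k
    unfolding that(3) by (rule odd_harmonic_sums[OF that(2) root(1,2)[OF that(1)] _ _ root(3,4)[OF that(1)]]) simp_all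
  have "\<exists>X\<in>cmzv_space 2 12. (\<lambda>n. harm n / of_nat (2 * n + 1) ^ 1 * w ^ (2 * n + 1)) sums X"
    by (rule ex) simp_all
  then obtain A where A: "A \<in> cmzv_space 2 12" "(\<lambda>n. harm n / of_nat (2 * n + 1) ^ 1 * w ^ (2 * n + 1)) sums A"
    by (rule bexE)
  have "\<exists>X\<in>cmzv_space 2 12. (\<lambda>n. harm n / of_nat (2 * n + 1) ^ 1 * cnj w ^ (2 * n + 1)) sums X"
    by (rule ex) simp_all
  then obtain A' where A': "A' \<in> cmzv_space 2 12" "(\<lambda>n. harm n / of_nat (2 * n + 1) ^ 1 * cnj w ^ (2 * n + 1)) sums A'"
    by (rule bexE)
  have "\<exists>X\<in>cmzv_space 3 12. (\<lambda>n. harm n / of_nat (2 * n + 1) ^ 2 * w ^ (2 * n + 1)) sums X"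
    by (rule ex) simp_all
  then obtain B where B: "B \<in> cmzv_space 3 12" "(\<lambda>n. harm n / of_nat (2 * n + 1) ^ 2 * w ^ (2 * n + 1)) sums B"
    by (rule bexE)
  have "\<exists>X\<in>cmzv_space 3 12. (\<lambda>n. harm n / of_nat (2 * n + 1) ^ 2 * cnj w ^ (2 * n + 1)) sums X"
    by (rule ex) simp_all
  then obtain B' where B': "B' \<in> cmzv_space 3 12" "(\<lambda>n. harm n / of_nat (2 * n + 1) ^ 2 * cnj w ^ (2 * n + 1)) sums B'"
    by (rule bexE)
  have cnj: "X' = cnj X" if "(\<lambda>n. harm n / of_nat (2 * n + 1) ^ p * w ^ (2 * n + 1)) sums X"
    "(\<lambda>n. harm n / of_nat (2 * n + 1) ^ p * cnj w ^ (2 * n + 1)) sums X'" for p X X'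
  proof -
    have "cnj (harm n) = harm n" for n by (simp add: harm_def)
    hence "(\<lambda>n. harm n / of_nat (2 * n + 1) ^ p * cnj w ^ (2 * n + 1)) sums cnj X"
      using iffD2[OF sums_cnj that(1)] by simp
    with that(2) show ?thesis by (rule sums_unique2)
  qed
  \<comment> \<open>From -i times 4 Im B - (2 pi/3) Re A: the first part is -2 (B - B'), the second
    is (1/3) i pi (A + A'), and i pi = 2 (Li_1(i) - Li_1(-i)) turns 1/3 into 2/3.\<close>
  define x where "x = of_rat (- 2) * (B - B') + of_rat (2 / 3) * (mpl [1] [\<i>] * (A + A') - mpl [1] [- \<i>] * (A + A'))"
  have i12: "cmzv_index 1 12 [1] [\<i>]" "cmzv_index 1 12 [1] [- \<i>]"
    by (intro cmzv_indexI; simp add: complex_eq_iff)+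
  have "mpl [1] [\<i>] * (A + A') \<in> cmzv_space (1 + 2) 12" "mpl [1] [- \<i>] * (A + A') \<in> cmzv_space (1 + 2) 12"
    by (intro cmzv_space_mult i12 cmzv_space_add A A'; simp)+
  moreover have "1 + 2 = (3 :: nat)" by simp
  ultimately have "mpl [1] [\<i>] * (A + A') \<in> cmzv_space 3 12" "mpl [1] [- \<i>] * (A + A') \<in> cmzv_space 3 12"
    by (simp_all only:)
  hence "x \<in> cmzv_space 3 12"
    unfolding x_def by (intro cmzv_space_add cmzv_space_scale cmzv_space_diff B B')
  moreover have "complex_of_real (sin_sum (pi / 6)) = \<i> * x"
  proof -
    have "sin_sum (pi / 6) = 4 * (Im B - pi / 6 * Re A)"
      by (rule sin_sum_eq_harm_sums) (use A(2) B(2) in \<open>simp_all add: w_def\<close>)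
    moreover have "x = - 2 * (B - cnj B) + 1 / 3 * (\<i> * of_real pi) * (A + cnj A)"
      unfolding x_def i_pi_mpl cnj[OF A(2) A'(2)] cnj[OF B(2) B'(2)]
      by (simp add: of_rat_divide of_rat_minus field_simps)
    ultimately show ?thesis by (simp add: complex_eq_iff)
  qed
  ultimately show ?thesis by blast
qed

theorem theorem1:
  defines "G \<equiv> Im (polylog 3 ((1 + \<i>) / 2 :: complex))"
  defines "V \<equiv> 32 * G / 3 - 4 * pi * polylog 2 (2 - sqrt 3 :: real) / 3 - pi ^ 3 / 9
                - pi * (ln 2 - ln (2 + sqrt 3)) ^ 2 / 3"
  shows "(\<lambda>n::nat. 1 / ((2 * real n + 1) ^ 3 * real ((2 * n) choose n))) sums V \<and>
         complex_of_real V \<in> (\<lambda>x. \<i> * x) ` cmzv_space 3 12"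
proof -
  have "sin_sum (pi / 6) = V"
    unfolding V_def G_def by (rule sums_unique2[OF sin_sum_pi_sixth series_closed_form])
  thus ?thesis using sin_sum_pi_sixth sin_sum_in_cmzv_space by simp
qed

end
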